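(* Let $T(z)=(z-i)/(z+i)$. If $\varphi\in\mathrm{SS}(\mathbb S)$, then $h=T^{-1}\circ\varphi\circ T\in\mathrm{SS}(\mathbb R)$. The converse does not necessarily hold. In other words, there exists $h\in\mathrm{SS}(\mathbb R)$ such that $\varphi=T\circ h\circ T^{-1}\notin\mathrm{SS}(\mathbb S)$.
   Context: $\mathbb S$ is the unit circle. The Cayley transformation $T(z)=(z-i)/(z+i)$ maps the upper half-plane onto the unit disk and $\mathbb R\cup\{\infty\}$ onto $\mathbb S$ with $T(\infty)=1$; homeomorphisms of $\mathbb R$ are extended by $\infty\mapsto\infty$. A weight is a locally integrable non-negative measurable function $\omega$ on $\mathbb R$. It is an $A_\infty$-weight if there are constants $C,\alpha>0$ such that $\frac{\int_E\omega}{\int_I\omega}\le C\left(\frac{|E|}{|I|}\right)^{\alpha}$ for every bounded closed interval $I$ and every measurable $E\subset I$. A locally integrable $u$ on $\mathbb R$ is in $\mathrm{BMO}(\mathbb R)$ if $\sup_I\frac1{|I|}\int_I|u-u_I|<\infty$ (over bounded intervals, $u_I$ the mean of $u$ over $I$), and in $\mathrm{VMO}(\mathbb R)$ if in addition $\frac1{|I|}\int_I|u-u_I|\to0$ as $|I|\to0$ (uniformly in $I$). $A_\infty$-weights, $\mathrm{BMO}(\mathbb S)$ and $\mathrm{VMO}(\mathbb S)$ are defined in the same way on $\mathbb S$ with arcs and arc length. $\mathrm{SS}(\mathbb R)$ (strongly symmetric homeomorphisms of $\mathbb R$) is the set of increasing homeomorphisms $h$ of $\mathbb R$ onto itself that are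 locally absolutely continuous with $h'$ an $A_\infty$-weight on $\mathbb R$ and $\log h'\in\mathrm{VMO}(\mathbb R)$. $\mathrm{SS}(\mathbb S)$ is defined similarly: it is the set of sense-preserving homeomorphisms $\varphi$ of $\mathbb S$ onto itself that are absolutely continuous with $|\varphi'|$ an $A_\infty$-weight on $\mathbb S$ and $\log|\varphi'|\in\mathrm{VMO}(\mathbb S)$.
   Formalization: The first claim is stated for φ ∈ SS(S) with φ(1) = 1; without this normalization h = T⁻¹∘φ∘T need not map R to itself (for example φ(z) = −z gives h(x) = −1/x). *)

theory Defs
  imports "HOL-Analysis.Analysis" "HOL-Complex_Analysis.Complex_Analysis"
begin

section \<open>Weights and mean oscillation\<close>

text \<open>The line and the circle are treated uniformly: \<open>M\<close> is a measure and \<open>\<I>\<close> is the family of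
  intervals (arcs) over which averages are taken. Functions matter only up to null sets, so that
  derivatives existing almost everywhere can be plugged in.\<close>

definition locally_integrable :: "'a measure \<Rightarrow> 'a set set \<Rightarrow> ('a \<Rightarrow> real) \<Rightarrow> bool" where
  "locally_integrable M \<I> u \<longleftrightarrow> u \<in> borel_measurable M \<and> (\<forall>I\<in>\<I>. set_integrable M I u)"

definition weight :: "'a measure \<Rightarrow> 'a set set \<Rightarrow> ('a \<Rightarrow> real) \<Rightarrow> bool" where
  "weight M \<I> \<omega> \<longleftrightarrow> locally_integrable M \<I> \<omega> \<and> (AE x in M. 0 \<le> \<omega> x)"

text \<open>Positivity of the integral over each interval only makes the quotient meaningful; it
  prevents the zero weight from qualifying through \<open>0 / 0 = 0\<close>.\<close>

definition A_infinity :: "'a measure \<Rightarrow> 'a set set \<Rightarrow> ('a \<Rightarrow> real) \<Rightarrow> bool" where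
  "A_infinity M \<I> \<omega> \<longleftrightarrow> weight M \<I> \<omega> \<and>
     (\<forall>I\<in>\<I>. 0 < (LINT x:I|M. \<omega> x)) \<and>
     (\<exists>C>0. \<exists>\<alpha>>0. \<forall>I\<in>\<I>. \<forall>E\<in>sets M. E \<subseteq> I \<longrightarrow>
        (LINT x:E|M. \<omega> x) / (LINT x:I|M. \<omega> x) \<le> C * (measure M E / measure M I) powr \<alpha>)"

definition mean :: "'a measure \<Rightarrow> 'a set \<Rightarrow> ('a \<Rightarrow> real) \<Rightarrow> real" where
  "mean M I u = (LINT x:I|M. u x) / measure M I"

definition mean_oscillation :: "'a measure \<Rightarrow> 'a set \<Rightarrow> ('a \<Rightarrow> real) \<Rightarrow> real" where
  "mean_oscillation M I u = mean M I (\<lambda>x. \<bar>u x - mean M I u\<bar>)"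

definition BMO :: "'a measure \<Rightarrow> 'a set set \<Rightarrow> ('a \<Rightarrow> real) set" where
  "BMO M \<I> = {u. locally_integrable M \<I> u \<and> bdd_above ((\<lambda>I. mean_oscillation M I u) ` \<I>)}"

definition VMO :: "'a measure \<Rightarrow> 'a set set \<Rightarrow> ('a \<Rightarrow> real) set" where
  "VMO M \<I> = {u \<in> BMO M \<I>.
     \<forall>\<epsilon>>0. \<exists>\<delta>>0. \<forall>I\<in>\<I>. measure M I < \<delta> \<longrightarrow> mean_oscillation M I u < \<epsilon>}"

definition intervals :: "real set set" where
  "intervals = {{a..b} |a b. a < b}"

definition arcs :: "complex set set" where
  "arcs = {cis ` {a..b} |a b. a < b \<and> b \<le> a + 2 * pi}"

text \<open>Arc length on the unit circle, completed so that its measurable sets are the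
  Lebesgue measurable subsets of the circle.\<close>

definition arc_length :: "complex measure" where
  "arc_length = completion
     (distr (restrict_space lborel {0..<2*pi}) (restrict_space borel (sphere 0 1)) cis)"

section \<open>Strongly symmetric homeomorphisms\<close>

definition absolutely_continuous_on :: "real set \<Rightarrow> (real \<Rightarrow> 'a::metric_space) \<Rightarrow> bool" where
  "absolutely_continuous_on S f \<longleftrightarrow>
     (\<forall>\<epsilon>>0. \<exists>\<delta>>0. \<forall>(n::nat) u v.
        (\<forall>i<n. u i \<le> v i \<and> {u i..v i} \<subseteq> S) \<and>
        (\<forall>i<n. \<forall>j<n. i \<noteq> j \<longrightarrow> {u i<..<v i} \<inter> {u j<..<v j} = {}) \<and>
        (\<Sum>i<n. v i - u i) < \<delta>
        \<longrightarrow> (\<Sum>i<n. dist (f (u i)) (f (v i))) < \<epsilon>)"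

definition SS_line :: "(real \<Rightarrow> real) set" where
  "SS_line = {h. strict_mono h \<and> (\<exists>g. homeomorphism UNIV UNIV h g) \<and>
     (\<forall>a b. absolutely_continuous_on {a..b} h) \<and>
     A_infinity lebesgue intervals (deriv h) \<and>
     (\<lambda>x. ln (deriv h x)) \<in> VMO lebesgue intervals}"

text \<open>The derivative of a map of the circle, as a limit of difference quotients along the
  circle. Its modulus is the derivative with respect to arc length. As with \<open>deriv\<close>, the
  value is unspecified where the limit does not exist.\<close>

definition circle_deriv :: "(complex \<Rightarrow> complex) \<Rightarrow> complex \<Rightarrow> complex" where
  "circle_deriv \<phi> z = (SOME D. (\<phi> has_field_derivative D) (at z within sphere 0 1))"

text \<open>Maps of the circle are represented by functions on the complex plane, of which only the
  values on the unit circle are relevant. A homeomorphism of the circle is sense-preserving iff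
  its degree, the winding number of the image of the circle, is 1.\<close>

definition SS_circle :: "(complex \<Rightarrow> complex) set" where
  "SS_circle = {\<phi>. (\<exists>\<psi>. homeomorphism (sphere 0 1) (sphere 0 1) \<phi> \<psi>) \<and>
     winding_number (\<phi> \<circ> circlepath 0 1) 0 = 1 \<and>
     absolutely_continuous_on {0..2*pi} (\<lambda>t. \<phi> (cis t)) \<and>
     A_infinity arc_length arcs (\<lambda>z. norm (circle_deriv \<phi> z)) \<and>
     (\<lambda>z. ln (norm (circle_deriv \<phi> z))) \<in> VMO arc_length arcs}"

section \<open>Conjugation by the Cayley transformation\<close>

definition cayley :: "complex \<Rightarrow> complex" where
  "cayley z = (z - \<i>) / (z + \<i>)"

abbreviation cayley_line :: "real \<Rightarrow> complex" where
  "cayley_line x \<equiv> cayley (of_real x)"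

text \<open>Since \<open>cayley_line\<close> is a bijection of the real line onto the circle without 1,
  \<open>inv cayley_line\<close> is the inverse Cayley transformation there. The point 1 corresponds to
  infinity: \<open>to_line\<close> is meant for maps \<open>\<phi>\<close> of the circle with \<open>\<phi> 1 = 1\<close>, and \<open>to_circle\<close>
  uses the extension of \<open>h\<close> that fixes infinity.\<close>

definition to_line :: "(complex \<Rightarrow> complex) \<Rightarrow> real \<Rightarrow> real" where
  "to_line \<phi> x = inv cayley_line (\<phi> (cayley_line x))"

definition to_circle :: "(real \<Rightarrow> real) \<Rightarrow> complex \<Rightarrow> complex" where
  "to_circle h z = (if z = 1 then 1 else cayley_line (h (inv cayley_line z)))"

end

theory Submission
  imports Defs
begin

text \<open>In the coordinate \<open>x\<close> of the line, arc length is \<open>2 dx / (1 + x\<^sup>2)\<close> and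
  \<open>ln h' = ln \<bar>\<phi>'\<bar> \<circ> T + ln (1 + h\<^sup>2) - ln (1 + x\<^sup>2)\<close>. Applied to arcs around \<open>1\<close>, the
  \<open>A\<^sub>\<infinity>\<close> property of \<open>\<bar>\<phi>'\<bar>\<close> gives doubling and power decay of its integral over the tails
  \<open>{R \<le> \<bar>x\<bar>}\<close>; so \<open>1 + \<bar>h\<bar>\<close> is comparable to a constant on each dyadic annulus and grows at least like a
  power. On tame intervals (bounded ones and those within a dyadic annulus) both Cayley
  transformations then have bounded distortion, which transfers the \<open>A\<^sub>\<infinity>\<close> and oscillation bounds
  from the circle; a large interval is a union of dyadic annuli, whose contributions decay
  geometrically. Short intervals are tame, and \<open>ln (1 + h\<^sup>2)\<close> is uniformly continuous because \<open>h\<close> is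
  Hoelder continuous relative to its size, so the mean oscillation tends to zero.

  For the failure of the converse take \<open>h x = x + x\<^sup>3\<close>: \<open>ln h'\<close> is Lipschitz on the line, whereas the
  derivative of the conjugated map vanishes quadratically at \<open>1\<close>, and \<open>ln \<bar>z - 1\<bar>\<close> does not have
  vanishing mean oscillation there.\<close>

section \<open>Differentiation of monotone absolutely continuous functions\<close>

text \<open>Membership in the classes is phrased with pointwise derivatives, the estimates with
  integrals; so a Radon-Nikodym density p of h replaces \<open>deriv h\<close> throughout, and the
  two are identified almost everywhere only at the end. The obstacle is the point 1: a long interval
  of the line corresponds to almost the whole circle, where the hypotheses on the circle say nothing
  at the scale of the interval, and the factor (1 + h^2) / 2 between p and the transported weight is
  unbounded. What helps is that one quantity, the mass \<tau>(R) of the circle weight on {R <= |x|},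
  governs everything: 1 + |h| is of order 1 / \<tau>(R) at |x| = R, so a dyadic annulus has p-mass
  of order 1 / \<tau>(R), and the decay of \<tau> lets the outermost annulus dominate. Summing the
  annuli costs half of the exponent \<alpha>. The identity between the logarithms breaks down at
  zeros of p, so p must be shown to be positive almost everywhere. The converse fails because short
  intervals far out on the line have images much shorter than their distance to 1, whereas VMO on
  the circle also tests arcs that reach 1.\<close>

lemma lmeasurable_outer_open:
  fixes S :: "real set"
  assumes S: "S \<in> lmeasurable" and "0 < e"
  obtains T where "open T" "S \<subseteq> T" "T \<in> lmeasurable" "measure lebesgue T < measure lebesgue S + e"
proof -
  obtain T where T: "open T" "S \<subseteq> T" "(T - S) \<in> lmeasurable" "emeasure lebesgue (T - S) < ennreal e"
    using sets_lebesgue_outer_open[of S e] assms by (auto dest: fmeasurableD)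
  have eq: "T = S \<union> (T - S)" using T by auto
  show thesis
  proof
    show "T \<in> lmeasurable" using S T by (subst eq) (rule fmeasurable.Un)
    have "measure lebesgue T \<le> measure lebesgue S + measure lebesgue (T - S)"
      using S T by (subst eq) (intro measure_Un_le, auto)
    then show "measure lebesgue T < measure lebesgue S + e"
      using T by (simp add: emeasure_eq_measure2 ennreal_less_iff)
  qed fact+
qed

text \<open>The outer measure m of E satisfies m <= \<theta> m up to arbitrarily small errors: take
  an almost optimal cover, enlarge it to an open G and shrink it by the hypothesis. Boundedness
  makes m finite, so m = 0. Outer measure is used because the exceptional sets of differentiation
  are not known to be measurable.\<close>

lemma negligible_if_shrinking_cover:
  fixes E :: "real set"
  assumes "bounded E" "\<theta> < 1"
    and cov: "\<And>G e. open G \<Longrightarrow> G \<in> lmeasurable \<Longrightarrow> E \<subseteq> G \<Longrightarrow> 0 < e \<Longrightarrow>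
      \<exists>B. B \<in> lmeasurable \<and> E \<subseteq> B \<and> measure lebesgue B \<le> \<theta> * measure lebesgue G + e"
    and "0 \<le> \<theta>"
  shows "negligible E"
proof -
  define S where "S = {measure lebesgue B | B. B \<in> lmeasurable \<and> E \<subseteq> B}"
  define m where "m = Inf S"
  obtain c r where "E \<subseteq> cball c r"
    using \<open>bounded E\<close> bounded_subset_cball by blast
  then have "measure lebesgue (cball c r) \<in> S"
    unfolding S_def using lmeasurable_cball by blast
  then have ne: "S \<noteq> {}" by auto
  have bdd: "bdd_below S" unfolding S_def by (auto intro!: bdd_belowI[of _ 0])
  have m0: "0 \<le> m" unfolding m_def using ne by (intro cInf_greatest) (auto simp: S_def)
  \<comment> \<open>One error e each for the almost optimal cover B, its open enlargement G and the
    slack in the new cover.\<close>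
  have step: "m \<le> \<theta> * m + 3 * e" if e: "0 < e" for e
  proof -
    obtain s where "s \<in> S" "s < m + e"
      using cInf_lessD[OF ne, of "m + e"] e unfolding m_def by auto
    then obtain B where B: "B \<in> lmeasurable" "E \<subseteq> B" "measure lebesgue B < m + e"
      unfolding S_def by auto
    obtain G where G: "open G" "B \<subseteq> G" "G \<in> lmeasurable" "measure lebesgue G < measure lebesgue B + e"
      using lmeasurable_outer_open[OF B(1) e] by metis
    obtain B' where B': "B' \<in> lmeasurable" "E \<subseteq> B'" "measure lebesgue B' \<le> \<theta> * measure lebesgue G + e"
      using cov[OF G(1,3) _ e] B G by blast
    have "m \<le> measure lebesgue B'"
      unfolding m_def using B' by (intro cInf_lower bdd) (auto simp: S_def)
    also have "\<dots> \<le> \<theta> * (m + 2 * e) + e"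
      using B'(3) G(4) B(3) mult_left_mono[of "measure lebesgue G" "m + 2 * e" \<theta>] \<open>0 \<le> \<theta>\<close> by linarith
    also have "\<dots> \<le> \<theta> * m + 3 * e"
      using mult_right_mono[of \<theta> 1 "2 * e"] \<open>\<theta> < 1\<close> e by (simp add: algebra_simps)
    finally show ?thesis .
  qed
  have "m * (1 - \<theta>) \<le> 0 + e" if "0 < e" for e
    using step[of "e/3"] that by (simp add: algebra_simps)
  then have "m * (1 - \<theta>) \<le> 0" by (rule field_le_epsilon)
  then have "m \<le> 0" using \<open>\<theta> < 1\<close> by (simp add: mult_le_0_iff)
  show ?thesis unfolding negligible_outer
  proof (intro allI impI)
    fix e :: real assume "0 < e"
    then obtain s where "s \<in> S" "s < e"
      using cInf_lessD[OF ne, of "e"] \<open>m \<le> 0\<close> unfolding m_def by auto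
    then show "\<exists>T. E \<subseteq> T \<and> T \<in> lmeasurable \<and> measure lebesgue T < e"
      unfolding S_def by auto
  qed
qed

text \<open>Intervals are balls about their midpoints, so the covering theorem for balls allows x to
  be an endpoint; one-sided difference quotients need this freedom.\<close>

lemma Vitali_covering_intervals:
  fixes E :: "real set"
  assumes "\<And>x d. x \<in> E \<Longrightarrow> 0 < d \<Longrightarrow> \<exists>u v. u < v \<and> u \<le> x \<and> x \<le> v \<and> v - u < d \<and> P u v"
  obtains C where "countable C" "\<And>u v. (u, v) \<in> C \<Longrightarrow> u < v \<and> P u v"
    "disjoint_family_on (\<lambda>(u, v). {u..v}) C"
    "negligible (E - (\<Union>(u, v)\<in>C. {u..v}))"
proof -
  define K where "K = {(u, v). u < v \<and> P u v}"
  define a where "a = (\<lambda>(u::real, v). (u + v) / 2)"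
  define r where "r = (\<lambda>(u::real, v). (v - u) / 2)"
  have cb: "cball (a i) (r i) = (case i of (u, v) \<Rightarrow> {u..v})" for i
    by (cases i) (auto simp: a_def r_def cball_eq_atLeastAtMost field_simps)
  obtain C where C: "countable C" "C \<subseteq> K"
     "pairwise (\<lambda>i j. disjnt (cball (a i) (r i)) (cball (a j) (r j))) C"
     "negligible (E - (\<Union>i \<in> C. cball (a i) (r i)))"
  proof (rule Vitali_covering_theorem_cballs[of K r E a])
    show "0 < r i" if "i \<in> K" for i using that by (auto simp: K_def r_def)
    show "\<exists>i. i \<in> K \<and> x \<in> cball (a i) (r i) \<and> r i < d" if x: "x \<in> E" "0 < d" for x d
    proof -
      obtain u v where "u < v \<and> u \<le> x \<and> x \<le> v \<and> v - u < d \<and> P u v"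
        using assms[OF x] by metis
      then show ?thesis unfolding cb
        by (intro exI[of _ "(u, v)"]) (auto simp: K_def r_def)
    qed
  qed
  show thesis
  proof (rule that[of C])
    show "disjoint_family_on (\<lambda>(u, v). {u..v}) C"
      using C(3) unfolding cb pairwise_def disjoint_family_on_def disjnt_def by blast
  qed (use C in \<open>auto simp: cb K_def\<close>)
qed

text \<open>The sigma-algebras are left open because both Borel and completed measures are compared
  in this way.\<close>

lemma measure_UN_intervals_le:
  fixes M N :: "real measure"
  assumes "countable C" "disjoint_family_on (\<lambda>(u, v). {u..v}) C"
    and "sets borel \<subseteq> sets M" "sets borel \<subseteq> sets N"
    and "\<And>u v. (u, v) \<in> C \<Longrightarrow> emeasure M {u..v} \<le> c * emeasure N {u..v}"
  shows "emeasure M (\<Union>(u, v)\<in>C. {u..v}) \<le> c * emeasure N (\<Union>(u, v)\<in>C. {u..v})"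
proof -
  have "emeasure M (\<Union>(u, v)\<in>C. {u..v}) = (\<integral>\<^sup>+i. emeasure M (case i of (u, v) \<Rightarrow> {u..v}) \<partial>count_space C)"
    using assms(1-3) by (intro emeasure_UN_countable) auto
  also have "\<dots> \<le> (\<integral>\<^sup>+i. c * emeasure N (case i of (u, v) \<Rightarrow> {u..v}) \<partial>count_space C)"
    using assms by (intro nn_integral_mono) auto
  also have "\<dots> = c * (\<integral>\<^sup>+i. emeasure N (case i of (u, v) \<Rightarrow> {u..v}) \<partial>count_space C)"
    by (intro nn_integral_cmult) auto
  also have "(\<integral>\<^sup>+i. emeasure N (case i of (u, v) \<Rightarrow> {u..v}) \<partial>count_space C)
    = emeasure N (\<Union>(u, v)\<in>C. {u..v})"
    using assms(1,2,4) by (intro emeasure_UN_countable[symmetric]) auto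
  finally show ?thesis .
qed

lemma emeasure_lborel_lmeasurable:
  "A \<in> sets borel \<Longrightarrow> A \<in> lmeasurable \<Longrightarrow> emeasure lborel A = ennreal (measure lebesgue A)"
  using emeasure_eq_measure2[of A lebesgue] emeasure_completion[of A lborel] by auto

lemma lmeasurable_Borel_subset:
  "U \<in> sets borel \<Longrightarrow> U \<subseteq> G \<Longrightarrow> G \<in> lmeasurable \<Longrightarrow> U \<in> lmeasurable"
  by (rule fmeasurableI2) auto

section \<open>Differentiation of an indefinite integral almost everywhere\<close>

locale indefinite_integral =
  fixes f F :: "real \<Rightarrow> real"
  assumes borel [measurable]: "f \<in> borel_measurable borel"
    and nonneg: "\<And>x. 0 \<le> f x"
    and mono: "mono F"
    and Icc: "\<And>a b. a \<le> b \<Longrightarrow> emeasure (density lborel f) {a..b} = ennreal (F b - F a)"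
begin

text \<open>Disjoint intervals with small quotients fill E up to a null set inside G. On their union
  U the integral of f is at most p |U|, while f >= q on \<open>A \<inter> U\<close>, which contains
  almost all of E; so this set has measure at most (p / q) |G|.\<close>

lemma negligible_lower:
  assumes "bounded E" "0 \<le> p" "p < q"
    and fq: "\<And>x. x \<in> E \<Longrightarrow> q \<le> f x"
    and quot: "\<And>x d. x \<in> E \<Longrightarrow> 0 < d \<Longrightarrow> 
       \<exists>u v. u < v \<and> u \<le> x \<and> x \<le> v \<and> v - u < d \<and> F v - F u \<le> p * (v - u)"
  shows "negligible E"
proof (rule negligible_if_shrinking_cover[OF \<open>bounded E\<close>])
  show "p / q < 1" "0 \<le> p / q" using assms by auto
  fix G :: "real set" and e :: real
  assume G: "open G" "G \<in> lmeasurable" "E \<subseteq> G" "0 < e"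
  define P where "P = (\<lambda>u v. {u..v} \<subseteq> G \<and> F v - F u \<le> p * (v - u))"
  have "\<exists>u v. u < v \<and> u \<le> x \<and> x \<le> v \<and> v - u < d \<and> P u v" if x: "x \<in> E" "0 < d" for x d
  proof -
    obtain d' where d': "0 < d'" "ball x d' \<subseteq> G" using G x by (meson openE subsetD)
    obtain u v where uv: "u < v" "u \<le> x" "x \<le> v" "v - u < min d d'" "F v - F u \<le> p * (v - u)"
      using quot[OF x(1), of "min d d'"] x d' by auto
    then have "{u..v} \<subseteq> ball x d'" by (auto simp: dist_real_def)
    then show ?thesis using uv d' unfolding P_def by auto
  qed
  then obtain C where C: "countable C" "\<And>u v. (u, v) \<in> C \<Longrightarrow> u < v \<and> P u v"
    "disjoint_family_on (\<lambda>(u, v). {u..v}) C"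
    "negligible (E - (\<Union>(u, v)\<in>C. {u..v}))"
    by (rule Vitali_covering_intervals[of E P]) auto
  define U where "U = (\<Union>(u, v)\<in>C. {u..v})"
  have U[measurable]: "U \<in> sets borel" using C unfolding U_def by (intro sets.countable_UN'') auto
  have UG: "U \<subseteq> G" using C(2) unfolding U_def P_def by force
  have Um: "U \<in> lmeasurable" by (rule lmeasurable_Borel_subset[OF U UG G(2)])
  define A where "A = {x. q \<le> f x}"
  have A[measurable]: "A \<in> sets borel" unfolding A_def by measurable
  have AU: "A \<inter> U \<in> lmeasurable" by (rule lmeasurable_Borel_subset[OF _ _ Um]) auto
  have "emeasure (density lborel f) U \<le> ennreal p * emeasure lborel U"
    unfolding U_def
  proof (rule measure_UN_intervals_le[OF C(1) C(3)])
    fix u v assume "(u, v) \<in> C"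
    then have "u < v" "F v - F u \<le> p * (v - u)" using C(2) unfolding P_def by auto
    then show "emeasure (density lborel f) {u..v} \<le> ennreal p * emeasure lborel {u..v}"
      using \<open>0 \<le> p\<close> by (simp add: Icc ennreal_mult[symmetric] ennreal_leI)
  qed auto
  moreover have "emeasure (density lborel f) (A \<inter> U) \<le> emeasure (density lborel f) U"
    by (intro emeasure_mono) auto
  moreover have "ennreal q * emeasure lborel (A \<inter> U) \<le> emeasure (density lborel f) (A \<inter> U)"
  proof -
    have "ennreal q * emeasure lborel (A \<inter> U) = (\<integral>\<^sup>+x. ennreal q * indicator (A \<inter> U) x \<partial>lborel)"
      by (subst nn_integral_cmult_indicator) auto
    also have "\<dots> \<le> (\<integral>\<^sup>+x. ennreal (f x) * indicator (A \<inter> U) x \<partial>lborel)"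
      by (intro nn_integral_mono) (auto simp: A_def indicator_def ennreal_leI)
    also have "\<dots> = emeasure (density lborel f) (A \<inter> U)"
      by (subst emeasure_density) auto
    finally show ?thesis .
  qed
  ultimately have "ennreal q * emeasure lborel (A \<inter> U) \<le> ennreal p * emeasure lborel U"
    by (meson order_trans)
  moreover have "emeasure lborel (A \<inter> U) = ennreal (measure lebesgue (A \<inter> U))"
    by (rule emeasure_lborel_lmeasurable[OF _ AU]) auto
  moreover have "emeasure lborel U = ennreal (measure lebesgue U)"
    by (rule emeasure_lborel_lmeasurable[OF _ Um]) auto
  ultimately have "q * measure lebesgue (A \<inter> U) \<le> p * measure lebesgue U"
    using assms by (simp add: ennreal_mult[symmetric])
  also have "\<dots> \<le> p * measure lebesgue G"
    using UG G Um \<open>0 \<le> p\<close> by (intro mult_left_mono measure_mono_fmeasurable) (auto)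
  finally have le: "measure lebesgue (A \<inter> U) \<le> p / q * measure lebesgue G"
    using assms by (simp add: field_simps)
  have null: "E - U \<in> null_sets lebesgue" using C(4) unfolding U_def negligible_iff_null_sets .
  show "\<exists>B. B \<in> lmeasurable \<and> E \<subseteq> B \<and> measure lebesgue B \<le> p / q * measure lebesgue G + e"
  proof (intro exI[of _ "(A \<inter> U) \<union> (E - U)"] conjI)
    show "(A \<inter> U) \<union> (E - U) \<in> lmeasurable"
      using AU null by (intro fmeasurable.Un) (auto simp: negligible_imp_measurable negligible_iff_null_sets)
    show "E \<subseteq> (A \<inter> U) \<union> (E - U)" using fq by (auto simp: A_def)
    have "measure lebesgue ((A \<inter> U) \<union> (E - U)) = measure lebesgue (A \<inter> U)"
      using null AU by (intro measure_Un_null_set) auto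
    then show "measure lebesgue ((A \<inter> U) \<union> (E - U)) \<le> p / q * measure lebesgue G + e"
      using le G by simp
  qed
qed

text \<open>The mirror image of \<open>negligible_lower\<close> with one complication: near a point
  of E the function f may be large off E. The intervals are therefore confined to an open U around A
  on which the integral of f is barely larger than on A, where it is at most p |G|.\<close>

lemma negligible_upper:
  assumes "E \<subseteq> {-n<..<n}" "0 \<le> p" "p < q"
    and fp: "\<And>x. x \<in> E \<Longrightarrow> f x \<le> p"
    and quot: "\<And>x d. x \<in> E \<Longrightarrow> 0 < d \<Longrightarrow> 
       \<exists>u v. u < v \<and> u \<le> x \<and> x \<le> v \<and> v - u < d \<and> q * (v - u) \<le> F v - F u"
  shows "negligible E"
proof (rule negligible_if_shrinking_cover)
  show "bounded E" using assms(1) by (intro bounded_subset[of "{- n..n}" E]) auto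
  show "p / q < 1" "0 \<le> p / q" using assms by auto
  fix G :: "real set" and e :: real
  assume G: "open G" "G \<in> lmeasurable" "E \<subseteq> G" "0 < e"
  \<comment> \<open>Truncation makes the measure finite, as outer regularity requires, and changes
    nothing on intervals inside {-n<..<n}.\<close>
  define M where "M = density lborel (\<lambda>x. ennreal (f x) * indicator {-n..n} x)"
  have sM: "sets M = sets borel" unfolding M_def by simp
  have fin: "emeasure M (space M) \<noteq> \<infinity>"
  proof (cases "-n \<le> n")
    case True
    have "emeasure M (space M) = emeasure (density lborel f) {-n..n}"
      unfolding M_def by (simp add: emeasure_density)
    then show ?thesis using Icc[OF True] by simp
  qed (auto simp: M_def emeasure_density)
  define A where "A = {x. f x \<le> p} \<inter> G"
  have Gb [measurable]: "G \<in> sets borel" using G by auto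
  have A[measurable]: "A \<in> sets borel" unfolding A_def by measurable
  have "emeasure M A \<le> ennreal p * emeasure lborel A"
  proof -
    have "emeasure M A = (\<integral>\<^sup>+x. ennreal (f x) * indicator {-n..n} x * indicator A x \<partial>lborel)"
      unfolding M_def by (subst emeasure_density) auto
    also have "\<dots> \<le> (\<integral>\<^sup>+x. ennreal p * indicator A x \<partial>lborel)"
      by (intro nn_integral_mono) (auto simp: A_def indicator_def ennreal_leI)
    also have "\<dots> = ennreal p * emeasure lborel A" by (subst nn_integral_cmult_indicator) auto
    finally show ?thesis .
  qed
  also have "\<dots> \<le> ennreal p * emeasure lborel G"
    by (intro mult_left_mono emeasure_mono) (auto simp: A_def)
  also have "emeasure lborel G = ennreal (measure lebesgue G)"
    by (rule emeasure_lborel_lmeasurable[OF _ G(2)]) auto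
  finally have MA: "emeasure M A \<le> ennreal (p * measure lebesgue G)"
    using \<open>0 \<le> p\<close> by (simp add: ennreal_mult)
  have "emeasure M A = (INF U \<in> {U. A \<subseteq> U \<and> open U}. emeasure M U)"
    using outer_regular[OF sM fin] A by simp
  moreover have "emeasure M A < ennreal (p * measure lebesgue G + e * q)"
    using G(4) assms(2,3) by (intro le_less_trans[OF MA] ennreal_lessI) (auto intro!: add_nonneg_pos)
  ultimately obtain U where U: "A \<subseteq> U" "open U" "emeasure M U < ennreal (p * measure lebesgue G + e * q)"
    by (auto simp: INF_less_iff)
  have EU: "E \<subseteq> U \<inter> {-n<..<n}" using U assms(1) fp G by (auto simp: A_def)
  have oU: "open (U \<inter> {-n<..<n})" using U by auto
  define P where "P = (\<lambda>u v. {u..v} \<subseteq> U \<inter> {-n<..<n} \<and> q * (v - u) \<le> F v - F u)"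
  have "\<exists>u v. u < v \<and> u \<le> x \<and> x \<le> v \<and> v - u < d \<and> P u v" if x: "x \<in> E" "0 < d" for x d
  proof -
    obtain d' where d': "0 < d'" "ball x d' \<subseteq> U \<inter> {-n<..<n}" using oU EU x by (meson openE subsetD)
    obtain u v where uv: "u < v" "u \<le> x" "x \<le> v" "v - u < min d d'" "q * (v - u) \<le> F v - F u"
      using quot[OF x(1), of "min d d'"] x d' by auto
    have "{u..v} \<subseteq> ball x d'" using uv by (auto simp: dist_real_def)
    then have "P u v" using uv(5) d'(2) unfolding P_def by (meson order_trans)
    then show ?thesis using uv by auto
  qed
  then obtain C where C: "countable C" "\<And>u v. (u, v) \<in> C \<Longrightarrow> u < v \<and> P u v"
    "disjoint_family_on (\<lambda>(u, v). {u..v}) C"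
    "negligible (E - (\<Union>(u, v)\<in>C. {u..v}))"
    by (rule Vitali_covering_intervals[of E P]) auto
  define V where "V = (\<Union>(u, v)\<in>C. {u..v})"
  have V[measurable]: "V \<in> sets borel" using C unfolding V_def by (intro sets.countable_UN'') auto
  have VU: "V \<subseteq> U" "V \<subseteq> {-n<..<n}" using C(2) unfolding V_def P_def by force+
  have Vm: "V \<in> lmeasurable"
    by (rule lmeasurable_Borel_subset[OF V VU(2)]) (rule lmeasurable_box[of "-n" n, unfolded box_real])
  have q: "0 < q" using assms by auto
  have "emeasure lborel V \<le> ennreal (1/q) * emeasure M V"
    unfolding V_def
  proof (rule measure_UN_intervals_le[OF C(1) C(3)])
    fix u v assume uv: "(u, v) \<in> C"
    then have *: "u < v" "q * (v - u) \<le> F v - F u" "{u..v} \<subseteq> {-n<..<n}" using C(2) unfolding P_def by auto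
    have "emeasure M {u..v} = emeasure (density lborel f) {u..v}"
      unfolding M_def using *(3)
      by (simp add: emeasure_density) (intro nn_integral_cong, auto simp: indicator_def)
    then show "emeasure lborel {u..v} \<le> ennreal (1/q) * emeasure M {u..v}"
      using * q by (simp add: Icc ennreal_mult'[symmetric] ennreal_leI field_simps)
  qed (auto simp: sM)
  also have "\<dots> \<le> ennreal (1/q) * ennreal (p * measure lebesgue G + e * q)"
    using U(2) VU(1) by (intro mult_left_mono order.trans[OF emeasure_mono less_imp_le[OF U(3)]]) (auto simp: sM)
  also have "\<dots> = ennreal (p / q * measure lebesgue G + e)"
    using q by (subst ennreal_mult'[symmetric]) (auto simp: field_simps)
  finally have "ennreal (measure lebesgue V) \<le> ennreal (p / q * measure lebesgue G + e)"
    by (simp add: emeasure_lborel_lmeasurable[OF _ Vm])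
  then have le: "measure lebesgue V \<le> p / q * measure lebesgue G + e"
    using assms(2) q G(4) by (subst (asm) ennreal_le_iff) auto
  have null: "E - V \<in> null_sets lebesgue" using C(4) unfolding V_def negligible_iff_null_sets .
  show "\<exists>B. B \<in> lmeasurable \<and> E \<subseteq> B \<and> measure lebesgue B \<le> p / q * measure lebesgue G + e"
  proof (intro exI[of _ "V \<union> (E - V)"] conjI)
    show "V \<union> (E - V) \<in> lmeasurable"
      using Vm null by (intro fmeasurable.Un) (auto simp: negligible_imp_measurable negligible_iff_null_sets)
    have "measure lebesgue (V \<union> (E - V)) = measure lebesgue V"
      using null Vm by (intro measure_Un_null_set) auto
    then show "measure lebesgue (V \<union> (E - V)) \<le> p / q * measure lebesgue G + e"
      using le by simp
  qed auto
qed

lemma ex_interval_if_quotient: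
  assumes "y \<noteq> x" "\<bar>y - x\<bar> < d" "Q ((F y - F x) / (y - x))"
  shows "\<exists>u v. u < v \<and> u \<le> x \<and> x \<le> v \<and> v - u < d \<and> Q ((F v - F u) / (v - u))"
proof (cases "y < x")
  case True
  have "(F x - F y) / (x - y) = (F y - F x) / (y - x)"
    by (metis minus_diff_eq minus_divide_divide)
  then show ?thesis using assms True by (intro exI[of _ y] exI[of _ x]) auto
qed (use assms in \<open>intro exI[of _ x] exI[of _ y], auto\<close>)

text \<open>If the derivative is not f x, difference quotients arbitrarily near x stay above f x + e
  or below f x - e. Rationals p < q in the gap put x into one of countably many sets, which
  \<open>negligible_upper\<close> and \<open>negligible_lower\<close> show to be null.\<close>

theorem AE_has_derivative: "AE x in lebesgue. (F has_real_derivative f x) (at x)"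
proof -
  define Lo where "Lo = (\<lambda>(p, q, n::nat). {x \<in> {- real n<..<real n}. real_of_rat q \<le> f x \<and>
     (\<forall>d>0. \<exists>u v. u < v \<and> u \<le> x \<and> x \<le> v \<and> v - u < d \<and> F v - F u \<le> real_of_rat p * (v - u))})"
  define Up where "Up = (\<lambda>(p, q, n::nat). {x \<in> {- real n<..<real n}. f x \<le> real_of_rat p \<and>
     (\<forall>d>0. \<exists>u v. u < v \<and> u \<le> x \<and> x \<le> v \<and> v - u < d \<and> real_of_rat q * (v - u) \<le> F v - F u)})"
  define I where "I = {(p, q, n::nat) | p q n. 0 \<le> p \<and> p < (q::rat)}"
  have "negligible (Lo i \<union> Up i)" if iI: "i \<in> I" for i
  proof -
    obtain p q n where i: "i = (p, q, n)" "0 \<le> p" "p < q" using iI unfolding I_def by blast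
    have 0: "bounded (Lo i)" by (rule bounded_subset[of "{- real n..real n}"]) (auto simp: Lo_def i)
    have 1: "0 \<le> real_of_rat p" "real_of_rat p < real_of_rat q" using i by (auto simp: of_rat_less)
    have "negligible (Lo i)" by (rule negligible_lower[OF 0 1]) (auto simp: Lo_def i)
    moreover have "negligible (Up i)" by (rule negligible_upper[OF _ 1, of _ n]) (auto simp: Up_def i)
    ultimately show ?thesis by (rule negligible_Un)
  qed
  moreover have "countable I" by (rule countable_subset[of _ UNIV]) auto
  ultimately have "negligible (\<Union>i\<in>I. Lo i \<union> Up i)"
    by (intro negligible_countable_Union[of "(\<lambda>i. Lo i \<union> Up i) ` I"]) auto
  then have "AE x in lebesgue. x \<notin> (\<Union>i\<in>I. Lo i \<union> Up i)"
    unfolding negligible_iff_null_sets by (rule AE_not_in)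
  then show ?thesis
  proof (rule AE_mp, intro AE_I2 impI)
    fix x assume x: "x \<notin> (\<Union>i\<in>I. Lo i \<union> Up i)"
    obtain n where n: "\<bar>x\<bar> < real n" using reals_Archimedean2 by blast
    show "(F has_real_derivative f x) (at x)"
      unfolding has_field_derivative_iff LIM_def dist_real_def
    proof (intro allI impI, rule ccontr)
      fix e :: real assume "0 < e" and neg: "\<not> (\<exists>d>0. \<forall>y. y \<noteq> x \<and> \<bar>y - x\<bar> < d \<longrightarrow> \<bar>(F y - F x) / (y - x) - f x\<bar> < e)"
      show False
      proof (cases "\<forall>d>0. \<exists>y. y \<noteq> x \<and> \<bar>y - x\<bar> < d \<and> f x + e \<le> (F y - F x) / (y - x)")
        case True
        obtain p where p: "f x < real_of_rat p" "real_of_rat p < f x + e"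
          using of_rat_dense[of "f x" "f x + e"] \<open>0 < e\<close> by auto
        obtain q where q: "real_of_rat p < real_of_rat q" "real_of_rat q < f x + e"
          using of_rat_dense p by blast
        have "0 \<le> real_of_rat p" using p nonneg[of x] by linarith
        then have "(p, q, n) \<in> I" using q by (auto simp: I_def of_rat_less)
        moreover have "x \<in> Up (p, q, n)"
        proof -
          have "\<exists>u v. u < v \<and> u \<le> x \<and> x \<le> v \<and> v - u < d \<and> real_of_rat q * (v - u) \<le> F v - F u" if d: "0 < d" for d
          proof -
            obtain y where y: "y \<noteq> x" "\<bar>y - x\<bar> < d" "f x + e \<le> (F y - F x) / (y - x)" using True d by blast
            obtain u v where uv: "u < v" "u \<le> x" "x \<le> v" "v - u < d" "f x + e \<le> (F v - F u) / (v - u)"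
              using ex_interval_if_quotient[where Q = "\<lambda>r. f x + e \<le> r", OF y] by auto
            have "real_of_rat q \<le> (F v - F u) / (v - u)" using uv q by linarith
            then have "real_of_rat q * (v - u) \<le> F v - F u" using uv by (simp add: pos_le_divide_eq)
            then show ?thesis using uv by blast
          qed
          then show ?thesis using n p by (auto simp: Up_def)
        qed
        ultimately show False using x by blast
      next
        case False
        then obtain d0 where d0: "0 < d0" "\<And>y. y \<noteq> x \<Longrightarrow> \<bar>y - x\<bar> < d0 \<Longrightarrow> (F y - F x) / (y - x) < f x + e"
          by (meson not_le)
        have True: "\<exists>y. y \<noteq> x \<and> \<bar>y - x\<bar> < d \<and> (F y - F x) / (y - x) \<le> f x - e" if d: "0 < d" for d
        proof -
          obtain y where "y \<noteq> x" "\<bar>y - x\<bar> < min d d0" "\<not> \<bar>(F y - F x) / (y - x) - f x\<bar> < e"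
            using neg d0(1) d by (meson min_less_iff_conj)
          then show ?thesis using d0(2)[of y] by (intro exI[of _ y]) auto
        qed
        \<comment> \<open>Quotients of a monotone function are nonnegative, hence f x - e >= 0, and
          the rational p taken above it is nonnegative, as the index set I requires.\<close>
        have quot_nonneg: "0 \<le> (F y - F x) / (y - x)" for y
          using mono by (cases "y \<le> x") (auto simp: mono_def zero_le_divide_iff)
        have "0 \<le> f x - e" using True[of 1] quot_nonneg by (meson order_trans zero_less_one)
        obtain p where p: "f x - e < real_of_rat p" "real_of_rat p < f x"
          using of_rat_dense[of "f x - e" "f x"] \<open>0 < e\<close> by auto
        obtain q where q: "real_of_rat p < real_of_rat q" "real_of_rat q < f x"
          using of_rat_dense p by blast
        have "0 \<le> real_of_rat p" using p \<open>0 \<le> f x - e\<close> by linarith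
        then have "(p, q, n) \<in> I" using q by (auto simp: I_def of_rat_less)
        moreover have "x \<in> Lo (p, q, n)"
        proof -
          have "\<exists>u v. u < v \<and> u \<le> x \<and> x \<le> v \<and> v - u < d \<and> F v - F u \<le> real_of_rat p * (v - u)" if d: "0 < d" for d
          proof -
            obtain y where y: "y \<noteq> x" "\<bar>y - x\<bar> < d" "(F y - F x) / (y - x) \<le> f x - e" using True[OF d] by blast
            obtain u v where uv: "u < v" "u \<le> x" "x \<le> v" "v - u < d" "(F v - F u) / (v - u) \<le> f x - e"
              using ex_interval_if_quotient[where Q = "\<lambda>r. r \<le> f x - e", OF y] by auto
            have "(F v - F u) / (v - u) \<le> real_of_rat p" using uv p by linarith
            then have "F v - F u \<le> real_of_rat p * (v - u)" using uv by (simp add: pos_divide_le_eq)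
            then show ?thesis using uv by blast
          qed
          then show ?thesis using n q by (auto simp: Lo_def)
        qed
        ultimately show False using x by blast
      qed
    qed
  qed
qed

end

section \<open>Absolute continuity and the density of the Stieltjes measure\<close>

lemma absolutely_continuous_on_imp_continuous_on:
  fixes h :: "real \<Rightarrow> real"
  assumes "\<And>a b. absolutely_continuous_on {a..b} h"
  shows "continuous_on UNIV h"
  unfolding continuous_on_iff
proof (intro ballI allI impI)
  fix x e :: real assume "0 < e"
  obtain d where d: "0 < d" "\<And>(n::nat) u v. (\<forall>i<n. u i \<le> v i \<and> {u i..v i} \<subseteq> {x - 1..x + 1}) \<Longrightarrow>
        (\<forall>i<n. \<forall>j<n. i \<noteq> j \<longrightarrow> {u i<..<v i} \<inter> {u j<..<v j} = {}) \<Longrightarrow>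
        (\<Sum>i<n. v i - u i) < d \<Longrightarrow> (\<Sum>i<n. dist (h (u i)) (h (v i))) < e"
    using assms[of "x - 1" "x + 1"] \<open>0 < e\<close> unfolding absolutely_continuous_on_def by meson
  show "\<exists>d>0. \<forall>x'\<in>UNIV. dist x' x < d \<longrightarrow> dist (h x') (h x) < e"
  proof (intro exI[of _ "min d 1"] conjI ballI impI)
    fix y assume "dist y x < min d 1"
    then show "dist (h y) (h x) < e"
      using d(2)[of 1 "\<lambda>_. min x y" "\<lambda>_. max x y"]
      by (cases "x \<le> y") (auto simp: dist_real_def min_def max_def abs_if split: if_splits)
  qed (use d in auto)
qed

text \<open>A null set in [-m, m] lies in an open T whose length is below the threshold of absolute
  continuity. Nonoverlapping closed intervals inside T cover it, every finite union of them has
  measure at most e, and continuity from below extends this to the countable union.\<close>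

lemma absolutely_continuous_interval_measure:
  fixes h :: "real \<Rightarrow> real"
  assumes mono: "mono h" and ac: "\<And>a b. absolutely_continuous_on {a..b} h"
  shows "absolutely_continuous lborel (interval_measure h)"
  unfolding absolutely_continuous_def
proof
  fix N :: "real set" assume N: "N \<in> null_sets lborel"
  then have Nb[measurable]: "N \<in> sets borel" by auto
  have cont: "continuous_on UNIV h" using ac by (rule absolutely_continuous_on_imp_continuous_on)
  have Icc: "emeasure (interval_measure h) {a..b} = ennreal (h b - h a)" if "a \<le> b" for a b
    using that mono cont by (intro emeasure_interval_measure_Icc) (auto simp: mono_def)
  have le: "emeasure (interval_measure h) (N \<inter> {- real m..real m}) \<le> ennreal e" if e: "0 < e" for m e
  \<comment> \<open>\<open>covering_lemma\<close> needs a box with nonempty interior and D is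
    enumerated later on, so the degenerate cases are split off; there a single point of measure 0
    suffices.\<close>
  proof (cases "m = 0 \<or> N \<inter> {- real m..real m} = {}")
    case True
    then have "emeasure (interval_measure h) (N \<inter> {- real m..real m}) \<le> emeasure (interval_measure h) {0..0}"
      by (intro emeasure_mono) auto
    then show ?thesis using e Icc[of 0 0] by auto
  next
    case False
    define S where "S = N \<inter> {- real m..real m}"
    obtain d where d: "0 < d" "\<And>(n::nat) u v. (\<forall>i<n. u i \<le> v i \<and> {u i..v i} \<subseteq> {- real m..real m}) \<Longrightarrow>
        (\<forall>i<n. \<forall>j<n. i \<noteq> j \<longrightarrow> {u i<..<v i} \<inter> {u j<..<v j} = {}) \<Longrightarrow>
        (\<Sum>i<n. v i - u i) < d \<Longrightarrow> (\<Sum>i<n. dist (h (u i)) (h (v i))) < e"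
      using ac[of "- real m" "real m"] e unfolding absolutely_continuous_on_def by meson
    have "S \<in> null_sets lebesgue"
      using N unfolding S_def by (intro null_sets_completionI null_set_Int2) auto
    then have "S \<in> lmeasurable" "measure lebesgue S = 0"
      by (auto simp: fmeasurable_def measure_eq_0_null_sets)
    then obtain T where T: "open T" "S \<subseteq> T" "T \<in> lmeasurable" "measure lebesgue T < d"
      using lmeasurable_outer_open[of S d] d(1) by auto
    \<comment> \<open>The gauge assigns T to the points of T. Every interval of the cover is tagged
      by a point of S and is thereby forced to lie in T.\<close>
    have "S \<subseteq> cbox (- real m) (real m)" "box (- real m) (real m) \<noteq> {}" "gauge (\<lambda>x. if x \<in> T then T else UNIV)"
      using False \<open>open T\<close> by (auto simp: S_def gauge_def)
    then obtain D where D: "countable D"  "\<Union>D \<subseteq> cbox (- real m) (real m)"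
      "\<And>K. K \<in> D \<Longrightarrow> interior K \<noteq> {} \<and> (\<exists>c d. K = cbox c d)"
      "pairwise (\<lambda>A B. interior A \<inter> interior B = {}) D"
      "\<And>K. K \<in> D \<Longrightarrow> \<exists>x \<in> S \<inter> K. K \<subseteq> (if x \<in> T then T else UNIV)"
      "S \<subseteq> \<Union>D"
      by (rule covering_lemma) (assumption | rule that)+
    have D_T: "K \<subseteq> T" if "K \<in> D" for K using D(5)[OF that] T(2) by (auto split: if_splits)
    have "D \<noteq> {}" using D(6) False S_def by auto
    have fin: "emeasure (interval_measure h) (\<Union>F) \<le> ennreal e" if F: "finite F" "F \<subseteq> D" for F
    proof -
      obtain g where g: "bij_betw g {0..<card F} F" using ex_bij_betw_nat_finite[OF F(1)] by blast
      define u where "u = (\<lambda>i. Inf (g i))"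
      define v where "v = (\<lambda>i. Sup (g i))"
      have gF: "g i \<in> F" if "i < card F" for i using g that by (auto simp: bij_betw_def)
      have uv: "g i = {u i..v i} \<and> u i < v i" if i: "i < card F" for i
      proof -
        obtain c d where cd: "g i = {c..d}" "interior (g i) \<noteq> {}" 
          using D(3)[of "g i"] gF[OF i] F(2) unfolding cbox_interval by blast
        then have "c < d" by (auto simp: interior_atLeastAtMost_real)
        then show ?thesis using cd by (simp add: u_def v_def)
      qed
      have disj: "{u i<..<v i} \<inter> {u j<..<v j} = {}" if "i < card F" "j < card F" "i \<noteq> j" for i j
      proof -
        have "g i \<noteq> g j" using g that unfolding bij_betw_def inj_on_def by auto
        then have "interior (g i) \<inter> interior (g j) = {}"
          using D(4) gF that F(2) unfolding pairwise_def by (meson subsetD)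
        then show ?thesis using uv that by (simp add: interior_atLeastAtMost_real)
      qed
      have "(\<Sum>i<card F. v i - u i) = (\<Sum>i<card F. measure lebesgue {u i<..<v i})"
        using uv by (intro sum.cong) (auto simp: less_imp_le)
      also have "\<dots> = measure lebesgue (\<Union>i<card F. {u i<..<v i})"
        using uv disj by (intro measure_finite_Union[symmetric]) (auto simp: disjoint_family_on_def less_imp_le)
      also have "\<dots> \<le> measure lebesgue T"
      proof (rule measure_mono_fmeasurable[OF _ _ T(3)])
        show "(\<Union>i<card F. {u i<..<v i}) \<subseteq> T" using uv gF D_T F(2) by fastforce
      qed auto
      finally have small: "(\<Sum>i<card F. v i - u i) < d" using T(4) by linarith
      have sub: "{u i..v i} \<subseteq> {- real m..real m}" if i: "i < card F" for i
      proof -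
        have "g i \<subseteq> \<Union>D" using gF[OF i] F(2) by auto
        then show ?thesis using uv[OF i] D(2) unfolding cbox_interval by (metis order_trans)
      qed
      have sumlt: "(\<Sum>i<card F. dist (h (u i)) (h (v i))) < e"
        using uv disj sub small by (intro d(2)) (auto simp: less_imp_le)
      have UF: "\<Union>F = (\<Union>i<card F. g i)" using g by (auto simp: bij_betw_def lessThan_atLeast0)
      have "emeasure (interval_measure h) (\<Union>F) \<le> (\<Sum>i<card F. emeasure (interval_measure h) (g i))"
        unfolding UF using uv by (intro emeasure_subadditive_finite) auto
      also have "\<dots> = (\<Sum>i<card F. ennreal (dist (h (u i)) (h (v i))))"
      proof (intro sum.cong refl)
        fix i assume "i \<in> {..<card F}"
        then have i: "i < card F" by simp
        have "h (u i) \<le> h (v i)" using uv[OF i] mono by (auto simp: mono_def)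
        then show "emeasure (interval_measure h) (g i) = ennreal (dist (h (u i)) (h (v i)))"
          using uv[OF i] by (simp add: Icc dist_real_def)
      qed
      also have "\<dots> = ennreal (\<Sum>i<card F. dist (h (u i)) (h (v i)))"
        by (rule sum_ennreal) auto
      finally show ?thesis using sumlt by (meson ennreal_leI less_imp_le order_trans)
    qed
    \<comment> \<open>Finite unions along an enumeration of D, with repetitions if D is
      finite.\<close>
    define B where "B = (\<lambda>n. \<Union>i<n. from_nat_into D i)"
    have meas: "from_nat_into D i \<in> sets borel" for i
    proof -
      obtain c d where "from_nat_into D i = cbox c d" using D(3) from_nat_into[OF \<open>D \<noteq> {}\<close>] by metis
      then show ?thesis by simp
    qed
    have UD: "\<Union>D = (\<Union>n. B n)"
    proof -
      have "\<Union>D = (\<Union>i. from_nat_into D i)"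
        using range_from_nat_into[OF \<open>D \<noteq> {}\<close> D(1)] by simp
      then show ?thesis unfolding B_def by blast
    qed
    have "emeasure (interval_measure h) S \<le> emeasure (interval_measure h) (\<Union>n. B n)"
      using D(6) UD meas unfolding B_def by (intro emeasure_mono) auto
    also have "\<dots> = (SUP n. emeasure (interval_measure h) (B n))"
      using meas
      by (intro SUP_emeasure_incseq[symmetric])
        (auto simp: B_def incseq_def intro!: UN_mono order_less_le_trans)
    also have "\<dots> \<le> ennreal e"
    proof (rule SUP_least)
      fix n
      have "from_nat_into D ` {..<n} \<subseteq> D" using from_nat_into[OF \<open>D \<noteq> {}\<close>] by auto
      from fin[OF _ this] show "emeasure (interval_measure h) (B n) \<le> ennreal e" by (simp add: B_def)
    qed
    finally show ?thesis unfolding S_def .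
  qed
  have zero: "emeasure (interval_measure h) (N \<inter> {- real m..real m}) = 0" for m
    using le ennreal_le_epsilon[of 0 "emeasure (interval_measure h) (N \<inter> {- real m..real m})"]
    by (metis add_0 bot.extremum_uniqueI bot_ennreal ennreal_le_epsilon)
  have "N = (\<Union>m::nat. N \<inter> {- real m..real m})"
  proof -
    have "\<exists>m::nat. - real m \<le> x \<and> x \<le> real m" for x
      using real_arch_simple[of "\<bar>x\<bar>"] by (auto simp: abs_le_iff minus_le_iff)
    then show ?thesis by auto
  qed
  moreover have "(\<Union>m::nat. N \<inter> {- real m..real m}) \<in> null_sets (interval_measure h)"
    using zero by (intro null_sets_UN) (auto simp: null_sets_def)
  ultimately show "N \<in> null_sets (interval_measure h)" by simp
qed

text \<open>Radon-Nikodym gives an extended density; sigma-finiteness of the interval measure makes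
  it finite almost everywhere, so that a real-valued f can replace it.\<close>

lemma mono_absolutely_continuous_density:
  fixes h :: "real \<Rightarrow> real"
  assumes mono: "mono h" and ac: "\<And>a b. absolutely_continuous_on {a..b} h"
  obtains f where "indefinite_integral f h"
proof -
  have cont: "continuous_on UNIV h" using ac by (rule absolutely_continuous_on_imp_continuous_on)
  have "sigma_finite_measure (interval_measure h)"
    using mono cont by (intro sigma_finite_interval_measure)
      (auto simp: mono_def continuous_on_eq_continuous_within continuous_at_imp_continuous_at_within)
  obtain f where f [measurable]: "f \<in> borel_measurable lborel" and dens: "density lborel f = interval_measure h"
    using sigma_finite_measure.Radon_Nikodym[OF sigma_finite_lborel absolutely_continuous_interval_measure[OF assms]] by auto
  have "AE x in lborel. f x \<noteq> \<infinity>"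
    using \<open>sigma_finite_measure (interval_measure h)\<close> f
    unfolding dens[symmetric] by (subst (asm) sigma_finite_measure.sigma_finite_iff_density_finite[OF sigma_finite_lborel]) auto
  then have "AE x in lborel. f x = ennreal (enn2real (f x))"
    by eventually_elim (simp add: ennreal_enn2real_if less_top)
  then have "density lborel (\<lambda>x. ennreal (enn2real (f x))) = interval_measure h"
    unfolding dens[symmetric] by (intro density_cong) auto
  moreover have "emeasure (interval_measure h) {a..b} = ennreal (h b - h a)" if "a \<le> b" for a b
    using that mono cont by (intro emeasure_interval_measure_Icc) (auto simp: mono_def)
  ultimately have "indefinite_integral (\<lambda>x. enn2real (f x)) h"
    using mono by unfold_locales auto
  then show thesis by (rule that)
qed

context indefinite_integral begin

lemma has_bochner_integral_Icc:
  assumes "a \<le> b"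
  shows "has_bochner_integral lebesgue (\<lambda>x. indicator {a..b} x * f x) (F b - F a)"
proof -
  have "(\<integral>\<^sup>+x. ennreal (indicator {a..b} x * f x) \<partial>lborel) = emeasure (density lborel f) {a..b}"
    by (subst emeasure_density) (auto intro!: nn_integral_cong simp: indicator_def)
  also have "\<dots> = ennreal (F b - F a)" using Icc[OF assms] .
  finally have "has_bochner_integral lborel (\<lambda>x. indicator {a..b} x * f x) (F b - F a)"
    using nonneg mono assms by (intro has_bochner_integral_nn_integral) (auto simp: mono_def)
  then show ?thesis by (simp add: has_bochner_integral_iff integrable_completion integral_completion)
qed

lemma set_integrable_Icc: "set_integrable lebesgue {a..b} f"
  using has_bochner_integral_Icc[of a b] by (cases "a \<le> b") (auto simp: set_integrable_def has_bochner_integral_iff)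

lemma LINT_Icc: "a \<le> b \<Longrightarrow> (LINT x:{a..b}|lebesgue. f x) = F b - F a"
  using has_bochner_integral_Icc[of a b] by (auto simp: set_lebesgue_integral_def has_bochner_integral_iff)

end

section \<open>Arc length in the coordinate of the line\<close>

definition line_density :: "real \<Rightarrow> real" where
  "line_density x = 2 / (1 + x\<^sup>2)"

lemma line_density_pos: "0 < line_density x"
  by (simp add: line_density_def add_pos_nonneg)

lemma line_density_measurable [measurable]: "line_density \<in> borel_measurable borel"
  unfolding line_density_def by measurable

lemma real_plus_i_nonzero: "complex_of_real x + \<i> \<noteq> 0"
  by (simp add: complex_eq_iff)

lemma cayley_line_eq_cis: "cayley_line x = cis (pi + 2 * arctan x)"
proof -
  have "cis (arctan x) = (1 + \<i> * x) / sqrt (1 + x\<^sup>2)"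
    by (simp add: complex_eq_iff cos_arctan sin_arctan)
  then have "cis (2 * arctan x) = ((1 + \<i> * x) / sqrt (1 + x\<^sup>2))\<^sup>2"
    by (metis Complex.DeMoivre of_nat_numeral)
  also have "\<dots> = (1 + \<i> * x)\<^sup>2 / (1 + x\<^sup>2)"
    by (simp add: power_divide flip: of_real_power)
  finally have *: "cis (pi + 2 * arctan x) = - ((1 + \<i> * x)\<^sup>2 / (1 + x\<^sup>2))"
    by (simp flip: cis_mult)
  have "1 + (complex_of_real x)\<^sup>2 \<noteq> 0"
    by (metis of_real_1 of_real_add of_real_eq_0_iff of_real_power power_one sum_power2_eq_zero_iff zero_neq_one)
  moreover have "1 + (complex_of_real x)\<^sup>2 = (x + \<i>) * (x - \<i>)"
    by (simp add: algebra_simps power2_eq_square)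
  ultimately show ?thesis
    unfolding * cayley_def using real_plus_i_nonzero[of x]
    by (simp add: divide_simps) (simp add: algebra_simps power2_eq_square)
qed

lemma norm_cayley_line [simp]: "norm (cayley_line x) = 1"
  by (simp add: cayley_line_eq_cis)

lemma cayley_line_neq_1: "cayley_line x \<noteq> 1"
  unfolding cayley_def divide_eq_1_iff by (simp add: complex_eq_iff)

text \<open>The inverse Cayley formula i (1 + z) / (1 - z), whose value is real on the circle;
  \<open>Re\<close> adjusts the type.\<close>

definition line_of_circle :: "complex \<Rightarrow> real" where
  "line_of_circle z = Re (\<i> * (1 + z) / (1 - z))"

lemma line_of_circle_cayley_line [simp]: "line_of_circle (cayley_line x) = x"
proof -
  have "\<i> * (1 + cayley_line x) / (1 - cayley_line x) = of_real x"
    using real_plus_i_nonzero[of x] by (simp add: cayley_def divide_simps)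
  then show ?thesis by (simp add: line_of_circle_def)
qed

text \<open>The value is fixed by complex conjugation because the conjugate of z is 1 / z on the
  circle.\<close>

lemma of_real_line_of_circle:
  assumes "norm z = 1" "z \<noteq> 1"
  shows "of_real (line_of_circle z) = \<i> * (1 + z) / (1 - z)"
proof -
  have "z * cnj z = 1" using assms by (metis complex_norm_square of_real_1 power_one)
  have nz: "1 - z \<noteq> 0" "1 - cnj z \<noteq> 0" using assms by auto
  have "cnj (\<i> * (1 + z) / (1 - z)) = - \<i> * (1 + cnj z) / (1 - cnj z)" by simp
  also have "\<dots> = \<i> * (1 + z) / (1 - z)"
    using nz \<open>z * cnj z = 1\<close> by (simp add: divide_simps) (simp add: algebra_simps)
  finally have "Im (\<i> * (1 + z) / (1 - z)) = 0"
    by (simp only: complex_is_Real_iff[symmetric] Reals_cnj_iff)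
  then show ?thesis by (simp add: line_of_circle_def complex_eq_iff)
qed

lemma cayley_line_line_of_circle:
  assumes "norm z = 1" "z \<noteq> 1"
  shows "cayley_line (line_of_circle z) = z"
proof -
  have nz: "1 - z \<noteq> 0" using assms by auto
  show ?thesis unfolding cayley_def of_real_line_of_circle[OF assms]
    using nz by (simp add: divide_simps) (simp add: algebra_simps)
qed

lemma inj_cayley_line: "inj cayley_line"
  by (metis injI line_of_circle_cayley_line)

lemma inv_cayley_line:
  assumes "norm z = 1" "z \<noteq> 1"
  shows "inv cayley_line z = line_of_circle z"
  using inj_cayley_line cayley_line_line_of_circle[OF assms] by (metis inv_f_f)

lemma cayley_line_measurable [measurable]: "cayley_line \<in> borel_measurable borel"
  unfolding cayley_line_eq_cis by (intro borel_measurable_continuous_onI continuous_intros)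

lemma line_of_circle_measurable [measurable]: "line_of_circle \<in> borel_measurable borel"
  unfolding line_of_circle_def by measurable

text \<open>Change of variables for pi + 2 arctan x, a bijection of the line onto (0, 2 pi) with
  derivative \<open>line_density\<close>.\<close>

lemma emeasure_line_density:
  assumes [measurable]: "B \<in> sets borel"
  shows "emeasure (density lborel line_density) {x. pi + 2 * arctan x \<in> B} = emeasure lborel (B \<inter> {0<..<2 * pi})"
proof -
  define g where "g x = pi + 2 * arctan x" for x
  have gm[measurable]: "g \<in> borel_measurable borel"
    unfolding g_def by (intro borel_measurable_continuous_onI continuous_intros)
  have rg: "range g = {0<..<2 * pi}"
  proof -
    have "y \<in> range g" if "0 < y" "y < 2 * pi" for y
    proof -
      have "arctan (tan ((y - pi) / 2)) = (y - pi) / 2" using that by (intro arctan_tan) auto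
      then have "g (tan ((y - pi) / 2)) = y" by (simp add: g_def)
      then show ?thesis by (metis rangeI)
    qed
    moreover have "0 < g x" "g x < 2 * pi" for x
      using arctan_bounded[of x] by (auto simp: g_def)
    ultimately show ?thesis by auto
  qed
  have Bm: "B \<inter> {0<..<2 * pi} \<in> lmeasurable"
    by (rule fmeasurableI2[of "box 0 (2 * pi)"]) (auto simp: lmeasurable_box)
  have "indicat_real B absolutely_integrable_on {0<..<2 * pi} \<and>
     integral {0<..<2 * pi} (indicat_real B) = measure lebesgue (B \<inter> {0<..<2 * pi})"
  proof
    have "((\<lambda>x. 1::real) absolutely_integrable_on (B \<inter> {0<..<2 * pi}))"
      using Bm by (simp add: absolutely_integrable_on_const)
    then have "(\<lambda>x. if x \<in> B then 1::real else 0) absolutely_integrable_on {0<..<2 * pi}"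
      by (subst (asm) absolutely_integrable_restrict_UNIV[symmetric], subst absolutely_integrable_restrict_UNIV[symmetric])
         (erule back_subst[of "\<lambda>f. f absolutely_integrable_on UNIV"], auto)
    then show "indicat_real B absolutely_integrable_on {0<..<2 * pi}"
      by (rule back_subst[of "\<lambda>f. f absolutely_integrable_on {0<..<2 * pi}"]) (auto simp: indicator_def)
    show "integral {0<..<2 * pi} (indicat_real B) = measure lebesgue (B \<inter> {0<..<2 * pi})"
      by (metis Bm integral_indicator)
  qed
  then have "(\<lambda>x. \<bar>line_density x\<bar> * indicat_real B (g x)) absolutely_integrable_on UNIV \<and>
     integral UNIV (\<lambda>x. \<bar>line_density x\<bar> * indicat_real B (g x)) = measure lebesgue (B \<inter> {0<..<2 * pi})"
  proof (subst has_absolute_integral_change_of_variables_1'[of UNIV g])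
    show "(g has_field_derivative line_density x) (at x within UNIV)" for x
      unfolding g_def line_density_def
      by (auto intro!: derivative_eq_intros simp: inverse_eq_divide)
    show "inj g" using arctan_eq_iff by (auto simp: inj_on_def g_def)
  qed (auto simp: rg)
  then have "((\<lambda>x. line_density x * indicat_real B (g x)) has_integral measure lebesgue (B \<inter> {0<..<2 * pi})) UNIV"
    by (auto simp: abs_of_pos[OF line_density_pos] has_integral_integrable_integral
        dest: set_lebesgue_integral_eq_integral(1))
  then have "(\<integral>\<^sup>+x. ennreal (line_density x * indicat_real B (g x)) \<partial>lborel) = measure lebesgue (B \<inter> {0<..<2 * pi})"
    using line_density_pos by (intro nn_integral_has_integral_lborel) (auto simp: less_imp_le)
  moreover have "(\<integral>\<^sup>+x. ennreal (line_density x * indicat_real B (g x)) \<partial>lborel) = 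
     emeasure (density lborel line_density) {x. g x \<in> B}"
    by (subst emeasure_density) (auto intro!: nn_integral_cong simp: indicator_def)
  moreover have "emeasure lborel (B \<inter> {0<..<2 * pi}) = measure lebesgue (B \<inter> {0<..<2 * pi})"
    by (rule emeasure_lborel_lmeasurable[OF _ Bm]) auto
  ultimately show ?thesis unfolding g_def by metis
qed

section \<open>Arc length transported to the line\<close>

abbreviation "circle_borel \<equiv> restrict_space borel (sphere (0::complex) 1)"

lemma cayley_line_measurable_circle [measurable]: "cayley_line \<in> lborel \<rightarrow>\<^sub>M circle_borel"
  by (intro measurable_restrict_space2) auto

text \<open>The parametrisations by \<open>cis\<close> and by \<open>cayley_line\<close> differ only
  at the angle 0, that is at the point 1, which is a null set.\<close>

lemma arc_length_eq_line:
  "arc_length = completion (distr (density lborel line_density) circle_borel cayley_line)"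
proof -
  have cism [measurable]: "cis \<in> borel_measurable borel"
    by (intro borel_measurable_continuous_onI continuous_intros)
  have cism': "cis \<in> restrict_space lborel {0..<2 * pi} \<rightarrow>\<^sub>M circle_borel"
    by (intro measurable_restrict_space2 measurable_restrict_space1) auto
  have "distr (restrict_space lborel {0..<2 * pi}) circle_borel cis
      = distr (density lborel line_density) circle_borel cayley_line"
  proof (rule measure_eqI)
    fix A assume "A \<in> sets (distr (restrict_space lborel {0..<2 * pi}) circle_borel cis)"
    then have A: "A \<in> sets circle_borel" by simp
    then have [measurable]: "A \<in> sets borel" by (auto simp: sets_restrict_space)
    have B: "cis -` A \<in> sets borel" using measurable_sets[OF cism, of A] by simp
    have "emeasure (distr (restrict_space lborel {0..<2 * pi}) circle_borel cis) A
        = emeasure (restrict_space lborel {0..<2 * pi}) (cis -` A \<inter> {0..<2 * pi})"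
      using A cism' by (subst emeasure_distr) (auto simp: space_restrict_space)
    also have "\<dots> = emeasure lborel (cis -` A \<inter> {0..<2 * pi})"
      by (subst emeasure_restrict_space) auto
    also have "\<dots> = emeasure lborel (cis -` A \<inter> {0<..<2 * pi})"
      using AE_lborel_singleton[of 0] B by (intro emeasure_eq_AE) (auto elim!: eventually_mono)
    also have "\<dots> = emeasure (density lborel line_density) {x. pi + 2 * arctan x \<in> cis -` A}"
      using B by (rule emeasure_line_density[symmetric])
    also have "\<dots> = emeasure (density lborel line_density) (cayley_line -` A \<inter> space (density lborel line_density))"
      by (auto simp: cayley_line_eq_cis intro!: arg_cong2[where f = emeasure])
    also have "\<dots> = emeasure (distr (density lborel line_density) circle_borel cayley_line) A"
      using A by (subst emeasure_distr) auto
    finally show "emeasure (distr (restrict_space lborel {0..<2 * pi}) circle_borel cis) A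
      = emeasure (distr (density lborel line_density) circle_borel cayley_line) A" .
  qed simp
  then show ?thesis by (simp add: arc_length_def)
qed

lemma borel_measurable_lebesgue_AE:
  fixes f g :: "real \<Rightarrow> 'b::topological_space"
  assumes "f \<in> borel_measurable lebesgue" "AE x in lebesgue. f x = g x"
  shows "g \<in> borel_measurable lebesgue"
proof (rule measurableI)
  fix A :: "'b set" assume "A \<in> sets borel"
  then have A: "f -` A \<in> sets lebesgue" using measurable_sets[OF assms(1)] by auto
  have "AE x in lebesgue. x \<in> f -` A \<longleftrightarrow> x \<in> g -` A" using assms(2) by eventually_elim auto
  then have "g -` A \<in> sets lebesgue"
    by (rule completion.in_sets_AE[OF _ A]) simp
  then show "g -` A \<inter> space lebesgue \<in> sets lebesgue" by simp
qed simp

text \<open>A function measurable for the completed arc length is replaced by a Borel function that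
  agrees with it almost everywhere, so that the substitution rules for \<open>distr\<close> and
  \<open>density\<close> apply. The exceptional set becomes a Lebesgue null set of the line because
  \<open>line_density\<close> is positive.\<close>

lemma
  fixes f :: "complex \<Rightarrow> real"
  assumes f: "f \<in> borel_measurable arc_length"
  shows borel_measurable_cayley_line: "(\<lambda>x. f (cayley_line x)) \<in> borel_measurable lebesgue"
    and integrable_arc_length_iff: "integrable arc_length f \<longleftrightarrow> integrable lebesgue (\<lambda>x. line_density x * f (cayley_line x))"
    and integral_arc_length: "integral\<^sup>L arc_length f = (LINT x|lebesgue. line_density x * f (cayley_line x))"
proof -
  let ?M = "distr (density lborel line_density) circle_borel cayley_line"
  have f1: "f \<in> borel_measurable (completion ?M)" using f by (simp only: arc_length_eq_line)
  obtain f' where f'[measurable]: "f' \<in> borel_measurable ?M" and ae: "AE z in ?M. f z = f' z"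
    using completion_ex_borel_measurable_real[OF f1] by blast
  have "AE x in density lborel line_density. f (cayley_line x) = f' (cayley_line x)"
    using ae by (rule AE_distrD[rotated]) auto
  then have ae': "AE x in lborel. f (cayley_line x) = f' (cayley_line x)"
    using line_density_pos by (subst (asm) AE_density) auto
  have ae'': "AE x in lebesgue. f (cayley_line x) = f' (cayley_line x)"
    using ae' by (rule AE_completion)
  have m1: "(\<lambda>x. f' (cayley_line x)) \<in> borel_measurable lborel" by measurable
  have "AE x in lebesgue. f' (cayley_line x) = f (cayley_line x)" using ae'' by eventually_elim simp
  then show m2: "(\<lambda>x. f (cayley_line x)) \<in> borel_measurable lebesgue"
    by (rule borel_measurable_lebesgue_AE[OF measurable_completion[OF m1]])
  have m3: "(\<lambda>x. line_density x * f' (cayley_line x)) \<in> borel_measurable lborel" by measurable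
  have m4: "(\<lambda>x. line_density x * f (cayley_line x)) \<in> borel_measurable lebesgue"
    using m2 by (intro borel_measurable_times measurable_completion[of line_density]) auto
  have ae3: "AE x in lebesgue. line_density x * f' (cayley_line x) = line_density x * f (cayley_line x)"
    using ae'' by eventually_elim simp
  have "integrable arc_length f \<longleftrightarrow> integrable (completion ?M) f'"
    unfolding arc_length_eq_line
    by (intro integrable_cong_AE f1 measurable_completion[OF f'] AE_completion[OF ae])
  also have "\<dots> \<longleftrightarrow> integrable lborel (\<lambda>x. line_density x * f' (cayley_line x))"
    using m1 line_density_pos
    by (subst integrable_completion, simp, subst integrable_distr_eq, simp, simp, subst integrable_density) (auto simp: less_imp_le)
  also have "\<dots> \<longleftrightarrow> integrable lebesgue (\<lambda>x. line_density x * f' (cayley_line x))"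
    using m3 by (simp add: integrable_completion)
  also have "\<dots> \<longleftrightarrow> integrable lebesgue (\<lambda>x. line_density x * f (cayley_line x))"
    by (intro integrable_cong_AE measurable_completion[OF m3] m4 ae3)
  finally show "integrable arc_length f \<longleftrightarrow> integrable lebesgue (\<lambda>x. line_density x * f (cayley_line x))" .
  have "integral\<^sup>L arc_length f = integral\<^sup>L (completion ?M) f'"
    unfolding arc_length_eq_line
    by (intro integral_cong_AE f1 measurable_completion[OF f'] AE_completion[OF ae])
  also have "\<dots> = (LINT x|lborel. line_density x * f' (cayley_line x))"
    using m1 line_density_pos
    by (subst integral_completion, simp, subst integral_distr, simp, simp, subst integral_density) (auto simp: less_imp_le)
  also have "\<dots> = (LINT x|lebesgue. line_density x * f' (cayley_line x))"
    using m3 by (simp add: integral_completion)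
  also have "\<dots> = (LINT x|lebesgue. line_density x * f (cayley_line x))"
    by (intro integral_cong_AE measurable_completion[OF m3] m4 ae3)
  finally show "integral\<^sup>L arc_length f = (LINT x|lebesgue. line_density x * f (cayley_line x))" .
qed

text \<open>A Lebesgue set is a Borel set up to a subset of a Borel null set. Borel sets have Borel
  images because \<open>line_of_circle\<close> is a Borel inverse, and null sets have null images
  because the image measure has a density. This makes arbitrary measurable subsets of the line
  admissible in the condition on the circle.\<close>

lemma cayley_line_image_sets:
  assumes "E \<in> sets lebesgue"
  shows "cayley_line ` E \<in> sets arc_length"
proof -
  let ?M = "distr (density lborel line_density) circle_borel cayley_line"
  have im: "cayley_line ` B \<in> sets circle_borel" if [measurable]: "B \<in> sets borel" for B
  proof -
    have "cayley_line ` B = {z. z \<noteq> 1 \<and> line_of_circle z \<in> B} \<inter> sphere 0 1"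
      using cayley_line_line_of_circle cayley_line_neq_1 by (auto simp: image_iff) (metis)
    moreover have "{z. z \<noteq> 1 \<and> line_of_circle z \<in> B} \<in> sets borel" by measurable
    ultimately show ?thesis unfolding sets_restrict_space by (subst image_iff) blast
  qed
  obtain S N N' where E: "E = S \<union> N" "N \<subseteq> N'" "N' \<in> null_sets lborel" "S \<in> sets lborel"
    using assms by (rule sets_completionE)
  have "cayley_line ` N' \<in> null_sets ?M"
  proof -
    have "cayley_line -` (cayley_line ` N') = N'" using inj_cayley_line by (simp add: inj_vimage_image_eq)
    then have "emeasure ?M (cayley_line ` N') = emeasure (density lborel line_density) N'"
      using im E(3) by (subst emeasure_distr) auto
    also have "\<dots> = 0"
      using E(3) absolutely_continuousI_density[of line_density lborel] 
      by (auto simp: absolutely_continuous_def)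
    finally show ?thesis using im E(3) by (auto simp: null_sets_def)
  qed
  then show ?thesis unfolding arc_length_eq_line
    using E im by (intro sets_completionI[of _ "cayley_line ` S" "cayley_line ` N"]) (auto simp: image_Un)
qed

section \<open>Arcs and their preimages on the line\<close>

lemma cis_eq_cis_iff: "cis s = cis t \<longleftrightarrow> (\<exists>n::int. s = t + 2 * pi * of_int n)"
proof -
  have "cis s = cis t \<longleftrightarrow> (\<exists>n::int. \<i> * of_real s = \<i> * of_real t + (of_int (2 * n) * pi) * \<i>)"
    unfolding cis_conv_exp exp_eq ..
  also have "\<dots> \<longleftrightarrow> (\<exists>n::int. s = t + 2 * pi * of_int n)"
    by (intro ex_cong1) (auto simp: complex_eq_iff)
  finally show ?thesis .
qed

lemma measure_arc_length_Borel:
  assumes "A \<in> sets circle_borel"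
  shows "A \<in> sets arc_length"
    and "emeasure arc_length A = emeasure lborel (cis -` A \<inter> {0..<2 * pi})"
proof -
  have cism': "cis \<in> restrict_space lborel {0..<2 * pi} \<rightarrow>\<^sub>M circle_borel"
    by (intro measurable_restrict_space2 measurable_restrict_space1)
      (auto intro!: borel_measurable_continuous_onI continuous_intros)
  show "A \<in> sets arc_length" using assms unfolding arc_length_def by simp
  have "emeasure arc_length A = emeasure (restrict_space lborel {0..<2 * pi}) (cis -` A \<inter> {0..<2 * pi})"
    unfolding arc_length_def using assms cism'
    by (subst emeasure_completion, simp, subst emeasure_distr) (auto simp: space_restrict_space)
  also have "\<dots> = emeasure lborel (cis -` A \<inter> {0..<2 * pi})"
    by (subst emeasure_restrict_space) auto
  finally show "emeasure arc_length A = emeasure lborel (cis -` A \<inter> {0..<2 * pi})" .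
qed

lemma arc_Borel: "cis ` {a..b} \<in> sets circle_borel"
proof -
  have "compact (cis ` {a..b})" by (intro compact_continuous_image continuous_intros) auto
  then have "cis ` {a..b} \<in> sets borel" by (simp add: compact_imp_closed)
  moreover have "cis ` {a..b} = sphere 0 1 \<inter> cis ` {a..b}" by auto
  ultimately show ?thesis unfolding sets_restrict_space by (metis imageI)
qed

lemma arc_in_sets [simp]: "cis ` {a..b} \<in> sets arc_length"
  using measure_arc_length_Borel(1)[OF arc_Borel] .

lemma arc_shift: "cis ` {a + 2 * pi * of_int n..b + 2 * pi * of_int n} = cis ` {a..b}"
proof -
  have "cis ` {a + 2 * pi * of_int n..b + 2 * pi * of_int n} = cis ` (\<lambda>t. t + 2 * pi * of_int n) ` {a..b}"
    by (simp only: image_add_atLeastAtMost')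
  also have "\<dots> = (\<lambda>t. cis (t + 2 * pi * of_int n)) ` {a..b}" by (rule image_image)
  also have "(\<lambda>t. cis (t + 2 * pi * of_int n)) = cis" using cis_eq_cis_iff by blast
  finally show ?thesis .
qed

text \<open>A shift by a multiple of 2 pi puts the initial angle c into [0, 2 pi). If the arc passes
  the angle 2 pi, its trace on the fundamental domain splits into an initial and a final
  piece.\<close>

lemma emeasure_arc_length_arc:
  assumes "a \<le> b" "b \<le> a + 2 * pi"
  shows "emeasure arc_length (cis ` {a..b}) = ennreal (b - a)"
proof -
  define n where "n = \<lfloor>a / (2 * pi)\<rfloor>"
  define c where "c = a - 2 * pi * of_int n"
  define d where "d = b - 2 * pi * of_int n"
  have "of_int n \<le> a / (2 * pi)" "a / (2 * pi) < of_int n + 1" unfolding n_def by linarith+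
  then have c: "0 \<le> c" "c < 2 * pi" unfolding c_def by (auto simp: field_simps)
  have d: "c \<le> d" "d \<le> c + 2 * pi" "d - c = b - a" using assms by (auto simp: c_def d_def)
  have arc: "cis ` {a..b} = cis ` {c..d}" using arc_shift[of c n d] by (simp add: c_def d_def)
  have iff: "cis t \<in> cis ` {c..d} \<longleftrightarrow> (c \<le> t \<and> t \<le> d) \<or> t \<le> d - 2 * pi" if t: "t \<in> {0..<2 * pi}" for t
  proof
    assume "cis t \<in> cis ` {c..d}"
    then obtain s where s: "c \<le> s" "s \<le> d" "cis s = cis t" by auto
    then obtain k :: int where k: "s = t + 2 * pi * of_int k" unfolding cis_eq_cis_iff by auto
    have "-1 < real_of_int k"
    proof (rule ccontr)
      assume "\<not> - 1 < real_of_int k"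
      then have "2 * pi * of_int k \<le> 2 * pi * (-1)" by (intro mult_left_mono) auto
      then show False using k s(1) c t unfolding atLeastLessThan_iff by linarith
    qed
    moreover have "of_int k < (2::real)"
    proof (rule ccontr)
      assume "\<not> real_of_int k < 2"
      then have "2 * pi * 2 \<le> 2 * pi * of_int k" by (intro mult_left_mono) auto
      then show False using k s(2) c d(2) t unfolding atLeastLessThan_iff by linarith
    qed
    ultimately have "k = 0 \<or> k = 1" by linarith
    then show "(c \<le> t \<and> t \<le> d) \<or> t \<le> d - 2 * pi" using k s by auto
  next
    have "cis (t + 2 * pi * of_int 1) = cis t" using cis_eq_cis_iff by blast
    assume "(c \<le> t \<and> t \<le> d) \<or> t \<le> d - 2 * pi"
    then show "cis t \<in> cis ` {c..d}"
    proof
      assume "c \<le> t \<and> t \<le> d"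
      then show ?thesis by auto
    next
      assume "t \<le> d - 2 * pi"
      then have "t + 2 * pi * of_int 1 \<in> {c..d}" using c t by auto
      then show ?thesis using \<open>cis (t + 2 * pi * of_int 1) = cis t\<close> by (metis imageI)
    qed
  qed
  have eq: "cis -` cis ` {c..d} \<inter> {0..<2 * pi} = {t \<in> {0..<2 * pi}. (c \<le> t \<and> t \<le> d) \<or> t \<le> d - 2 * pi}"
    using iff unfolding vimage_def by blast
  have "emeasure lborel {t \<in> {0..<2 * pi}. (c \<le> t \<and> t \<le> d) \<or> t \<le> d - 2 * pi} = ennreal (d - c)"
  proof (cases "d < 2 * pi")
    case True
    then have "{t \<in> {0..<2 * pi}. (c \<le> t \<and> t \<le> d) \<or> t \<le> d - 2 * pi} = {c..d}" using c by auto
    then show ?thesis using d by simp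
  next
    case False
    show ?thesis
    \<comment> \<open>For the full circle the two pieces would share the point c, so additivity
      needs d < c + 2 pi.\<close>
    proof (cases "d = c + 2 * pi")
      case True
      then have "{t \<in> {0..<2 * pi}. (c \<le> t \<and> t \<le> d) \<or> t \<le> d - 2 * pi} = {0..<2 * pi}" using c by auto
      then show ?thesis using True by simp
    next
      case neq: False
      have "{t \<in> {0..<2 * pi}. (c \<le> t \<and> t \<le> d) \<or> t \<le> d - 2 * pi} = {0..d - 2 * pi} \<union> {c..<2 * pi}"
        using False c d neq by auto
      also have "emeasure lborel \<dots> = emeasure lborel {0..d - 2 * pi} + emeasure lborel {c..<2 * pi}"
        using neq d by (intro plus_emeasure[symmetric]) auto
      also have "\<dots> = ennreal (d - c)" using False c by (simp flip: ennreal_plus)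
      finally show ?thesis .
    qed
  qed
  then show ?thesis
    unfolding arc measure_arc_length_Borel(2)[OF arc_Borel] eq using d by simp
qed

lemma measure_arc_length_arc:
  "a \<le> b \<Longrightarrow> b \<le> a + 2 * pi \<Longrightarrow> measure arc_length (cis ` {a..b}) = b - a"
  by (simp add: measure_def emeasure_arc_length_arc)

lemma arcI: "a < b \<Longrightarrow> b \<le> a + 2 * pi \<Longrightarrow> cis ` {a..b} \<in> arcs"
  unfolding arcs_def by auto

text \<open>The arguments of the point are pi + 2 arctan x, which lies in (0, 2 pi), and its
  translates by multiples of 2 pi; only this one and the preceding one fall into
  [-2 pi, 2 pi].\<close>

lemma cayley_line_in_arc:
  assumes "-2 * pi \<le> a" "b \<le> 2 * pi" 
  shows "cayley_line x \<in> cis ` {a..b} \<longleftrightarrow>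
    (pi + 2 * arctan x \<in> {a..b} \<or> 2 * arctan x - pi \<in> {a..b})"
proof
  have bd: "- pi < 2 * arctan x" "2 * arctan x < pi" using arctan_bounded[of x] by auto
  assume "cayley_line x \<in> cis ` {a..b}"
  then obtain s where s: "a \<le> s" "s \<le> b" "cis s = cis (pi + 2 * arctan x)"
    by (auto simp: cayley_line_eq_cis)
  then obtain k :: int where k: "s = pi + 2 * arctan x + 2 * pi * of_int k" unfolding cis_eq_cis_iff by auto
  have "-2 < real_of_int k"
  proof (rule ccontr)
    assume "\<not> - 2 < real_of_int k"
    then have "2 * pi * of_int k \<le> 2 * pi * (-2)" by (intro mult_left_mono) auto
    then show False using k s(1) bd assms by linarith
  qed
  moreover have "of_int k < (1::real)"
  proof (rule ccontr)
    assume "\<not> real_of_int k < 1"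
    then have "2 * pi * 1 \<le> 2 * pi * of_int k" by (intro mult_left_mono) auto
    then show False using k s(2) bd assms by linarith
  qed
  ultimately have "k = 0 \<or> k = -1" by linarith
  then show "pi + 2 * arctan x \<in> {a..b} \<or> 2 * arctan x - pi \<in> {a..b}" using k s by auto
next
  have "cis (pi + 2 * arctan x) = cis (2 * arctan x - pi)"
    unfolding cis_eq_cis_iff by (intro exI[of _ 1]) auto
  moreover assume "pi + 2 * arctan x \<in> {a..b} \<or> 2 * arctan x - pi \<in> {a..b}"
  ultimately show "cayley_line x \<in> cis ` {a..b}" unfolding cayley_line_eq_cis by (metis imageI)
qed

lemma cayley_line_in_arc_interval:
  "cayley_line x \<in> cis ` {pi + 2 * arctan a..pi + 2 * arctan b} \<longleftrightarrow> x \<in> {a..b}"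
proof -
  have bd: "- pi < 2 * arctan y" "2 * arctan y < pi" for y using arctan_bounded[of y] by auto
  have "cayley_line x \<in> cis ` {pi + 2 * arctan a..pi + 2 * arctan b} \<longleftrightarrow>
    (pi + 2 * arctan x \<in> {pi + 2 * arctan a..pi + 2 * arctan b} \<or> 2 * arctan x - pi \<in> {pi + 2 * arctan a..pi + 2 * arctan b})"
    using bd[of a] bd[of b] by (intro cayley_line_in_arc) auto
  then show ?thesis using bd[of x] bd[of a] arctan_le_iff by force
qed

text \<open>The arc is centred at 1 with half-length pi - 2 arctan R. Such arcs do not come from
  intervals of the line; they carry the information about infinity.\<close>

lemma cayley_line_in_arc_tail:
  assumes "0 \<le> R"
  shows "cayley_line x \<in> cis ` {2 * arctan R - pi..pi - 2 * arctan R} \<longleftrightarrow> R \<le> \<bar>x\<bar>"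
proof -
  have bd: "- pi < 2 * arctan y" "2 * arctan y < pi" for y using arctan_bounded[of y] by auto
  have R: "0 \<le> arctan R" using assms by simp
  have "cayley_line x \<in> cis ` {2 * arctan R - pi..pi - 2 * arctan R} \<longleftrightarrow>
    (pi + 2 * arctan x \<in> {2 * arctan R - pi..pi - 2 * arctan R} \<or> 2 * arctan x - pi \<in> {2 * arctan R - pi..pi - 2 * arctan R})"
    using bd[of R] R pi_ge_zero by (intro cayley_line_in_arc; linarith)
  also have "\<dots> \<longleftrightarrow> arctan x \<le> arctan (- R) \<or> arctan R \<le> arctan x"
    using bd[of x] bd[of R] R by (auto simp: arctan_minus)
  also have "\<dots> \<longleftrightarrow> R \<le> \<bar>x\<bar>" unfolding arctan_le_iff by linarith
  finally show ?thesis .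
qed

lemma
  fixes f :: "complex \<Rightarrow> real"
  assumes A: "A \<in> sets arc_length" and f: "f \<in> borel_measurable arc_length"
  shows set_integrable_arc_length_iff: "set_integrable arc_length A f \<longleftrightarrow>
      set_integrable lebesgue {x. cayley_line x \<in> A} (\<lambda>x. line_density x * f (cayley_line x))"
    and set_integral_arc_length: "(LINT z:A|arc_length. f z) =
      (LINT x:{x. cayley_line x \<in> A}|lebesgue. line_density x * f (cayley_line x))"
proof -
  have m: "(\<lambda>z. indicator A z *\<^sub>R f z) \<in> borel_measurable arc_length"
    using A f by (intro borel_measurable_scaleR borel_measurable_indicator)
  have eq: "line_density x * (indicator A (cayley_line x) *\<^sub>R f (cayley_line x)) =
     indicator {x. cayley_line x \<in> A} x *\<^sub>R (line_density x * f (cayley_line x))" for x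
    by (auto simp: indicator_def)
  show "set_integrable arc_length A f \<longleftrightarrow>
      set_integrable lebesgue {x. cayley_line x \<in> A} (\<lambda>x. line_density x * f (cayley_line x))"
    using integrable_arc_length_iff[OF m] unfolding set_integrable_def eq .
  show "(LINT z:A|arc_length. f z) =
      (LINT x:{x. cayley_line x \<in> A}|lebesgue. line_density x * f (cayley_line x))"
    using integral_arc_length[OF m] unfolding set_lebesgue_integral_def eq .
qed

section \<open>Mean oscillation on the line\<close>

lemma set_integral_mono_set_nonneg:
  fixes f :: "'a \<Rightarrow> real"
  assumes "set_integrable M B f" "A \<in> sets M" "A \<subseteq> B" "\<And>x. x \<in> B \<Longrightarrow> 0 \<le> f x"
  shows "(LINT x:A|M. f x) \<le> (LINT x:B|M. f x)"
  unfolding set_lebesgue_integral_def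
proof (rule integral_mono)
  show "integrable M (\<lambda>x. indicat_real A x *\<^sub>R f x)"
    using set_integrable_subset[OF assms(1-3)] by (simp add: set_integrable_def)
  show "integrable M (\<lambda>x. indicat_real B x *\<^sub>R f x)" using assms(1) by (simp add: set_integrable_def)
  show "indicat_real A x *\<^sub>R f x \<le> indicat_real B x *\<^sub>R f x" for x
    using assms(3,4) by (auto simp: indicator_def)
qed

lemma set_integral_nonneg_on:
  fixes f :: "'a \<Rightarrow> real"
  assumes "\<And>x. x \<in> A \<Longrightarrow> 0 \<le> f x"
  shows "0 \<le> (LINT x:A|M. f x)"
  unfolding set_lebesgue_integral_def using assms by (intro integral_nonneg_AE) (auto simp: indicator_def)

lemma set_integral_Un_le:
  fixes f :: "'a \<Rightarrow> real"
  assumes "set_integrable M A f" "set_integrable M B f" "A \<in> sets M" "B \<in> sets M"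
    and "\<And>x. x \<in> A \<Longrightarrow> 0 \<le> f x"
  shows "(LINT x:A \<union> B|M. f x) \<le> (LINT x:A|M. f x) + (LINT x:B|M. f x)"
proof -
  have A': "set_integrable M (A - B) f" using assms by (auto intro: set_integrable_subset)
  have "(LINT x:A \<union> B|M. f x) = (LINT x:(A - B) \<union> B|M. f x)" by simp
  also have "\<dots> = (LINT x:A - B|M. f x) + (LINT x:B|M. f x)"
    using A' assms by (intro set_integral_Un) auto
  also have "(LINT x:A - B|M. f x) \<le> (LINT x:A|M. f x)"
    using assms by (intro set_integral_mono_set_nonneg) auto
  finally show ?thesis by simp
qed

lemma set_integral_le_cmult:
  fixes f g :: "'a \<Rightarrow> real"
  assumes "set_integrable M A f" "set_integrable M A g" "\<And>x. x \<in> A \<Longrightarrow> f x \<le> c * g x"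
  shows "(LINT x:A|M. f x) \<le> c * (LINT x:A|M. g x)"
proof -
  have "(LINT x:A|M. f x) \<le> (LINT x:A|M. c * g x)"
    using assms by (intro set_integral_mono) auto
  then show ?thesis by simp
qed

lemma set_integrable_bound_mult:
  fixes f g :: "'a \<Rightarrow> real"
  assumes "set_integrable M A g" "A \<in> sets M" "f \<in> borel_measurable M"
    "\<And>x. x \<in> A \<Longrightarrow> \<bar>f x\<bar> \<le> c * \<bar>g x\<bar>"
  shows "set_integrable M A f"
proof (rule set_integrable_bound[of M A "\<lambda>x. c * g x"])
  show "set_borel_measurable M A f" using assms(2,3) unfolding set_borel_measurable_def by measurable
  show "AE x in M. x \<in> A \<longrightarrow> norm (f x) \<le> norm (c * g x)"
  proof (intro AE_I2 impI)
    fix x assume "x \<in> A"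
    have "c * \<bar>g x\<bar> \<le> \<bar>c\<bar> * \<bar>g x\<bar>" by (intro mult_right_mono) auto
    then show "norm (f x) \<le> norm (c * g x)" using assms(4)[OF \<open>x \<in> A\<close>] by (simp add: abs_mult)
  qed
qed (use assms in auto)

lemma set_integral_const_lebesgue:
  assumes "A \<in> lmeasurable"
  shows "set_integrable lebesgue A (\<lambda>x. c :: real)" "(LINT x:A|lebesgue. (c::real)) = c * measure lebesgue A"
proof -
  show "set_integrable lebesgue A (\<lambda>x. c :: real)"
    using assms unfolding set_integrable_def by (auto simp: fmeasurable_def intro!: integrable_mult_left)
  show "(LINT x:A|lebesgue. (c::real)) = c * measure lebesgue A"
    using assms unfolding set_lebesgue_integral_def by (simp add: fmeasurableD mult.commute)
qed

lemma set_integrable_abs_diff_const: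
  fixes f :: "real \<Rightarrow> real"
  assumes "set_integrable lebesgue A f" "A \<in> lmeasurable"
  shows "set_integrable lebesgue A (\<lambda>x. \<bar>f x - c\<bar>)"
  using assms by (intro set_integrable_abs set_integral_diff set_integral_const_lebesgue) auto

text \<open>The mean is an optimal constant up to a factor 2, so later estimates may centre at
  whatever constant is convenient.\<close>

lemma mean_oscillation_le:
  fixes f :: "'a \<Rightarrow> real"
  assumes f: "set_integrable M I f" and I: "I \<in> sets M" and pos: "0 < measure M I"
    and le: "(LINT x:I|M. \<bar>f x - c\<bar>) \<le> K * measure M I"
  shows "mean_oscillation M I f \<le> 2 * K"
proof -
  have fin: "emeasure M I < \<infinity>" using pos by (metis less_top enn2real_top infinity_ennreal_def measure_def less_irrefl)
  have const: "set_integrable M I (\<lambda>x. d :: real)" for d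
    using I fin unfolding set_integrable_def by (auto intro!: integrable_mult_left)
  have intc: "(LINT x:I|M. (d::real)) = d * measure M I" for d
    using I fin sets.sets_into_space[OF I]
    unfolding set_lebesgue_integral_def by (simp add: Int_absorb2 mult.commute)
  have i1: "set_integrable M I (\<lambda>x. \<bar>f x - d\<bar>)" for d
    using f const by (intro set_integrable_abs set_integral_diff) auto
  have "\<bar>mean M I f - c\<bar> * measure M I = \<bar>(LINT x:I|M. f x) - (LINT x:I|M. c)\<bar>"
    using pos by (simp add: mean_def intc field_simps abs_mult[symmetric] abs_if)
  also have "\<dots> = \<bar>LINT x:I|M. f x - c\<bar>" using f const by (subst set_integral_diff(2)) auto
  also have "\<dots> \<le> (LINT x:I|M. \<bar>f x - c\<bar>)"
    unfolding set_lebesgue_integral_def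
    by (rule order_trans[OF integral_abs_bound]) (simp add: abs_mult)
  finally have *: "\<bar>mean M I f - c\<bar> * measure M I \<le> K * measure M I" using le by simp
  have "(LINT x:I|M. \<bar>f x - mean M I f\<bar>) \<le> (LINT x:I|M. \<bar>f x - c\<bar> + \<bar>mean M I f - c\<bar>)"
    using i1 const by (intro set_integral_mono set_integral_add) auto
  also have "\<dots> = (LINT x:I|M. \<bar>f x - c\<bar>) + \<bar>mean M I f - c\<bar> * measure M I"
    using i1 const by (subst set_integral_add(2)) (auto simp: intc)
  also have "\<dots> \<le> (2 * K) * measure M I" using le * by simp
  finally show ?thesis
    unfolding mean_oscillation_def using pos by (subst mean_def) (simp add: field_simps)
qed

text \<open>On tame intervals the Cayley transformation has bounded distortion.\<close>

definition tame :: "real \<Rightarrow> real \<Rightarrow> bool" where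
  "tame a b \<longleftrightarrow> - 2 \<le> a \<and> b \<le> 2 \<or> (\<exists>R\<ge>1. R \<le> a \<and> b \<le> 2 * R \<or> - (2 * R) \<le> a \<and> b \<le> - R)"

text \<open>With R the larger of |a| and |b|, an interval that is not tame has R or -R as an
  endpoint and reaches past the half radius on that side. It therefore contains one side of an
  annulus and has length comparable to R.\<close>

lemma tame_or_large:
  assumes "a < b"
  shows "tame a b \<or> (\<exists>R>2. - R \<le> a \<and> b \<le> R \<and> R / 2 \<le> b - a \<and> 
    ({R/2..R} \<subseteq> {a..b} \<or> {- R..- (R/2)} \<subseteq> {a..b}))"
proof -
  define R where "R = max \<bar>a\<bar> \<bar>b\<bar>"
  show ?thesis
  proof (cases "R \<le> 2")
    case True
    then show ?thesis unfolding R_def tame_def by auto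
  next
    case False
    have b: "tame a b \<or> {R/2..R} \<subseteq> {a..b} \<and> R / 2 \<le> b - a" if "R = b"
    proof (cases "R / 2 \<le> a")
      case True
      then have "1 \<le> R/2 \<and> (R/2 \<le> a \<and> b \<le> 2 * (R/2))" using False that by auto
      then show ?thesis unfolding tame_def by blast
    qed (use that in auto)
    have a: "tame a b \<or> {- R..- (R/2)} \<subseteq> {a..b} \<and> R / 2 \<le> b - a" if "R = - a"
    proof (cases "b \<le> - (R / 2)")
      case True
      then have "1 \<le> R/2 \<and> (- (2 * (R/2)) \<le> a \<and> b \<le> - (R/2))" using False that by auto
      then show ?thesis unfolding tame_def by blast
    qed (use that in auto)
    have "R = b \<or> R = - a" using assms unfolding R_def by (auto simp: max_def abs_if split: if_splits)
    then have "tame a b \<or> R / 2 \<le> b - a \<and> ({R/2..R} \<subseteq> {a..b} \<or> {- R..- (R/2)} \<subseteq> {a..b})"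
      using a b by argo
    moreover have "- R \<le> a" "b \<le> R" unfolding R_def by auto
    ultimately show ?thesis using False unfolding not_le by blast
  qed
qed

text \<open>Serves to compare a short interval with a tame one of length at least 1. If an endpoint
  has modulus R > 2, the interval lies in [R/2, R] or [-R, -R/2] because b - a <= 1 < R/2.\<close>

lemma tame_enclosing:
  assumes "a < b" "b - a \<le> 1"
  obtains c d where "tame c d" "c \<le> a" "b \<le> d" "1 \<le> d - c"
proof -
  define R where "R = max \<bar>a\<bar> \<bar>b\<bar>"
  show thesis
  proof (cases "R \<le> 2")
    case True
    then show thesis using that[of "-2" 2] unfolding R_def tame_def by auto
  next
    case False
    have tame: "tame (R/2) R" "tame (-R) (-(R/2))"
      unfolding tame_def using False by (intro disjI2 exI[of _ "R/2"]; simp)+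
    have "R = b \<or> R = - a" using assms unfolding R_def by (auto simp: max_def abs_if split: if_splits)
    then show thesis using that[OF tame(1)] that[OF tame(2)] False assms by auto
  qed
qed

lemma tame_subset:
  assumes "tame c d" "c \<le> a" "b \<le> d"
  shows "tame a b"
  using assms(1) unfolding tame_def
proof (elim disjE exE conjE)
  fix R assume "1 \<le> R" "R \<le> c" "d \<le> 2 * R"
  then show "- 2 \<le> a \<and> b \<le> 2 \<or> (\<exists>R\<ge>1. R \<le> a \<and> b \<le> 2 * R \<or> - (2 * R) \<le> a \<and> b \<le> - R)"
    using assms by (intro disjI2 exI[of _ R]) auto
next
  fix R assume "1 \<le> R" "- (2 * R) \<le> c" "d \<le> - R"
  then show "- 2 \<le> a \<and> b \<le> 2 \<or> (\<exists>R\<ge>1. R \<le> a \<and> b \<le> 2 * R \<or> - (2 * R) \<le> a \<and> b \<le> - R)"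
    using assms by (intro disjI2 exI[of _ R]) auto
qed (use assms in auto)

section \<open>Dyadic annuli and a BMO criterion on the line\<close>

lemma ex_power2_bracket:
  fixes R :: real
  assumes "1 \<le> R"
  obtains n :: nat where "2 ^ n \<le> R" "R < 2 * 2 ^ n"
proof -
  define n where "n = (LEAST n::nat. R < 2 ^ n)"
  have n: "R < 2 ^ n" unfolding n_def
    using real_arch_pow[of 2 R] LeastI_ex[of "\<lambda>n. R < 2 ^ n"] by simp
  have "n \<noteq> 0" using n assms by (cases n) auto
  then obtain m where m: "n = Suc m" by (cases n) auto
  have "\<not> R < 2 ^ m" using not_less_Least[of m "\<lambda>n. R < 2 ^ n"] m unfolding n_def by auto
  then show thesis using that[of m] n m by auto
qed

lemma Icc_lmeasurable [simp]: "{a..b::real} \<in> lmeasurable"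
  using lmeasurable_cbox[of a b] by simp

lemma annulus_eq: 
  assumes "0 \<le> R"
  shows "{x::real. R \<le> \<bar>x\<bar> \<and> \<bar>x\<bar> \<le> S} = {R..S} \<union> {-S..-R}"
  using assms by (auto simp: abs_if)

lemma annulus_lmeasurable:
  assumes "0 \<le> R"
  shows "{x::real. R \<le> \<bar>x\<bar> \<and> \<bar>x\<bar> \<le> S} \<in> lmeasurable"
  unfolding annulus_eq[OF assms] by (intro fmeasurable.Un) auto

lemma measure_annulus:
  fixes R S :: real
  assumes "0 < R" "R \<le> S"
  shows "measure lebesgue {x. R \<le> \<bar>x\<bar> \<and> \<bar>x\<bar> \<le> S} = 2 * (S - R)"
proof -
  have "measure lebesgue ({R..S} \<union> {-S..-R}) = measure lebesgue {R..S} + measure lebesgue {-S..-R}"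
    using assms by (intro measure_Un3[THEN trans]) (auto simp: Int_absorb)
  then show ?thesis unfolding annulus_eq[OF less_imp_le[OF assms(1)]] using assms by simp
qed

text \<open>The annuli with inner radii 2^n and 2^(n+1) overlap in a set of size comparable to both,
  so their constants differ by a bounded multiple of K. Adding one annulus at a time bounds the
  oscillation about c n on {-(4 * 2^n)..4 * 2^n} by a multiple of the radius, and an interval that
  is not tame is comparable in size to such a set.\<close>

lemma BMO_line_criterion:
  fixes f :: "real \<Rightarrow> real"
  assumes f: "locally_integrable lebesgue intervals f"
    and tame: "\<And>a b. a < b \<Longrightarrow> tame a b \<Longrightarrow> \<exists>c. (LINT x:{a..b}|lebesgue. \<bar>f x - c\<bar>) \<le> K * (b - a)"
    and ann: "\<And>R. 1 \<le> R \<Longrightarrow> \<exists>c. (LINT x:{x. R \<le> \<bar>x\<bar> \<and> \<bar>x\<bar> \<le> 4 * R}|lebesgue. \<bar>f x - c\<bar>) \<le> K * R"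
  shows "f \<in> BMO lebesgue intervals"
proof -
  have fi: "set_integrable lebesgue {a..b} f" if "a < b" for a b
    using f that unfolding locally_integrable_def intervals_def by auto
  have fiA: "set_integrable lebesgue A f" if "A \<in> sets lebesgue" "A \<subseteq> {-r..r}" for A r
    using set_integrable_subset[OF fi[of "-r-1" "r+1"] that(1)] that(2)
    by (cases "A = {}") (fastforce simp: set_integrable_def)+
  have fic: "set_integrable lebesgue A (\<lambda>x. \<bar>f x - c\<bar>)" if "A \<in> sets lebesgue" "A \<subseteq> {-r..r}" for A r c
    by (rule set_integrable_abs_diff_const[OF fiA[OF that] fmeasurableI2[OF Icc_lmeasurable that(2,1)]])
  let ?ann = "\<lambda>R. {x::real. R \<le> \<bar>x\<bar> \<and> \<bar>x\<bar> \<le> 4 * R}"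
  have annm: "?ann R \<in> sets lebesgue" if "0 \<le> R" for R using annulus_lmeasurable[OF that] by (rule fmeasurableD)
  have annsub: "?ann R \<subseteq> {-(4*R)..4*R}" for R by (auto simp: abs_le_iff)
  obtain c where c: "\<And>n::nat. (LINT x:?ann (2^n)|lebesgue. \<bar>f x - c n\<bar>) \<le> K * 2^n"
    using ann[of "2 ^ n" for n] by (simp only: one_le_power one_le_numeral) metis
  have K: "0 \<le> K" using c[of 0] set_integral_nonneg_on[of "?ann 1" "\<lambda>x. \<bar>f x - c 0\<bar>" lebesgue] by simp
  \<comment> \<open>The first entry closes the induction through K' + 8 K <= 2 K'; the second is its
    start.\<close>
  define K' where "K' = max (8 * K) (LINT x:{-4..4}|lebesgue. \<bar>f x - c 0\<bar>)"
  have big: "(LINT x:{-(4 * 2^n)..4*2^n}|lebesgue. \<bar>f x - c n\<bar>) \<le> K' * 2^n" for n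
  proof (induction n)
    case 0
    then show ?case by (simp add: K'_def)
  next
    case (Suc n)
    let ?B = "{-(4 * 2^n)..4*2^n::real}"
    let ?C = "{x::real. 2 * 2^n \<le> \<bar>x\<bar> \<and> \<bar>x\<bar> \<le> 4 * 2^n}"
    have Cm: "?C \<in> lmeasurable" by (rule annulus_lmeasurable) simp
    have Cs: "?C \<in> sets lebesgue" using Cm by (rule fmeasurableD)
    have Csub: "?C \<subseteq> ?ann (2^n)" "?C \<subseteq> ?ann (2^Suc n)" by auto
    have Csub3: "?C \<subseteq> ?B" by (auto simp: abs_le_iff)
    have ai: "set_integrable lebesgue (?ann (2^m)) (\<lambda>x. \<bar>f x - d\<bar>)" for m d
      by (rule fic[OF annm annsub]) simp
    \<comment> \<open>The overlap has measure 4 * 2^n; integrating the triangle inequality over it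
      compares the two constants.\<close>
    have "\<bar>c n - c (Suc n)\<bar> * (4 * 2^n) = (LINT x:?C|lebesgue. \<bar>c n - c (Suc n)\<bar>)"
      using measure_annulus[of "2 * 2^n" "4 * 2^n"] set_integral_const_lebesgue(2)[OF Cm] by simp
    also have "\<dots> \<le> (LINT x:?C|lebesgue. \<bar>f x - c n\<bar> + \<bar>f x - c (Suc n)\<bar>)"
      using fic[OF Cs Csub3]
      by (intro set_integral_mono set_integral_const_lebesgue[OF Cm] set_integral_add) auto
    also have "\<dots> = (LINT x:?C|lebesgue. \<bar>f x - c n\<bar>) + (LINT x:?C|lebesgue. \<bar>f x - c (Suc n)\<bar>)"
      using fic[OF Cs Csub3] by (intro set_integral_add) auto
    also have "\<dots> \<le> K * 2^n + K * 2^Suc n"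
      by (intro add_mono order_trans[OF set_integral_mono_set_nonneg c] ai Cs Csub) auto
    finally have diff: "\<bar>c n - c (Suc n)\<bar> * (4 * 2^n) \<le> 3 * K * 2^n" by simp
    have "(LINT x:{-(4 * 2^Suc n)..4*2^Suc n}|lebesgue. \<bar>f x - c (Suc n)\<bar>) \<le>
        (LINT x:?B \<union> ?ann (2^Suc n)|lebesgue. \<bar>f x - c (Suc n)\<bar>)"
    proof (rule set_integral_mono_set_nonneg)
      have "?B \<union> ?ann (2 ^ Suc n) \<subseteq> {- (4 * 2^Suc n)..4*2^Suc n}" by (auto simp: abs_le_iff)
      then show "set_integrable lebesgue (?B \<union> ?ann (2 ^ Suc n)) (\<lambda>x. \<bar>f x - c (Suc n)\<bar>)"
        by (rule fic[rotated]) (intro sets.Un annm, simp_all)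
      have "x \<in> ?B \<or> 2 * 2^n \<le> \<bar>x\<bar>" for x :: real
        using zero_less_power[of "2::real" n] by (simp only: atLeastAtMost_iff) linarith
      moreover have "\<bar>x\<bar> \<le> 4 * 2^Suc n" if "x \<in> {-(4 * 2^Suc n)..4*2^Suc n}" for x :: real
        using that unfolding atLeastAtMost_iff by linarith
      ultimately show "{-(4 * 2^Suc n)..4*2^Suc n} \<subseteq> ?B \<union> ?ann (2^Suc n)"
        by (auto simp del: atLeastAtMost_iff)
    qed auto
    also have "\<dots> \<le> (LINT x:?B|lebesgue. \<bar>f x - c (Suc n)\<bar>) + (LINT x:?ann (2^Suc n)|lebesgue. \<bar>f x - c (Suc n)\<bar>)"
      using annm[of "2^Suc n"] by (intro set_integral_Un_le ai fic[of ?B "4*2^n"]) auto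
    also have "(LINT x:?B|lebesgue. \<bar>f x - c (Suc n)\<bar>) \<le> (LINT x:?B|lebesgue. \<bar>f x - c n\<bar> + \<bar>c n - c (Suc n)\<bar>)"
      using fic[of ?B "4*2^n"] by (intro set_integral_mono set_integral_add set_integral_const_lebesgue) auto
    also have "\<dots> = (LINT x:?B|lebesgue. \<bar>f x - c n\<bar>) + \<bar>c n - c (Suc n)\<bar> * (8 * 2^n)"
      using fic[of ?B "4*2^n"] by (subst set_integral_add(2)) (auto simp: set_integral_const_lebesgue)
    finally have "(LINT x:{-(4 * 2^Suc n)..4*2^Suc n}|lebesgue. \<bar>f x - c (Suc n)\<bar>) \<le> 
       K' * 2^n + 6 * K * 2^n + K * 2^Suc n"
      using Suc c[of "Suc n"] diff by linarith
    also have "\<dots> = (K' + 8 * K) * 2^n" by (simp add: algebra_simps)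
    also have "\<dots> \<le> (K' + K') * 2^n" by (intro mult_right_mono add_left_mono) (auto simp: K'_def)
    finally show ?case by simp
  qed
  have K': "0 \<le> K'" using K by (simp add: K'_def)
  have "\<exists>c. (LINT x:{a..b}|lebesgue. \<bar>f x - c\<bar>) \<le> max K (2 * K') * (b - a)" if ab: "a < b" for a b
  proof -
    consider "tame a b" | R where "2 < R" "- R \<le> a" "b \<le> R" "R / 2 \<le> b - a"
      using tame_or_large[OF ab] by blast
    then show ?thesis
    proof cases
      case 1
      then obtain c where "(LINT x:{a..b}|lebesgue. \<bar>f x - c\<bar>) \<le> K * (b - a)" using tame[OF ab] by blast
      also have "\<dots> \<le> max K (2 * K') * (b - a)" using ab by (intro mult_right_mono) auto
      finally show ?thesis by blast
    next
      case R: 2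
      \<comment> \<open>The set of radius 4 * 2^n contains {a..b}, and 2^n <= R <= 2 (b - a) keeps
        the two comparable.\<close>
      obtain n :: nat where n: "2 ^ n \<le> R" "R < 2 * 2 ^ n" using ex_power2_bracket[of R] R by auto
      have "(LINT x:{a..b}|lebesgue. \<bar>f x - c n\<bar>) \<le> (LINT x:{-(4 * 2^n)..4*2^n}|lebesgue. \<bar>f x - c n\<bar>)"
        using fic[of "{-(4 * 2^n)..4*2^n}" "4*2^n"] n R by (intro set_integral_mono_set_nonneg) auto
      also have "\<dots> \<le> K' * 2^n" by (rule big)
      also have "\<dots> \<le> K' * (2 * (b - a))" using n R K' by (intro mult_left_mono) auto
      also have "\<dots> = (2 * K') * (b - a)" by simp
      also have "\<dots> \<le> max K (2 * K') * (b - a)" by (rule mult_right_mono) (use ab in auto)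
      finally show ?thesis by blast
    qed
  qed
  then have "mean_oscillation lebesgue {a..b} f \<le> 2 * max K (2 * K')" if ab: "a < b" for a b
    using ab fi[OF ab] mean_oscillation_le[of lebesgue "{a..b}" f _ "max K (2 * K')"] by fastforce
  then have "bdd_above ((\<lambda>I. mean_oscillation lebesgue I f) ` intervals)"
    by (intro bdd_aboveI[of _ "2 * max K (2 * K')"]) (auto simp: intervals_def)
  then show ?thesis using f by (simp add: BMO_def)
qed

section \<open>Transfer of the weight to the line\<close>

lemma two_arctan_le: "0 < y \<Longrightarrow> pi - 2 * arctan y \<le> 2 / y"
  using arctan_inverse[of y] arctan_le_self[of "1 / y"] by (simp add: inverse_eq_divide)

lemma arctan_ge_frac:
  fixes u :: real assumes "0 \<le> u" shows "u / (1 + u) \<le> arctan u"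
proof -
  define g where "g u = arctan u - u / (1 + u)" for u :: real
  have "g 0 \<le> g u"
  proof (rule DERIV_nonneg_imp_nondecreasing[OF assms])
    fix x assume x: "0 \<le> x" "x \<le> u"
    have "(g has_real_derivative 1 / (1 + x\<^sup>2) - 1 / (1 + x)\<^sup>2) (at x)"
      unfolding g_def using x
      by (auto intro!: derivative_eq_intros simp: power2_eq_square field_simps)
    moreover have "0 \<le> 1 / (1 + x\<^sup>2) - 1 / (1 + x)\<^sup>2"
      using x frac_le[of 1 1 "1 + x\<^sup>2" "(1 + x)\<^sup>2"] by (simp add: power2_sum add_pos_nonneg)
    ultimately show "\<exists>y. (g has_real_derivative y) (at x) \<and> 0 \<le> y" by blast
  qed
  then show ?thesis by (simp add: g_def)
qed

text \<open>pi - 2 arctan y is the arc length of the image of [y, \<infinity>) and equals 2 arctan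
  (1 / y) for y > 0. The denominator 1 + |y| makes the bound usable for either sign of y.\<close>

lemma two_arctan_ge: "2 / (1 + \<bar>y\<bar>) \<le> pi - 2 * arctan y"
proof (cases "0 < y")
  case True
  have "(1/y) / (1 + 1/y) \<le> arctan (1 / y)" using True by (intro arctan_ge_frac) simp
  moreover have "2 / (1 + \<bar>y\<bar>) = 2 * ((1/y) / (1 + 1/y))" using True by (simp add: field_simps)
  moreover have "arctan (1 / y) = pi / 2 - arctan y" using arctan_inverse[of y] True by (simp add: inverse_eq_divide)
  ultimately show ?thesis by linarith
next
  case False
  then have "arctan y \<le> 0" by simp
  moreover have "2 / (1 + \<bar>y\<bar>) \<le> 2" by (simp add: divide_le_eq)
  ultimately show ?thesis using pi_ge_two by linarith
qed

definition tail :: "real \<Rightarrow> real set" where "tail R = {x. R \<le> \<bar>x\<bar>}"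

lemma tail_sets [measurable]: "tail R \<in> sets borel" "tail R \<in> sets lebesgue"
proof -
  show "tail R \<in> sets borel" unfolding tail_def by measurable
  then show "tail R \<in> sets lebesgue" by simp
qed

lemma one_plus_square_bounds:
  fixes y :: real
  shows "(1 + \<bar>y\<bar>)\<^sup>2 / 2 \<le> 1 + y\<^sup>2" "1 + y\<^sup>2 \<le> (1 + \<bar>y\<bar>)\<^sup>2"
proof -
  have "0 \<le> (1 - \<bar>y\<bar>)\<^sup>2" by simp
  then show "(1 + \<bar>y\<bar>)\<^sup>2 / 2 \<le> 1 + y\<^sup>2" by (simp add: power2_sum power2_diff)
  show "1 + y\<^sup>2 \<le> (1 + \<bar>y\<bar>)\<^sup>2" by (simp add: power2_sum)
qed

lemma line_density_bounds:
  assumes "r \<le> \<bar>x\<bar>" "\<bar>x\<bar> \<le> s" "0 \<le> r"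
  shows "2 / (1 + s\<^sup>2) \<le> line_density x" "line_density x \<le> 2 / (1 + r\<^sup>2)"
proof -
  have "r\<^sup>2 \<le> x\<^sup>2" "x\<^sup>2 \<le> s\<^sup>2"
    using assms power_mono[of r "\<bar>x\<bar>" 2] power_mono[of "\<bar>x\<bar>" s 2] by auto
  then show "2 / (1 + s\<^sup>2) \<le> line_density x" "line_density x \<le> 2 / (1 + r\<^sup>2)"
    unfolding line_density_def by (auto intro!: divide_left_mono mult_pos_pos add_pos_nonneg)
qed

text \<open>The constant 5 is the quotient of the extreme densities on {-2..2}; on a dyadic annulus
  the quotient stays below 4.\<close>

lemma tame_line_density:
  assumes "tame a b"
  obtains m where "0 < m" "\<And>x. x \<in> {a..b} \<Longrightarrow> m \<le> line_density x \<and> line_density x \<le> 5 * m"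
proof -
  note witness = that
  have ann: thesis if R: "1 \<le> R" and sub: "\<And>x. x \<in> {a..b} \<Longrightarrow> R \<le> \<bar>x\<bar> \<and> \<bar>x\<bar> \<le> 2 * R" for R
  proof (rule witness[of "2 / (1 + (2 * R)\<^sup>2)"])
    show "0 < 2 / (1 + (2 * R)\<^sup>2)" by (simp add: add_pos_nonneg)
    fix x assume x: "x \<in> {a..b}"
    have "2 / (1 + R\<^sup>2) \<le> 5 * (2 / (1 + (2 * R)\<^sup>2))"
      by (simp add: field_simps power2_eq_square add_pos_nonneg)
    then show "2 / (1 + (2 * R)\<^sup>2) \<le> line_density x \<and> line_density x \<le> 5 * (2 / (1 + (2 * R)\<^sup>2))"
      using line_density_bounds[of R x "2 * R"] sub[OF x] R by auto
  qed
  show thesis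
    using assms unfolding tame_def
  proof (elim disjE exE conjE)
    assume "- 2 \<le> a" "b \<le> 2"
    then have "\<bar>x\<bar> \<le> 2" if "x \<in> {a..b}" for x using that by auto
    then show thesis using line_density_bounds[of 0 _ 2]
      by (intro witness[of "2/5"]) (auto simp: power2_eq_square)
  next
    fix R assume "1 \<le> R" "R \<le> a" "b \<le> 2 * R"
    then show thesis by (intro ann[of R]) auto
  next
    fix R assume "1 \<le> R" "- (2 * R) \<le> a" "b \<le> - R"
    then show thesis by (intro ann[of R]) auto
  qed
qed

text \<open>Read off from the lengths of arcs by transporting the constant function 1.\<close>

lemma integrable_line_density: "integrable lebesgue line_density"
  and LINT_line_density: "a \<le> b \<Longrightarrow> (LINT x:{a..b}|lebesgue. line_density x) = 2 * (arctan b - arctan a)"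
  and LINT_line_density_tail: "0 \<le> R \<Longrightarrow> (LINT x:tail R|lebesgue. line_density x) = 2 * (pi - 2 * arctan R)"
proof -
  have one: "(\<lambda>z. 1::real) \<in> borel_measurable arc_length" by simp
  have bd: "- pi < 2 * arctan y" "2 * arctan y < pi" for y using arctan_bounded[of y] by auto
  have sp: "space arc_length = cis ` {0..2 * pi}"
  proof -
    have "space arc_length = sphere 0 1" by (simp add: arc_length_def space_restrict_space)
    moreover have "z \<in> cis ` {0..2 * pi}" if "norm z = 1" for z
    proof -
      have "z = cis (Arg2pi z)" using that Arg2pi_eq[of z] by (simp add: cis_conv_exp)
      then show ?thesis using Arg2pi_ge_0[of z] Arg2pi_lt_2pi[of z] by (intro image_eqI[of _ _ "Arg2pi z"]) auto
    qed
    ultimately show ?thesis by auto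
  qed
  have "finite_measure arc_length"
    using emeasure_arc_length_arc[of 0 "2 * pi"] sp by (intro finite_measureI) simp
  then have "integrable arc_length (\<lambda>z. 1::real)"
    by (rule finite_measure.integrable_const)
  then show "integrable lebesgue line_density"
    using integrable_arc_length_iff[OF one] by simp
  have *: "(LINT x:{x. cayley_line x \<in> cis ` {a..b}}|lebesgue. line_density x) = b - a"
    if "a \<le> b" "b \<le> a + 2 * pi" for a b
  proof -
    have "(LINT z:cis ` {a..b}|arc_length. (1::real)) = measure arc_length (cis ` {a..b})"
      unfolding set_lebesgue_integral_def
      using sets.sets_into_space[OF arc_in_sets[of a b]] by (simp add: Int_absorb2)
    then show ?thesis using set_integral_arc_length[OF arc_in_sets one, of a b] measure_arc_length_arc[OF that] by simp
  qed
  show "(LINT x:{a..b}|lebesgue. line_density x) = 2 * (arctan b - arctan a)" if "a \<le> b"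
    using *[of "pi + 2 * arctan a" "pi + 2 * arctan b"] bd[of a] bd[of b] that arctan_monotone'[OF that]
    unfolding cayley_line_in_arc_interval Collect_mem_eq by simp
  show "(LINT x:tail R|lebesgue. line_density x) = 2 * (pi - 2 * arctan R)" if "0 \<le> R"
    using *[of "2 * arctan R - pi" "pi - 2 * arctan R"] bd[of R] that
    unfolding cayley_line_in_arc_tail[OF that] tail_def by simp
qed

lemma set_integrable_line_density: "A \<in> sets lebesgue \<Longrightarrow> set_integrable lebesgue A line_density"
  unfolding set_integrable_def using integrable_line_density by (rule integrable_mult_indicator[rotated])

lemma LINT_line_density_tail_bounds:
  assumes "1 \<le> R"
  shows "2 / R \<le> (LINT x:tail R|lebesgue. line_density x)" "(LINT x:tail R|lebesgue. line_density x) \<le> 4 / R"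
proof -
  have eq: "(LINT x:tail R|lebesgue. line_density x) = 2 * (pi - 2 * arctan R)"
    using assms by (intro LINT_line_density_tail) auto
  have a: "2 / (1 + R) \<le> pi - 2 * arctan R" using two_arctan_ge[of R] assms by simp
  have b: "2 / R \<le> 2 * (2 / (1 + R))" using assms by (simp add: field_simps)
  show "2 / R \<le> (LINT x:tail R|lebesgue. line_density x)"
    unfolding eq by (rule order_trans[OF b mult_left_mono[OF a]]) simp
  show "(LINT x:tail R|lebesgue. line_density x) \<le> 4 / R"
    using two_arctan_le[of R] assms unfolding eq by simp
qed

text \<open>Collects what the estimates on the line need to know about the circle map: p is a
  density of h, and its product with \<open>line_density (h x)\<close>, the transported circle
  weight, is a density of 2 arctan h. The A_infinity bound is kept for two families of arcs, the
  images of intervals and the arcs centred at 1. Of the doubling bounds, those on {R..2*R} and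
  {-(2*R)..-R} keep h R and h (-R) from being too large, and the one on {2*R..4*R} compares
  consecutive tails.\<close>

locale circle_weight_on_line =
  fixes h p :: "real \<Rightarrow> real" and C \<alpha> D :: real
  assumes mono: "strict_mono h" and surj: "surj h"
    and p_measurable: "p \<in> borel_measurable lebesgue"
    and p_nonneg: "\<And>x. 0 \<le> p x"
    and p_integrable: "\<And>a b. set_integrable lebesgue {a..b} p"
    and LINT_p: "\<And>a b. a \<le> b \<Longrightarrow> (LINT x:{a..b}|lebesgue. p x) = h b - h a"
    and k_integrable: "integrable lebesgue (\<lambda>x. p x * line_density (h x))"
    and LINT_k: "\<And>a b. a \<le> b \<Longrightarrow>
      (LINT x:{a..b}|lebesgue. p x * line_density (h x)) = 2 * (arctan (h b) - arctan (h a))"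
    and C_pos: "0 < C" and \<alpha>_pos: "0 < \<alpha>" and D_pos: "0 < D"
    and A_infinity_Icc: "\<And>a b E. a < b \<Longrightarrow> E \<in> sets lebesgue \<Longrightarrow> E \<subseteq> {a..b} \<Longrightarrow>
      (LINT x:E|lebesgue. p x * line_density (h x)) \<le>
        C * ((LINT x:E|lebesgue. line_density x) / (LINT x:{a..b}|lebesgue. line_density x)) powr \<alpha> *
        (LINT x:{a..b}|lebesgue. p x * line_density (h x))"
    and A_infinity_tail: "\<And>R E. 1 \<le> R \<Longrightarrow> E \<in> sets lebesgue \<Longrightarrow> E \<subseteq> tail R \<Longrightarrow>
      (LINT x:E|lebesgue. p x * line_density (h x)) \<le>
        C * ((LINT x:E|lebesgue. line_density x) / (LINT x:tail R|lebesgue. line_density x)) powr \<alpha> *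
        (LINT x:tail R|lebesgue. p x * line_density (h x))"
    and doubling: "\<And>R. 1 \<le> R \<Longrightarrow>
      (LINT x:tail R|lebesgue. p x * line_density (h x)) \<le> D * (LINT x:{R..2*R}|lebesgue. p x * line_density (h x))"
      "\<And>R. 1 \<le> R \<Longrightarrow>
      (LINT x:tail R|lebesgue. p x * line_density (h x)) \<le> D * (LINT x:{2*R..4*R}|lebesgue. p x * line_density (h x))"
      "\<And>R. 1 \<le> R \<Longrightarrow>
      (LINT x:tail R|lebesgue. p x * line_density (h x)) \<le> D * (LINT x:{-(2*R)..-R}|lebesgue. p x * line_density (h x))"
begin

definition k :: "real \<Rightarrow> real" where "k x = p x * line_density (h x)"

text \<open>The length of the image, under the circle map, of the arc around 1 that corresponds to
  \<open>tail R\<close>.\<close>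

definition \<tau> :: "real \<Rightarrow> real" where "\<tau> R = (LINT x:tail R|lebesgue. k x)"

lemma k_nonneg: "0 \<le> k x"
  unfolding k_def using p_nonneg line_density_pos by (simp add: less_imp_le)

lemma set_integrable_k: "A \<in> sets lebesgue \<Longrightarrow> set_integrable lebesgue A k"
  using k_integrable unfolding set_integrable_def k_def[abs_def] by (rule integrable_mult_indicator[rotated])

lemma h_less_iff: "h x < h y \<longleftrightarrow> x < y" and h_le_iff: "h x \<le> h y \<longleftrightarrow> x \<le> y"
  using mono by (auto simp: strict_mono_less strict_mono_less_eq)

lemma \<tau>_pos: assumes "1 \<le> R" shows "0 < \<tau> R"
proof -
  have "0 < 2 * (arctan (h (2*R)) - arctan (h R))" using assms by (simp add: arctan_less_iff h_less_iff)
  also have "\<dots> = (LINT x:{R..2*R}|lebesgue. k x)"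
    unfolding k_def using assms by (intro LINT_k[symmetric]) auto
  also have "(LINT x:{R..2*R}|lebesgue. k x) \<le> \<tau> R"
    unfolding \<tau>_def using assms k_nonneg
    by (intro set_integral_mono_set_nonneg set_integrable_k tail_sets) (auto simp: tail_def)
  finally show ?thesis .
qed

lemma \<tau>_le_doubling: assumes "1 \<le> R" shows "\<tau> R \<le> D * \<tau> (2 * R)"
proof -
  have "\<tau> R \<le> D * (LINT x:{2*R..4*R}|lebesgue. k x)"
    unfolding \<tau>_def k_def using assms by (rule doubling)
  also have "(LINT x:{2*R..4*R}|lebesgue. k x) \<le> \<tau> (2*R)"
    unfolding \<tau>_def using assms k_nonneg
    by (intro set_integral_mono_set_nonneg set_integrable_k tail_sets) (auto simp: tail_def)
  finally show ?thesis using D_pos by simp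
qed

lemma \<tau>_antimono: assumes "R \<le> S" shows "\<tau> S \<le> \<tau> R"
  unfolding \<tau>_def using assms k_nonneg
  by (intro set_integral_mono_set_nonneg set_integrable_k tail_sets) (auto simp: tail_def)

text \<open>Since {R..2*R} carries a fixed share of \<tau> R, the image of R stays at angular
  distance at least \<tau> R / D from 1, whence h R <= 2 D / \<tau> R; the negative side gives the
  same for -h (-R). The remaining 7 D / \<tau> R dominates the summand 1 because 2 pi < 7.\<close>

lemma h_upper:
  assumes R: "1 \<le> R" and x: "\<bar>x\<bar> \<le> R"
  shows "1 + \<bar>h x\<bar> \<le> 9 * D / \<tau> R"
proof -
  have t: "0 < \<tau> R" using \<tau>_pos[OF R] .
  have 1: "\<tau> R \<le> D * (pi - 2 * arctan (h R))"
  proof -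
    have "\<tau> R \<le> D * (LINT x:{R..2*R}|lebesgue. k x)"
      unfolding \<tau>_def k_def using R by (rule doubling)
    also have "(LINT x:{R..2*R}|lebesgue. k x) = 2 * (arctan (h (2*R)) - arctan (h R))"
      unfolding k_def using R by (intro LINT_k) auto
    also have "D * \<dots> \<le> D * (pi - 2 * arctan (h R))"
      using D_pos arctan_bounded[of "h (2*R)"] by (intro mult_left_mono) auto
    finally show ?thesis .
  qed
  have 2: "\<tau> R \<le> D * (pi - 2 * arctan (- h (- R)))"
  proof -
    have "\<tau> R \<le> D * (LINT x:{-(2*R)..-R}|lebesgue. k x)"
      unfolding \<tau>_def k_def using R by (rule doubling)
    also have "(LINT x:{-(2*R)..-R}|lebesgue. k x) = 2 * (arctan (h (-R)) - arctan (h (-(2*R))))"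
      unfolding k_def using R by (intro LINT_k) auto
    also have "D * \<dots> \<le> D * (pi - 2 * arctan (- h (- R)))"
      using D_pos arctan_bounded[of "h (-(2*R))"] by (intro mult_left_mono) (auto simp: arctan_minus)
    finally show ?thesis .
  qed
  have 3: "y \<le> 2 * D / \<tau> R" if "\<tau> R \<le> D * (pi - 2 * arctan y)" for y
  proof (cases "0 < y")
    case True
    have "\<tau> R \<le> D * (2 / y)" using that two_arctan_le[OF True] D_pos
      by (meson mult_left_mono less_imp_le order_trans)
    then show ?thesis using True t by (simp add: field_simps)
  next
    case False
    then show ?thesis using D_pos t by (smt (verit) divide_pos_pos)
  qed
  have "h x \<le> h R" "h (-R) \<le> h x" using x by (auto simp: h_le_iff abs_le_iff)
  then have "\<bar>h x\<bar> \<le> 2 * D / \<tau> R" using 3[OF 1] 3[OF 2] by linarith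
  moreover have "1 \<le> 7 * D / \<tau> R"
  proof -
    have "\<tau> R \<le> D * (2 * pi)"
      using 1 arctan_bounded[of "h R"] D_pos by (elim order_trans) (intro mult_left_mono, auto)
    also have "\<dots> \<le> D * 7" using pi_less_4 pi_approx D_pos by (intro mult_left_mono) auto
    finally show ?thesis using t by (simp add: field_simps)
  qed
  moreover have "9 * D / \<tau> R = 7 * D / \<tau> R + 2 * D / \<tau> R" by (simp add: field_simps)
  ultimately show ?thesis by linarith
qed

text \<open>For x > 0 the image of [x, \<infinity>) lies in that of the tail and has length pi - 2
  arctan (h x), because h is increasing and onto; for x < 0 use (-\<infinity>, x]. An arc of length
  at most \<tau> R that ends at 1 starts at a point whose coordinate has 1 + |h x| >= 2 / \<tau>
  R.\<close>

lemma h_lower: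
  assumes R: "1 \<le> R" and x: "R \<le> \<bar>x\<bar>"
  shows "2 / \<tau> R \<le> 1 + \<bar>h x\<bar>"
proof -
  have t: "0 < \<tau> R" using \<tau>_pos[OF R] .
  \<comment> \<open>Surjectivity of h enters through arbitrary values y: a bound on 2 arctan y for
    every y passes to the limit pi.\<close>
  have aux: "pi \<le> c" if "\<And>y. 2 * arctan y \<le> c" for c
  proof -
    have "((\<lambda>y. 2 * arctan y) \<longlongrightarrow> 2 * (pi / 2)) at_top"
      by (intro tendsto_intros tendsto_arctan_at_top)
    then have "2 * (pi / 2) \<le> c" using that by (intro tendsto_upperbound) auto
    then show ?thesis by simp
  qed
  have "2 / (1 + \<bar>h x\<bar>) \<le> \<tau> R"
  proof (cases "0 \<le> x")
    case True
    have "2 * arctan y \<le> \<tau> R + 2 * arctan (h x)" for y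
    proof -
      obtain z where z: "y = h z" using surj by (metis surjD)
      define Y where "Y = max x z"
      have "2 * (arctan (h Y) - arctan (h x)) = (LINT x:{x..Y}|lebesgue. k x)"
        unfolding k_def by (intro LINT_k[symmetric]) (simp add: Y_def)
      also have "\<dots> \<le> \<tau> R"
        unfolding \<tau>_def using True x k_nonneg
        by (intro set_integral_mono_set_nonneg set_integrable_k tail_sets) (auto simp: tail_def)
      finally have "2 * arctan (h Y) \<le> \<tau> R + 2 * arctan (h x)" by simp
      moreover have "arctan y \<le> arctan (h Y)" unfolding z by (simp add: arctan_le_iff h_le_iff Y_def)
      ultimately show ?thesis by linarith
    qed
    then have "pi - 2 * arctan (h x) \<le> \<tau> R" using aux by fastforce
    then show ?thesis using two_arctan_ge[of "h x"] by linarith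
  next
    case False
    have "2 * arctan y \<le> \<tau> R - 2 * arctan (h x)" for y
    proof -
      obtain z where z: "- y = h z" using surj by (metis surjD)
      define Y where "Y = min x z"
      have "2 * (arctan (h x) - arctan (h Y)) = (LINT x:{Y..x}|lebesgue. k x)"
        unfolding k_def by (intro LINT_k[symmetric]) (simp add: Y_def)
      also have "\<dots> \<le> \<tau> R"
        unfolding \<tau>_def using False x k_nonneg
        by (intro set_integral_mono_set_nonneg set_integrable_k tail_sets) (auto simp: tail_def)
      finally have "- 2 * arctan (h Y) \<le> \<tau> R - 2 * arctan (h x)" by simp
      moreover have "arctan (h Y) \<le> arctan (- y)" unfolding z by (simp add: arctan_le_iff h_le_iff Y_def)
      ultimately show ?thesis by (simp add: arctan_minus)
    qed
    then have "pi + 2 * arctan (h x) \<le> \<tau> R" using aux by fastforce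
    then show ?thesis using two_arctan_ge[of "- h x"] by (simp add: arctan_minus)
  qed
  then show ?thesis using t by (simp add: field_simps)
qed

text \<open>The A_infinity bound of an arc around 1 is tested on a smaller concentric arc, whose
  relative length is at most (4 / R) / (2 / r).\<close>

lemma \<tau>_decay:
  assumes "1 \<le> r" "r \<le> R"
  shows "\<tau> R \<le> C * (2 * r / R) powr \<alpha> * \<tau> r"
proof -
  have "\<tau> R \<le> C * ((LINT x:tail R|lebesgue. line_density x) / (LINT x:tail r|lebesgue. line_density x)) powr \<alpha> * \<tau> r"
    unfolding \<tau>_def k_def using assms by (intro A_infinity_tail tail_sets) (auto simp: tail_def)
  also have "\<dots> \<le> C * (2 * r / R) powr \<alpha> * \<tau> r"
  proof (intro mult_right_mono mult_left_mono powr_mono2)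
    have "(LINT x:tail R|lebesgue. line_density x) / (LINT x:tail r|lebesgue. line_density x) \<le> (4 / R) / (2 / r)"
      using LINT_line_density_tail_bounds[of R] LINT_line_density_tail_bounds[of r] assms
      by (intro frac_le) auto
    then show "(LINT x:tail R|lebesgue. line_density x) / (LINT x:tail r|lebesgue. line_density x) \<le> 2 * r / R"
      using assms by (simp add: field_simps)
    show "0 \<le> (LINT x:tail R|lebesgue. line_density x) / (LINT x:tail r|lebesgue. line_density x)"
      by (intro divide_nonneg_nonneg set_integral_nonneg_on less_imp_le line_density_pos)
  qed (use C_pos \<alpha>_pos \<tau>_pos[OF assms(1)] in auto)
  finally show ?thesis .
qed

lemma LINT_p_le_k:
  assumes "E \<in> sets lebesgue" "E \<subseteq> {a..b}" "\<And>x. x \<in> E \<Longrightarrow> 1 + \<bar>h x\<bar> \<le> M"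
  shows "(LINT x:E|lebesgue. p x) \<le> M\<^sup>2 / 2 * (LINT x:E|lebesgue. k x)"
proof (rule set_integral_le_cmult)
  show "set_integrable lebesgue E p" using p_integrable assms(1,2) by (rule set_integrable_subset)
  show "set_integrable lebesgue E k" using assms(1) by (rule set_integrable_k)
  fix x assume x: "x \<in> E"
  have "1 + (h x)\<^sup>2 \<le> M\<^sup>2"
    using one_plus_square_bounds(2)[of "h x"] power_mono[OF assms(3)[OF x], of 2] by simp
  then have "p x * (1 + (h x)\<^sup>2) \<le> p x * M\<^sup>2" using p_nonneg by (rule mult_left_mono)
  then show "p x \<le> M\<^sup>2 / 2 * k x"
    unfolding k_def line_density_def by (simp add: divide_simps add_pos_nonneg mult.commute)
qed

text \<open>The constant 4 / M^2 arises because 1 + h^2 is at least half of (1 + |h|)^2.\<close>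

lemma LINT_k_le_p:
  assumes "E \<in> sets lebesgue" "E \<subseteq> {a..b}" "\<And>x. x \<in> E \<Longrightarrow> M \<le> 1 + \<bar>h x\<bar>" "0 < M"
  shows "(LINT x:E|lebesgue. k x) \<le> 4 / M\<^sup>2 * (LINT x:E|lebesgue. p x)"
proof (rule set_integral_le_cmult)
  show "set_integrable lebesgue E p" using p_integrable assms(1,2) by (rule set_integrable_subset)
  show "set_integrable lebesgue E k" using assms(1) by (rule set_integrable_k)
  fix x assume x: "x \<in> E"
  have "M\<^sup>2 \<le> (1 + \<bar>h x\<bar>)\<^sup>2" using assms(3)[OF x] \<open>0 < M\<close> by (intro power_mono) auto
  then have M: "M\<^sup>2 / 2 \<le> 1 + (h x)\<^sup>2" using one_plus_square_bounds(1)[of "h x"] by linarith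
  have "line_density (h x) \<le> 2 / (M\<^sup>2 / 2)"
    unfolding line_density_def using M \<open>0 < M\<close> by (intro divide_left_mono mult_pos_pos) (auto simp: add_pos_nonneg)
  then have "p x * line_density (h x) \<le> p x * (4 / M\<^sup>2)"
    using p_nonneg by (intro mult_left_mono) auto
  then show "k x \<le> 4 / M\<^sup>2 * p x" unfolding k_def by (simp add: mult.commute)
qed

text \<open>Bounds the oscillation ratio of 1 + |h|: on {-2..2} by comparing \<open>h_upper\<close>
  for R = 2 with the trivial lower bound 1, on a dyadic annulus by comparing 9 D^2 / \<tau> R with 2
  / \<tau> R.\<close>

definition \<Lambda> :: real where "\<Lambda> = max (9 * D / \<tau> 2) (9 * D * D / 2)"

text \<open>On an annulus the lower bound at radius R and the upper bound at radius 2 R are one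
  doubling step apart.\<close>

lemma tame_h:
  assumes "tame a b" "a \<le> b"
  obtains M where "0 < M" "\<And>x. x \<in> {a..b} \<Longrightarrow> M \<le> 1 + \<bar>h x\<bar> \<and> 1 + \<bar>h x\<bar> \<le> \<Lambda> * M"
proof -
  note witness = that
  have ann: thesis if R: "1 \<le> R" and sub: "\<And>x. x \<in> {a..b} \<Longrightarrow> R \<le> \<bar>x\<bar> \<and> \<bar>x\<bar> \<le> 2 * R" for R
  proof (rule witness[of "2 / \<tau> R"])
    have t: "0 < \<tau> R" "0 < \<tau> (2 * R)" using \<tau>_pos R by auto
    then show "0 < 2 / \<tau> R" by simp
    fix x assume x: "x \<in> {a..b}"
    have "1 + \<bar>h x\<bar> \<le> 9 * D / \<tau> (2 * R)" using h_upper[of "2 * R" x] R sub[OF x] by auto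
    also have "\<dots> \<le> 9 * D / (\<tau> R / D)"
      using \<tau>_le_doubling[OF R] t D_pos by (intro divide_left_mono mult_pos_pos) (auto simp: field_simps)
    also have "\<dots> = (9 * D * D / 2) * (2 / \<tau> R)" by simp
    also have "\<dots> \<le> \<Lambda> * (2 / \<tau> R)" using t by (intro mult_right_mono) (auto simp: \<Lambda>_def)
    finally show "2 / \<tau> R \<le> 1 + \<bar>h x\<bar> \<and> 1 + \<bar>h x\<bar> \<le> \<Lambda> * (2 / \<tau> R)"
      using h_lower[OF R] sub[OF x] by auto
  qed
  show thesis
    using assms(1) unfolding tame_def
  proof (elim disjE exE conjE)
    assume ab: "- 2 \<le> a" "b \<le> 2"
    show thesis
    proof (rule that[of 1])
      fix x assume "x \<in> {a..b}"
      then have "1 + \<bar>h x\<bar> \<le> 9 * D / \<tau> 2" using ab by (intro h_upper) auto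
      then show "1 \<le> 1 + \<bar>h x\<bar> \<and> 1 + \<bar>h x\<bar> \<le> \<Lambda> * 1" by (auto simp: \<Lambda>_def)
    qed simp
  next
    fix R assume "1 \<le> R" "R \<le> a" "b \<le> 2 * R"
    then show thesis by (intro ann[of R]) auto
  next
    fix R assume "1 \<le> R" "- (2 * R) \<le> a" "b \<le> - R"
    then show thesis by (intro ann[of R]) auto
  qed
qed

lemma \<Lambda>_pos: "0 < \<Lambda>"
  unfolding \<Lambda>_def using D_pos by (simp add: less_max_iff_disj)

end

section \<open>The A_infinity property on the line\<close>

lemma measure_Icc_subset:
  assumes "E \<in> sets lebesgue" "E \<subseteq> {a..b::real}"
  shows "E \<in> lmeasurable \<and> measure lebesgue E \<le> measure lebesgue {a..b}"
  using fmeasurableI2[OF Icc_lmeasurable assms(2,1)] measure_mono_fmeasurable[OF assms(2,1) Icc_lmeasurable] by blast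

lemma LINT_line_density_le:
  assumes "E \<in> lmeasurable" "\<And>x. x \<in> E \<Longrightarrow> line_density x \<le> m"
  shows "(LINT x:E|lebesgue. line_density x) \<le> m * measure lebesgue E"
proof -
  have "(LINT x:E|lebesgue. line_density x) \<le> (LINT x:E|lebesgue. m)"
    using assms by (intro set_integral_mono set_integrable_line_density set_integral_const_lebesgue) (auto dest: fmeasurableD)
  then show ?thesis using set_integral_const_lebesgue(2)[OF assms(1)] by simp
qed

context circle_weight_on_line begin

text \<open>On a tame interval \<open>line_density\<close> is constant up to a factor 5 and 1 + |h|
  up to a factor \<Lambda>, so the estimate on the circle carries over; the scales m and M
  cancel.\<close>

lemma tame_A_infinity:
  assumes "tame a b" "a < b" and E: "E \<in> sets lebesgue" "E \<subseteq> {a..b}"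
  shows "(LINT x:E|lebesgue. p x) \<le>
    2 * \<Lambda>\<^sup>2 * C * 5 powr \<alpha> * (measure lebesgue E / (b - a)) powr \<alpha> * (h b - h a)"
proof -
  obtain m where m: "0 < m" "\<And>x. x \<in> {a..b} \<Longrightarrow> m \<le> line_density x \<and> line_density x \<le> 5 * m"
    using assms(1) by (rule tame_line_density) blast
  obtain M where M: "0 < M" "\<And>x. x \<in> {a..b} \<Longrightarrow> M \<le> 1 + \<bar>h x\<bar> \<and> 1 + \<bar>h x\<bar> \<le> \<Lambda> * M"
    using tame_h[OF assms(1) less_imp_le[OF assms(2)]] by blast
  have Em: "E \<in> lmeasurable" using measure_Icc_subset[OF E] by simp
  have \<sigma>E: "(LINT x:E|lebesgue. line_density x) \<le> 5 * m * measure lebesgue E"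
    using m(2) E(2) by (intro LINT_line_density_le[OF Em]) auto
  have \<sigma>J: "m * (b - a) \<le> (LINT x:{a..b}|lebesgue. line_density x)"
  proof -
    have "(LINT x:{a..b}|lebesgue. m) \<le> (LINT x:{a..b}|lebesgue. line_density x)"
      using m(2) by (intro set_integral_mono set_integrable_line_density set_integral_const_lebesgue) auto
    then show ?thesis using set_integral_const_lebesgue(2)[of "{a..b}" m] assms(2) by simp
  qed
  have \<mu>J: "(LINT x:{a..b}|lebesgue. k x) \<le> 4 / M\<^sup>2 * (h b - h a)"
    using LINT_k_le_p[of "{a..b}" a b M] M LINT_p[of a b] assms(2) by auto
  have ratio: "(LINT x:E|lebesgue. line_density x) / (LINT x:{a..b}|lebesgue. line_density x)
      \<le> 5 * (measure lebesgue E / (b - a))"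
  proof -
    have "(LINT x:E|lebesgue. line_density x) / (LINT x:{a..b}|lebesgue. line_density x) \<le>
        (5 * m * measure lebesgue E) / (m * (b - a))"
      using \<sigma>E \<sigma>J m(1) assms(2) by (intro frac_le) auto
    then show ?thesis using m(1) by simp
  qed
  have "(LINT x:E|lebesgue. k x) \<le> C * ((LINT x:E|lebesgue. line_density x) / (LINT x:{a..b}|lebesgue. line_density x)) powr \<alpha> *
        (LINT x:{a..b}|lebesgue. k x)"
    unfolding k_def using assms by (intro A_infinity_Icc) auto
  also have "\<dots> \<le> C * (5 * (measure lebesgue E / (b - a))) powr \<alpha> * (4 / M\<^sup>2 * (h b - h a))"
    using C_pos \<alpha>_pos assms(2) h_le_iff[of a b]
    by (intro mult_mono powr_mono2 \<mu>J ratio divide_nonneg_nonneg set_integral_nonneg_on less_imp_le[OF line_density_pos] k_nonneg) auto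
  finally have \<mu>E: "(LINT x:E|lebesgue. k x) \<le> C * (5 * (measure lebesgue E / (b - a))) powr \<alpha> * (4 / M\<^sup>2 * (h b - h a))" .
  have "(LINT x:E|lebesgue. p x) \<le> (\<Lambda> * M)\<^sup>2 / 2 * (LINT x:E|lebesgue. k x)"
    using E M(2) by (intro LINT_p_le_k[of E a b]) auto
  also have "\<dots> \<le> (\<Lambda> * M)\<^sup>2 / 2 * (C * (5 * (measure lebesgue E / (b - a))) powr \<alpha> * (4 / M\<^sup>2 * (h b - h a)))"
    using \<mu>E by (intro mult_left_mono) auto
  also have "\<dots> = 2 * \<Lambda>\<^sup>2 * C * (5 * (measure lebesgue E / (b - a))) powr \<alpha> * (h b - h a)"
    using M(1) by (simp add: power_mult_distrib)
  also have "(5 * (measure lebesgue E / (b - a))) powr \<alpha> = 5 powr \<alpha> * (measure lebesgue E / (b - a)) powr \<alpha>"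
    by (rule powr_mult)
  finally show ?thesis by (simp add: mult.assoc)
qed

text \<open>The tail rather than an interval is the reference set because E may meet both sides of
  the annulus. The exponent is halved on purpose, using |E| / R <= 2: the decay of \<tau> by the
  factor 2^(-\<alpha>) per annulus would make the terms 2^(-j \<alpha>) / \<tau> (2^j) merely
  comparable to the last one, whereas with \<alpha> / 2 they form a geometric sum.\<close>

lemma dyadic_piece:
  assumes R: "1 \<le> R" and E: "E \<in> sets lebesgue" "E \<subseteq> {x. R \<le> \<bar>x\<bar> \<and> \<bar>x\<bar> \<le> 2 * R}"
  shows "(LINT x:E|lebesgue. p x) \<le> 81 * D^4 * C * 2 powr (\<alpha> / 2) * (measure lebesgue E / R) powr (\<alpha> / 2) / \<tau> R"
proof -
  have t: "0 < \<tau> R" "0 < \<tau> (2 * R)" using \<tau>_pos R by auto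
  have ann: "{x. R \<le> \<bar>x\<bar> \<and> \<bar>x\<bar> \<le> 2 * R} \<in> lmeasurable" using R by (intro annulus_lmeasurable) auto
  have Em: "E \<in> lmeasurable" using fmeasurableI2[OF ann E(2,1)] .
  have Eann: "measure lebesgue E \<le> 2 * R"
    using measure_mono_fmeasurable[OF E(2,1) ann] measure_annulus[of R "2 * R"] R by simp
  have Esub: "E \<subseteq> {-(2*R)..2*R}" using E(2) by (auto simp: abs_le_iff)
  have \<sigma>E: "(LINT x:E|lebesgue. line_density x) \<le> 2 / R\<^sup>2 * measure lebesgue E"
  proof (intro LINT_line_density_le[OF Em])
    fix x assume "x \<in> E"
    then have "line_density x \<le> 2 / (1 + R\<^sup>2)" using E(2) R by (intro line_density_bounds(2)[of R x "2 * R"]) auto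
    also have "\<dots> \<le> 2 / R\<^sup>2" using R by (intro divide_left_mono) (auto intro!: mult_pos_pos add_pos_nonneg)
    finally show "line_density x \<le> 2 / R\<^sup>2" .
  qed
  have ratio: "(LINT x:E|lebesgue. line_density x) / (LINT x:tail R|lebesgue. line_density x) \<le> measure lebesgue E / R"
  proof -
    have "(LINT x:E|lebesgue. line_density x) / (LINT x:tail R|lebesgue. line_density x)
        \<le> (2 / R\<^sup>2 * measure lebesgue E) / (2 / R)"
      using \<sigma>E LINT_line_density_tail_bounds(1)[OF R] R by (intro frac_le) auto
    then show ?thesis using R by (simp add: power2_eq_square)
  qed
  define e where "e = measure lebesgue E / R"
  have e: "0 \<le> e" "e \<le> 2" using Eann R by (auto simp: e_def field_simps)
  have "(LINT x:E|lebesgue. k x) \<le> C * ((LINT x:E|lebesgue. line_density x) / (LINT x:tail R|lebesgue. line_density x)) powr \<alpha> * \<tau> R"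
    unfolding k_def \<tau>_def using R E by (intro A_infinity_tail) (auto simp: tail_def)
  also have "\<dots> \<le> C * e powr \<alpha> * \<tau> R"
    using C_pos \<alpha>_pos t ratio unfolding e_def
    by (intro mult_right_mono mult_left_mono powr_mono2 divide_nonneg_nonneg set_integral_nonneg_on less_imp_le[OF line_density_pos]) auto
  also have "e powr \<alpha> = e powr (\<alpha> / 2) * e powr (\<alpha> / 2)" by (simp flip: powr_add)
  also have "C * (e powr (\<alpha> / 2) * e powr (\<alpha> / 2)) * \<tau> R \<le> C * (2 powr (\<alpha> / 2) * e powr (\<alpha> / 2)) * \<tau> R"
    using C_pos t e \<alpha>_pos by (intro mult_right_mono mult_left_mono powr_mono2) auto
  finally have \<mu>E: "(LINT x:E|lebesgue. k x) \<le> C * (2 powr (\<alpha> / 2) * e powr (\<alpha> / 2)) * \<tau> R" .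
  have "(LINT x:E|lebesgue. p x) \<le> (9 * D / \<tau> (2 * R))\<^sup>2 / 2 * (LINT x:E|lebesgue. k x)"
  proof (intro LINT_p_le_k[OF E(1) Esub])
    fix x assume "x \<in> E"
    then show "1 + \<bar>h x\<bar> \<le> 9 * D / \<tau> (2 * R)" using R E(2) by (intro h_upper) auto
  qed
  also have "\<dots> \<le> (9 * D * D / \<tau> R)\<^sup>2 / 2 * (LINT x:E|lebesgue. k x)"
  proof -
    have "9 * D / \<tau> (2 * R) \<le> 9 * D / (\<tau> R / D)"
      using \<tau>_le_doubling[OF R] t D_pos by (intro divide_left_mono mult_pos_pos) (auto simp: field_simps)
    then have "9 * D / \<tau> (2 * R) \<le> 9 * D * D / \<tau> R" by simp
    then show ?thesis using D_pos t k_nonneg by (intro mult_right_mono divide_right_mono power_mono set_integral_nonneg_on) auto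
  qed
  also have "\<dots> \<le> (9 * D * D / \<tau> R)\<^sup>2 / 2 * (C * (2 powr (\<alpha> / 2) * e powr (\<alpha> / 2)) * \<tau> R)"
    using \<mu>E by (intro mult_left_mono) auto
  also have "\<dots> = 1/2 * (81 * D^4 * C * 2 powr (\<alpha> / 2) * e powr (\<alpha> / 2) / \<tau> R)"
    using t by (simp add: power2_eq_square field_simps power4_eq_xxxx)
  also have "\<dots> \<le> 81 * D^4 * C * 2 powr (\<alpha> / 2) * e powr (\<alpha> / 2) / \<tau> R"
    using t D_pos C_pos by (intro mult_left_le_one_le divide_nonneg_pos mult_nonneg_nonneg) auto
  finally show ?thesis unfolding e_def .
qed

text \<open>The summand 1 stands for the tame interval {-1..1}, the others for the annuli.\<close>

lemma dyadic_sum: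
  obtains K where "0 < K" "\<And>n E. E \<in> sets lebesgue \<Longrightarrow> E \<subseteq> {-(2^n)..2^n} \<Longrightarrow>
    (LINT x:E|lebesgue. p x) \<le> K * measure lebesgue E powr (\<alpha> / 2) * (1 + (\<Sum>j<n. (1 / 2^j) powr (\<alpha> / 2) / \<tau> (2^j)))"
proof -
  define K1 where "K1 = 2 * \<Lambda>\<^sup>2 * C * 5 powr \<alpha> * (h 1 - h (-1))"
  define K2 where "K2 = 81 * D^4 * C * 2 powr (\<alpha> / 2)"
  have pos: "0 < K1" "0 < K2"
    unfolding K1_def K2_def using \<Lambda>_pos C_pos D_pos h_less_iff[of "-1" 1] by (auto intro!: mult_pos_pos)
  define K where "K = max K1 K2"
  have K: "0 < K" "K1 \<le> K" "K2 \<le> K" using pos unfolding K_def by auto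
  have "(LINT x:E|lebesgue. p x) \<le> K * measure lebesgue E powr (\<alpha> / 2) * (1 + (\<Sum>j<n. (1 / 2^j) powr (\<alpha> / 2) / \<tau> (2^j)))"
    if "E \<in> sets lebesgue" "E \<subseteq> {-(2^n)..2^n}" for n E
    using that
  proof (induction n arbitrary: E)
    case 0
    have m: "measure lebesgue E \<le> 2" using measure_Icc_subset[of E "-1" 1] 0 by simp
    have "(LINT x:E|lebesgue. p x) \<le> 2 * \<Lambda>\<^sup>2 * C * 5 powr \<alpha> * (measure lebesgue E / (1 - (-1))) powr \<alpha> * (h 1 - h (-1))"
      using 0 by (intro tame_A_infinity) (auto simp: tame_def)
    also have "\<dots> = K1 * (measure lebesgue E / 2) powr \<alpha>" by (simp add: K1_def)
    also have "\<dots> \<le> K * measure lebesgue E powr (\<alpha> / 2)"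
    proof (intro mult_mono K)
      \<comment> \<open>Here |E| / 2 <= 1, so lowering the exponent enlarges the power.\<close>
      have "(measure lebesgue E / 2) powr \<alpha> \<le> (measure lebesgue E / 2) powr (\<alpha> / 2)"
        using m \<alpha>_pos by (intro powr_mono') auto
      also have "\<dots> \<le> measure lebesgue E powr (\<alpha> / 2)" using \<alpha>_pos by (intro powr_mono2) auto
      finally show "(measure lebesgue E / 2) powr \<alpha> \<le> measure lebesgue E powr (\<alpha> / 2)" .
    qed (use K in auto)
    finally show ?case by simp
  next
    case (Suc n)
    define e where "e = measure lebesgue E powr (\<alpha> / 2)"
    define s where "s = (\<Sum>j<n. (1 / 2^j) powr (\<alpha> / 2) / \<tau> (2^j))"
    define A where "A = {-(2^n)..2^n::real}"
    define B where "B = {x::real. 2^n \<le> \<bar>x\<bar> \<and> \<bar>x\<bar> \<le> 2 * 2^n}"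
    have AB: "A \<in> sets lebesgue" "B \<in> sets lebesgue"
      unfolding A_def B_def using fmeasurableD[OF annulus_lmeasurable[of "2^n" "2 * 2^n"]] by auto
    have "x \<in> A \<union> B" if "x \<in> E" for x
    proof -
      have "\<bar>x\<bar> \<le> 2 * 2^n" using Suc.prems(2) that by (auto simp: abs_le_iff)
      then show ?thesis unfolding A_def B_def by (cases "\<bar>x\<bar> \<le> 2 ^ n") (auto simp: abs_le_iff)
    qed
    then have EAB: "E = (E \<inter> A) \<union> (E \<inter> B)" by auto
    have s0: "0 \<le> s" unfolding s_def using \<tau>_pos by (intro sum_nonneg divide_nonneg_pos) auto
    have Em: "E \<in> lmeasurable" using measure_Icc_subset[OF Suc.prems] by simp
    have pi: "set_integrable lebesgue F p" if "F \<in> sets lebesgue" "F \<subseteq> E" for F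
      using set_integrable_subset[OF p_integrable that(1)] that(2) Suc.prems(2) by blast
    have powr_le: "measure lebesgue F powr (\<alpha> / 2) \<le> e" if "F \<in> sets lebesgue" "F \<subseteq> E" for F
      unfolding e_def using that Em \<alpha>_pos by (intro powr_mono2 measure_mono_fmeasurable) auto
    have "(LINT x:E|lebesgue. p x) \<le> (LINT x:E \<inter> A|lebesgue. p x) + (LINT x:E \<inter> B|lebesgue. p x)"
      using Suc.prems(1) AB p_nonneg by (subst EAB, intro set_integral_Un_le pi) auto
    also have "(LINT x:E \<inter> A|lebesgue. p x) \<le> K * e * (1 + s)"
    proof -
      have "(LINT x:E \<inter> A|lebesgue. p x) \<le> K * measure lebesgue (E \<inter> A) powr (\<alpha> / 2) * (1 + s)"
        unfolding s_def using Suc.prems(1) AB by (intro Suc.IH) (auto simp: A_def)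
      also have "\<dots> \<le> K * e * (1 + s)"
        using Suc.prems(1) AB K s0 by (intro mult_right_mono mult_left_mono powr_le) auto
      finally show ?thesis .
    qed
    also have "(LINT x:E \<inter> B|lebesgue. p x) \<le> K * e * ((1 / 2^n) powr (\<alpha> / 2) / \<tau> (2^n))"
    proof -
      have t: "0 < \<tau> (2^n)" by (rule \<tau>_pos) simp
      have "(LINT x:E \<inter> B|lebesgue. p x) \<le> 81 * D^4 * C * 2 powr (\<alpha> / 2) * (measure lebesgue (E \<inter> B) / 2^n) powr (\<alpha> / 2) / \<tau> (2^n)"
        using Suc.prems(1) AB by (intro dyadic_piece) (auto simp: B_def)
      also have "\<dots> = K2 * measure lebesgue (E \<inter> B) powr (\<alpha> / 2) * ((1 / 2^n) powr (\<alpha> / 2) / \<tau> (2^n))"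
        unfolding K2_def by (simp add: powr_divide)
      also have "\<dots> \<le> K * e * ((1 / 2^n) powr (\<alpha> / 2) / \<tau> (2^n))"
        using Suc.prems(1) AB K pos t by (intro mult_right_mono mult_mono powr_le) auto
      finally show ?thesis .
    qed
    finally show ?case unfolding s_def e_def by (simp add: algebra_simps)
  qed
  then show thesis using K(1) that by blast
qed

text \<open>The terms W j of the dyadic sum decrease geometrically as j moves down from n, so the
  sum is of the order of its outermost term.\<close>

lemma dyadic_bound:
  obtains K where "0 < K" "\<And>n E. E \<in> sets lebesgue \<Longrightarrow> E \<subseteq> {-(2^n)..2^n} \<Longrightarrow>
    (LINT x:E|lebesgue. p x) \<le> K * (measure lebesgue E / 2^n) powr (\<alpha> / 2) / \<tau> (2^n)"
proof -
  obtain K where K: "0 < K" "\<And>n E. E \<in> sets lebesgue \<Longrightarrow> E \<subseteq> {-(2^n)..2^n} \<Longrightarrow>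
    (LINT x:E|lebesgue. p x) \<le> K * measure lebesgue E powr (\<alpha> / 2) * (1 + (\<Sum>j<n. (1 / 2^j) powr (\<alpha> / 2) / \<tau> (2^j)))"
    using dyadic_sum by blast
  define q where "q = (1/2::real) powr (\<alpha> / 2)"
  have q: "0 < q" "q < 1" unfolding q_def using \<alpha>_pos powr_less_mono2[of "\<alpha>/2" "1/2" 1] by auto
  define C2 where "C2 = C * 2 powr \<alpha>"
  have C2: "0 < C2" using C_pos by (simp add: C2_def)
  define W where "W n = (1 / 2^n) powr (\<alpha> / 2) / \<tau> (2^n)" for n :: nat
  have t: "0 < \<tau> (2^n)" for n by (rule \<tau>_pos) simp
  have W: "0 < W n" for n unfolding W_def using t by simp
  have qpow: "(1 / 2^n) powr (\<alpha> / 2) = q ^ n" for n :: nat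
    unfolding q_def by (simp add: powr_realpow[symmetric] powr_powr powr_divide) (simp add: powr_powr mult.commute flip: powr_realpow)
  \<comment> \<open>The decay of \<tau> supplies q^(n - j) twice: one copy turns q^j into q^n, the
    other remains as geometric decay.\<close>
  have W_le: "W j \<le> C2 * q ^ (n - j) * W n" if "j \<le> n" for j n
  proof -
    have "\<tau> (2^n) \<le> C * (2 * 2^j / 2^n) powr \<alpha> * \<tau> (2^j)"
      using that by (intro \<tau>_decay) (auto intro: power_increasing)
    also have "2 * 2^j / 2^n = 2 * (1 / 2^(n - j)::real)"
      using that by (simp add: power_diff)
    also have "\<dots> powr \<alpha> = 2 powr \<alpha> * (q ^ (n - j) * q ^ (n - j))"
      unfolding qpow[symmetric] by (subst powr_mult) (auto simp flip: powr_add)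
    finally have "\<tau> (2^n) \<le> C2 * (q ^ (n - j) * q ^ (n - j)) * \<tau> (2^j)" by (simp add: C2_def mult.assoc)
    then have "1 / \<tau> (2^j) \<le> C2 * (q ^ (n - j) * q ^ (n - j)) / \<tau> (2^n)"
      using t by (simp add: field_simps)
    then have "q ^ j * (1 / \<tau> (2^j)) \<le> q ^ j * (C2 * (q ^ (n - j) * q ^ (n - j)) / \<tau> (2^n))"
      using q by (intro mult_left_mono) auto
    also have "\<dots> = C2 * q ^ (n - j) * (q ^ (j + (n - j)) / \<tau> (2^n))" by (simp add: power_add)
    finally show ?thesis using that unfolding W_def qpow by simp
  qed
  have sum_le: "(\<Sum>j<n. W j) \<le> C2 / (1 - q) * W n" for n
  proof -
    have "(\<Sum>j<n. W j) \<le> (\<Sum>j<n. C2 * W n * q ^ (n - j))"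
      using W_le by (intro sum_mono) (auto simp: mult_ac)
    also have "\<dots> = C2 * W n * (\<Sum>j<n. q ^ (n - j))" by (simp add: sum_distrib_left)
    also have "(\<Sum>j<n. q ^ (n - j)) = (\<Sum>j<n. q ^ Suc (n - Suc j))"
      by (intro sum.cong) (auto simp: Suc_diff_Suc)
    also have "\<dots> = (\<Sum>j<n. q ^ Suc j)" by (rule sum.nat_diff_reindex)
    also have "\<dots> = q * ((1 - q ^ n) / (1 - q))" using q by (simp add: sum_gp_strict flip: sum_distrib_left)
    also have "\<dots> \<le> 1 * (1 / (1 - q))" using q by (intro mult_mono divide_right_mono divide_nonneg_pos) (auto simp: power_le_one)
    finally show ?thesis using C2 W[of n] by (simp add: mult_left_mono field_simps)
  qed
  define K3 where "K3 = K * (\<tau> 1 * C2 + C2 / (1 - q))"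
  have "0 < K3" unfolding K3_def using K(1) \<tau>_pos[of 1] C2 q by (intro mult_pos_pos add_pos_pos) auto
  moreover have "(LINT x:E|lebesgue. p x) \<le> K3 * (measure lebesgue E / 2^n) powr (\<alpha> / 2) / \<tau> (2^n)"
    if E: "E \<in> sets lebesgue" "E \<subseteq> {-(2^n)..2^n}" for n E
  proof -
    \<comment> \<open>The contribution of {-1..1} is absorbed too, since 1 is a multiple of the
      zeroth term.\<close>
    have "1 = \<tau> 1 * W 0" using \<tau>_pos[of 1] by (simp add: W_def)
    also have "\<dots> \<le> \<tau> 1 * (C2 * q ^ n * W n)" using W_le[of 0 n] \<tau>_pos[of 1] by (intro mult_left_mono) auto
    also have "\<dots> \<le> \<tau> 1 * (C2 * 1 * W n)"
      using \<tau>_pos[of 1] C2 W[of n] q by (intro mult_left_mono mult_right_mono power_le_one) (auto simp: less_imp_le)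
    finally have one: "1 \<le> \<tau> 1 * C2 * W n" by simp
    have "(LINT x:E|lebesgue. p x) \<le> K * measure lebesgue E powr (\<alpha> / 2) * (1 + (\<Sum>j<n. W j))"
      unfolding W_def by (rule K(2)[OF E])
    also have "\<dots> \<le> K * measure lebesgue E powr (\<alpha> / 2) * (\<tau> 1 * C2 * W n + C2 / (1 - q) * W n)"
      using K(1) by (intro mult_left_mono add_mono one sum_le) auto
    also have "\<dots> = K3 * (measure lebesgue E powr (\<alpha> / 2) * W n)"
      unfolding K3_def by (simp only: distrib_left distrib_right mult.assoc mult.left_commute mult.commute)
    also have "\<dots> = K3 * (measure lebesgue E / 2^n) powr (\<alpha> / 2) / \<tau> (2^n)"
      unfolding W_def by (simp add: powr_divide)
    finally show ?thesis .
  qed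
  ultimately show thesis using that by blast
qed

text \<open>For an interval that is not tame, \<open>dyadic_bound\<close> on an enclosing dyadic
  interval controls the mass of E. The interval contains one side of an annulus of radius comparable
  to 2^n, so h b - h a is at least of the matching order 1 / \<tau> (2^n).\<close>

lemma A_infinity_p:
  obtains K where "0 < K" "\<And>a b E. a < b \<Longrightarrow> E \<in> sets lebesgue \<Longrightarrow> E \<subseteq> {a..b} \<Longrightarrow>
    (LINT x:E|lebesgue. p x) \<le> K * (measure lebesgue E / (b - a)) powr (\<alpha> / 2) * (h b - h a)"
proof -
  obtain K where K: "0 < K" "\<And>n E. E \<in> sets lebesgue \<Longrightarrow> E \<subseteq> {-(2^n)..2^n} \<Longrightarrow>
    (LINT x:E|lebesgue. p x) \<le> K * (measure lebesgue E / 2^n) powr (\<alpha> / 2) / \<tau> (2^n)"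
    using dyadic_bound by blast
  define K1 where "K1 = 2 * \<Lambda>\<^sup>2 * C * 5 powr \<alpha>"
  define K2 where "K2 = K * 2 powr (\<alpha> / 2) * D^3"
  define K' where "K' = max K1 K2"
  have pos: "0 < K1" "0 < K2" unfolding K1_def K2_def using \<Lambda>_pos C_pos D_pos K(1) by auto
  have "(LINT x:E|lebesgue. p x) \<le> K' * (measure lebesgue E / (b - a)) powr (\<alpha> / 2) * (h b - h a)"
    if ab: "a < b" and E: "E \<in> sets lebesgue" "E \<subseteq> {a..b}" for a b E
  proof -
    define e where "e = measure lebesgue E / (b - a)"
    have "measure lebesgue E \<le> b - a" using measure_Icc_subset[OF E] ab by simp
    then have e: "0 \<le> e" "e \<le> 1" using ab by (auto simp: e_def)
    have hab: "0 < h b - h a" using ab h_less_iff by simp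
    consider "tame a b" | R where "2 < R" "- R \<le> a" "b \<le> R" "R / 2 \<le> b - a"
        "{R/2..R} \<subseteq> {a..b} \<or> {- R..- (R/2)} \<subseteq> {a..b}"
      using tame_or_large[OF ab] by blast
    then show ?thesis
    proof cases
      case 1
      have "(LINT x:E|lebesgue. p x) \<le> K1 * e powr \<alpha> * (h b - h a)"
        unfolding K1_def e_def by (rule tame_A_infinity[OF 1 ab E])
      also have "\<dots> \<le> K' * e powr (\<alpha> / 2) * (h b - h a)"
        using hab pos e \<alpha>_pos by (intro mult_right_mono mult_mono powr_mono') (auto simp: K'_def)
      finally show ?thesis unfolding e_def .
    next
      case R: 2
      obtain m :: nat where m: "2 ^ m \<le> R" "R < 2 * 2 ^ m" using ex_power2_bracket[of R] R by auto
      define n where "n = Suc m"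
      have n: "R \<le> 2 ^ n" "2 ^ n \<le> 2 * R" using m by (auto simp: n_def)
      have R2: "1 \<le> R / 2" "1 \<le> R" using R by auto
      have t: "0 < \<tau> (2^n)" "0 < \<tau> (R/2)" "0 < \<tau> (2 * R)" using \<tau>_pos R2 by auto
      have "1 / \<tau> (R/2) \<le> D * (h b - h a)"
      proof -
        have sub: "(LINT x:F|lebesgue. p x) \<le> h b - h a" if "F \<in> sets lebesgue" "F \<subseteq> {a..b}" for F
          using LINT_p[of a b] ab set_integral_mono_set_nonneg[OF p_integrable that] p_nonneg by simp
        \<comment> \<open>On F the quantity 1 + |h| is at least 2 / \<tau> (R/2), so the k-mass of F
          is at most \<tau> (R/2)^2 times its p-mass; but this k-mass is a fixed share of \<tau>
          (R/2).\<close>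
        have aux: "1 / \<tau> (R/2) \<le> D * (h b - h a)"
          if F: "F \<in> sets lebesgue" "F \<subseteq> {a..b}" "\<tau> (R/2) \<le> D * (LINT x:F|lebesgue. k x)" "F \<subseteq> tail (R/2)" for F
        proof -
          have "\<tau> (R/2) \<le> D * (4 / (2 / \<tau> (R/2))\<^sup>2 * (LINT x:F|lebesgue. p x))"
            using F D_pos h_lower[OF R2(1)] t
            by (elim order_trans) (intro mult_left_mono LINT_k_le_p[of F a b], auto simp: tail_def)
          also have "\<dots> \<le> D * (4 / (2 / \<tau> (R/2))\<^sup>2 * (h b - h a))"
            using D_pos t F by (intro mult_left_mono sub) auto
          also have "\<dots> = D * (h b - h a) * (\<tau> (R/2) * \<tau> (R/2))"
            using t by (simp add: power_divide power2_eq_square)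
          finally have "1 * \<tau> (R/2) \<le> (D * (h b - h a) * \<tau> (R/2)) * \<tau> (R/2)" by (simp add: mult.assoc)
          then have "1 \<le> D * (h b - h a) * \<tau> (R/2)" using t(2) by (rule mult_right_le_imp_le)
          then show ?thesis using t(2) by (simp add: divide_le_eq)
        qed
        show ?thesis using R(5)
        proof
          assume "{R/2..R} \<subseteq> {a..b}"
          then show ?thesis using doubling(1)[OF R2(1)] R2 by (intro aux[of "{R/2..R}"]) (auto simp: \<tau>_def k_def tail_def)
        next
          assume "{- R..- (R/2)} \<subseteq> {a..b}"
          then show ?thesis using doubling(3)[OF R2(1)] R2 by (intro aux[of "{- R..- (R/2)}"]) (auto simp: \<tau>_def k_def tail_def)
        qed
      qed
      \<comment> \<open>Two doublings lead from R/2 to 2 * R, which is at least 2^n.\<close>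
      moreover have "1 / \<tau> (2^n) \<le> D^2 * (1 / \<tau> (R/2))"
      proof -
        have "\<tau> (R/2) \<le> D * \<tau> R" using \<tau>_le_doubling[OF R2(1)] by simp
        also have "\<dots> \<le> D * (D * \<tau> (2 * R))" using D_pos \<tau>_le_doubling[OF R2(2)] by (intro mult_left_mono) auto
        also have "\<dots> \<le> D * (D * \<tau> (2 ^ n))" using D_pos n by (intro mult_left_mono \<tau>_antimono) auto
        finally show ?thesis using t by (simp add: field_simps power2_eq_square)
      qed
      ultimately have H: "1 / \<tau> (2^n) \<le> D^3 * (h b - h a)"
        using D_pos mult_left_mono[of "1 / \<tau> (R/2)" "D * (h b - h a)" "D^2"]
        by (simp add: power3_eq_cube power2_eq_square mult.assoc)
      have "(LINT x:E|lebesgue. p x) \<le> K * (measure lebesgue E / 2^n) powr (\<alpha> / 2) / \<tau> (2^n)"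
        using E R n by (intro K(2)) auto
      also have "\<dots> = K * (measure lebesgue E / 2^n) powr (\<alpha> / 2) * (1 / \<tau> (2^n))" by simp
      also have "\<dots> \<le> K * (2 * e) powr (\<alpha> / 2) * (D^3 * (h b - h a))"
      proof (intro mult_mono powr_mono2 H)
        have "b - a \<le> 2 * 2^n" using R n by linarith
        then have "measure lebesgue E / 2^n \<le> measure lebesgue E / ((b - a) / 2)"
          using ab by (intro divide_left_mono) auto
        then show "measure lebesgue E / 2^n \<le> 2 * e" by (simp add: e_def mult.commute)
      qed (use K(1) \<alpha>_pos t in auto)
      also have "\<dots> = K2 * e powr (\<alpha> / 2) * (h b - h a)" using e by (simp add: K2_def powr_mult)
      also have "\<dots> \<le> K' * e powr (\<alpha> / 2) * (h b - h a)" using hab by (intro mult_right_mono) (auto simp: K'_def)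
      finally show ?thesis unfolding e_def .
    qed
  qed
  moreover have "0 < K'" using pos by (simp add: K'_def)
  ultimately show thesis using that by blast
qed

end

section \<open>Positivity of the density and oscillation of ln (1 + h^2)\<close>

lemma sets_borel_subset_lebesgue: "sets borel \<subseteq> sets (lebesgue :: real measure)"
  by auto

lemma half_square_le:
  fixes y :: real
  assumes "0 \<le> M" "M \<le> 1 + \<bar>y\<bar>"
  shows "M\<^sup>2 / 2 \<le> 1 + y\<^sup>2"
proof -
  have "M\<^sup>2 \<le> (1 + \<bar>y\<bar>)\<^sup>2" using assms(2,1) by (rule power_mono)
  then show ?thesis using one_plus_square_bounds(1)[of y] by linarith
qed

context circle_weight_on_line begin

text \<open>In every interval the complement of the zero set Z carries the whole increment of h, so
  by \<open>A_infinity_p\<close> its relative measure cannot be below \<kappa>. Thus Z has relative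
  measure at most 1 - \<kappa> in every interval, and a Vitali cover shows that it is null.\<close>

lemma AE_p_pos: "AE x in lebesgue. 0 < p x"
proof -
  obtain K where K: "0 < K" "\<And>a b E. a < b \<Longrightarrow> E \<in> sets lebesgue \<Longrightarrow> E \<subseteq> {a..b} \<Longrightarrow>
    (LINT x:E|lebesgue. p x) \<le> K * (measure lebesgue E / (b - a)) powr (\<alpha> / 2) * (h b - h a)"
    using A_infinity_p by blast
  \<comment> \<open>Makes K times \<kappa>^(\<alpha> / 2) at most 1/2.\<close>
  define \<kappa> where "\<kappa> = min (1/2) ((1 / (2 * K)) powr (2 / \<alpha>))"
  have \<kappa>: "0 < \<kappa>" "\<kappa> < 1" using K(1) by (auto simp: \<kappa>_def)
  have K\<kappa>: "K * \<kappa> powr (\<alpha> / 2) < 1"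
  proof -
    have "\<kappa> powr (\<alpha> / 2) \<le> ((1 / (2 * K)) powr (2 / \<alpha>)) powr (\<alpha> / 2)"
      using \<kappa> \<alpha>_pos by (intro powr_mono2) (auto simp: \<kappa>_def)
    also have "\<dots> = 1 / (2 * K)" using K(1) \<alpha>_pos by (simp add: powr_powr)
    finally show ?thesis using K(1) by (simp add: field_simps)
  qed
  define Z where "Z = {x. p x = 0}"
  have Z: "Z \<in> sets lebesgue"
    using measurable_sets[OF p_measurable, of "{0}"] by (simp add: Z_def vimage_def)
  have interval: "measure lebesgue (Z \<inter> {u..v}) \<le> (1 - \<kappa>) * (v - u)" if uv: "u < v" for u v
  proof (rule ccontr)
    assume neg: "\<not> ?thesis"
    define E where "E = {u..v} - Z"
    have E: "E \<in> sets lebesgue" "E \<subseteq> {u..v}" using Z by (auto simp: E_def)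
    have "E = {u..v} - (Z \<inter> {u..v})" by (auto simp: E_def)
    then have "measure lebesgue E = (v - u) - measure lebesgue (Z \<inter> {u..v})"
      using Z uv measurable_measure_Diff[OF Icc_lmeasurable[of u v], of "Z \<inter> {u..v}"] by (simp add: sets.Int)
    then have "measure lebesgue E \<le> \<kappa> * (v - u)" using neg by (simp add: algebra_simps)
    then have small: "measure lebesgue E / (v - u) \<le> \<kappa>" using uv by (simp add: field_simps)
    have "h v - h u = (LINT x:{u..v}|lebesgue. p x)" using LINT_p uv by simp
    also have "\<dots> = (LINT x:E|lebesgue. p x)"
      unfolding set_lebesgue_integral_def
      by (intro Bochner_Integration.integral_cong) (auto simp: E_def Z_def indicator_def)
    also have "\<dots> \<le> K * (measure lebesgue E / (v - u)) powr (\<alpha> / 2) * (h v - h u)" by (rule K(2)[OF uv E])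
    also have "\<dots> \<le> K * \<kappa> powr (\<alpha> / 2) * (h v - h u)"
      using K(1) \<alpha>_pos uv small h_le_iff[of u v] by (intro mult_right_mono mult_left_mono powr_mono2) auto
    finally have "(h v - h u) * (1 - K * \<kappa> powr (\<alpha> / 2)) \<le> 0" by (simp add: algebra_simps)
    moreover have "0 < (h v - h u) * (1 - K * \<kappa> powr (\<alpha> / 2))"
      using K\<kappa> uv h_less_iff by (intro mult_pos_pos) auto
    ultimately show False by simp
  qed
  have "negligible (Z \<inter> {- real n..real n})" for n :: nat
  proof (rule negligible_if_shrinking_cover[of _ "1 - \<kappa>"])
    show "bounded (Z \<inter> {- real n..real n})" by (rule bounded_subset[of "{- real n..real n}"]) auto
    fix G :: "real set" and e :: real
    assume G: "open G" "G \<in> lmeasurable" "Z \<inter> {- real n..real n} \<subseteq> G" "0 < e"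
    \<comment> \<open>The density bound holds on every interval, so all intervals inside G may enter
      the Vitali family.\<close>
    define P where "P u v = ({u..v} \<subseteq> G)" for u v :: real
    have "\<exists>u v. u < v \<and> u \<le> x \<and> x \<le> v \<and> v - u < d \<and> P u v"
      if x: "x \<in> Z \<inter> {- real n..real n}" "0 < d" for x d
    proof -
      obtain d' where d': "0 < d'" "ball x d' \<subseteq> G" using G x by (meson openE subsetD)
      define s where "s = min d d' / 2"
      have s: "0 < s" "s < d" "s < d'" using d' x by (auto simp: s_def)
      have "{x..x + s} \<subseteq> ball x d'" using s by (auto simp: dist_real_def)
      then have "P x (x + s)" using d'(2) unfolding P_def by (rule order_trans)
      then show ?thesis using s by (intro exI[of _ x] exI[of _ "x + s"]) auto
    qed
    then obtain C where C: "countable C" "\<And>u v. (u, v) \<in> C \<Longrightarrow> u < v \<and> P u v"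
      "disjoint_family_on (\<lambda>(u, v). {u..v}) C"
      "negligible (Z \<inter> {- real n..real n} - (\<Union>(u, v)\<in>C. {u..v}))"
      by (rule Vitali_covering_intervals[of "Z \<inter> {- real n..real n}" P]) auto
    define U where "U = (\<Union>(u, v)\<in>C. {u..v})"
    have U: "U \<in> sets borel" using C(1) unfolding U_def by (intro sets.countable_UN'') auto
    have UG: "U \<subseteq> G" using C(2) unfolding U_def P_def by force
    have Um: "U \<in> lmeasurable" by (rule lmeasurable_Borel_subset[OF U UG G(2)])
    have ZU: "Z \<inter> U \<in> lmeasurable" using Z Um by (intro fmeasurableI2[OF Um]) (auto dest: fmeasurableD)
    have dens: "emeasure (density lebesgue (indicator Z)) A = emeasure lebesgue (Z \<inter> A)" if "A \<in> sets lebesgue" for A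
      using that Z by (subst emeasure_density) (auto simp flip: indicator_inter_arith)
    have "emeasure (density lebesgue (indicator Z)) U \<le> ennreal (1 - \<kappa>) * emeasure lebesgue U"
      unfolding U_def
    proof (rule measure_UN_intervals_le[OF C(1,3)])
      fix u v assume "(u, v) \<in> C"
      then have uv: "u < v" using C(2) by auto
      have m: "Z \<inter> {u..v} \<in> lmeasurable" using Z by (intro fmeasurableI2[OF Icc_lmeasurable]) auto
      have "emeasure (density lebesgue (indicator Z)) {u..v} = ennreal (measure lebesgue (Z \<inter> {u..v}))"
        using emeasure_eq_measure2[OF m] by (simp add: dens)
      also have "\<dots> \<le> ennreal ((1 - \<kappa>) * (v - u))" using interval[OF uv] by (rule ennreal_leI)
      also have "\<dots> = ennreal (1 - \<kappa>) * emeasure lebesgue {u..v}" using uv \<kappa> by (simp add: ennreal_mult)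
      finally show "emeasure (density lebesgue (indicator Z)) {u..v} \<le> ennreal (1 - \<kappa>) * emeasure lebesgue {u..v}" .
    qed (use sets_borel_subset_lebesgue in auto)
    then have "ennreal (measure lebesgue (Z \<inter> U)) \<le> ennreal ((1 - \<kappa>) * measure lebesgue U)"
      using emeasure_eq_measure2[OF ZU] emeasure_eq_measure2[OF Um] U \<kappa> by (simp add: dens ennreal_mult)
    then have "measure lebesgue (Z \<inter> U) \<le> (1 - \<kappa>) * measure lebesgue U"
      using \<kappa> by (subst (asm) ennreal_le_iff) auto
    also have "\<dots> \<le> (1 - \<kappa>) * measure lebesgue G"
      using UG G(2) Um \<kappa> by (intro mult_left_mono measure_mono_fmeasurable) auto
    finally have le: "measure lebesgue (Z \<inter> U) \<le> (1 - \<kappa>) * measure lebesgue G" .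
    define N where "N = Z \<inter> {- real n..real n} - U"
    have null: "N \<in> null_sets lebesgue" using C(4) unfolding N_def U_def negligible_iff_null_sets .
    show "\<exists>B. B \<in> lmeasurable \<and> Z \<inter> {- real n..real n} \<subseteq> B \<and> measure lebesgue B \<le> (1 - \<kappa>) * measure lebesgue G + e"
    proof (intro exI[of _ "(Z \<inter> U) \<union> N"] conjI)
      show "(Z \<inter> U) \<union> N \<in> lmeasurable"
        using ZU null by (intro fmeasurable.Un) (auto simp: negligible_imp_measurable negligible_iff_null_sets)
      show "Z \<inter> {- real n..real n} \<subseteq> (Z \<inter> U) \<union> N" by (auto simp: N_def)
      have "measure lebesgue ((Z \<inter> U) \<union> N) = measure lebesgue (Z \<inter> U)"
        using null ZU by (intro measure_Un_null_set) auto
      then show "measure lebesgue ((Z \<inter> U) \<union> N) \<le> (1 - \<kappa>) * measure lebesgue G + e" using le G by simp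
    qed
  qed (use \<kappa> in auto)
  then have "negligible (\<Union>n. Z \<inter> {- real n..real n})" by (intro negligible_Union_nat) auto
  moreover have "Z \<subseteq> (\<Union>n. Z \<inter> {- real n..real n})"
  proof
    fix x assume "x \<in> Z"
    moreover obtain n where "\<bar>x\<bar> \<le> real n" using real_arch_simple by blast
    ultimately have "x \<in> Z \<inter> {- real n..real n}" by (auto simp: abs_le_iff)
    then show "x \<in> (\<Union>n. Z \<inter> {- real n..real n})" by blast
  qed
  ultimately have "negligible Z" by (rule negligible_subset)
  then have "AE x in lebesgue. x \<notin> Z" unfolding negligible_iff_null_sets by (rule AE_not_in)
  then show ?thesis by eventually_elim (use p_nonneg in \<open>auto simp: Z_def less_le\<close>)
qed

text \<open>Relative to ln (M^2), the downward deviation is the ln 2 lost in 1 + t^2 >= (1 + |t|)^2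
  / 2, the upward one is ln (\<Lambda>^2).\<close>

lemma tame_ln_h:
  assumes "tame a b" "a < b"
  shows "\<exists>c. \<forall>x\<in>{a..b}. \<bar>ln (1 + (h x)\<^sup>2) - c\<bar> \<le> max (ln 2) (ln (\<Lambda>\<^sup>2))"
proof -
  obtain M where M: "0 < M" "\<And>x. x \<in> {a..b} \<Longrightarrow> M \<le> 1 + \<bar>h x\<bar> \<and> 1 + \<bar>h x\<bar> \<le> \<Lambda> * M"
    using tame_h[OF assms(1) less_imp_le[OF assms(2)]] by blast
  have "\<bar>ln (1 + (h x)\<^sup>2) - ln (M\<^sup>2)\<bar> \<le> max (ln 2) (ln (\<Lambda>\<^sup>2))" if x: "x \<in> {a..b}" for x
  proof -
    have pos: "0 < 1 + (h x)\<^sup>2" by (simp add: add_pos_nonneg)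
    have "M\<^sup>2 / 2 \<le> 1 + (h x)\<^sup>2"
      using M(1) M(2)[OF x] by (intro half_square_le) auto
    then have "ln (M\<^sup>2 / 2) \<le> ln (1 + (h x)\<^sup>2)" using M(1) pos by (subst ln_le_cancel_iff) auto
    moreover have "ln (M\<^sup>2 / 2) = ln (M\<^sup>2) - ln 2" using M(1) by (simp add: ln_div)
    moreover have "1 + (h x)\<^sup>2 \<le> \<Lambda>\<^sup>2 * M\<^sup>2"
      using one_plus_square_bounds(2)[of "h x"] power_mono[of "1 + \<bar>h x\<bar>" "\<Lambda> * M" 2] M(2)[OF x]
      by (auto simp: power_mult_distrib)
    then have "ln (1 + (h x)\<^sup>2) \<le> ln (\<Lambda>\<^sup>2 * M\<^sup>2)" using M(1) \<Lambda>_pos pos by (subst ln_le_cancel_iff) auto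
    moreover have "ln (\<Lambda>\<^sup>2 * M\<^sup>2) = ln (\<Lambda>\<^sup>2) + ln (M\<^sup>2)" using M(1) \<Lambda>_pos by (simp add: ln_mult)
    ultimately show ?thesis by linarith
  qed
  then show ?thesis by blast
qed

text \<open>Two doublings lead from R to 4 R; together with the factor D of \<open>h_upper\<close>
  they produce D^3.\<close>

lemma annulus_ln_h:
  assumes R: "1 \<le> R"
  shows "\<exists>c. \<forall>x. R \<le> \<bar>x\<bar> \<and> \<bar>x\<bar> \<le> 4 * R \<longrightarrow> \<bar>ln (1 + (h x)\<^sup>2) - c\<bar> \<le> ln ((9 * D^3)\<^sup>2)"
proof -
  have t: "0 < \<tau> R" "0 < \<tau> (2 * R)" "0 < \<tau> (4 * R)" using \<tau>_pos R by auto
  have "\<bar>ln (1 + (h x)\<^sup>2) - ln ((1 / \<tau> R)\<^sup>2)\<bar> \<le> ln ((9 * D^3)\<^sup>2)" if x: "R \<le> \<bar>x\<bar>" "\<bar>x\<bar> \<le> 4 * R" for x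
  proof -
    have pos: "0 < 1 + (h x)\<^sup>2" by (simp add: add_pos_nonneg)
    have "(1 / \<tau> R)\<^sup>2 \<le> (2 / \<tau> R)\<^sup>2 / 2" using t by (simp add: power_divide field_simps)
    also have "\<dots> \<le> 1 + (h x)\<^sup>2"
      using t by (intro half_square_le h_lower[OF R x(1)]) auto
    finally have "ln ((1 / \<tau> R)\<^sup>2) \<le> ln (1 + (h x)\<^sup>2)" using t pos by (subst ln_le_cancel_iff) auto
    moreover have "ln (1 + (h x)\<^sup>2) \<le> ln ((9 * D^3)\<^sup>2) + ln ((1 / \<tau> R)\<^sup>2)"
    proof -
      have "\<tau> R \<le> D * \<tau> (2 * R)" by (rule \<tau>_le_doubling[OF R])
      also have "\<dots> \<le> D * (D * \<tau> (4 * R))" using \<tau>_le_doubling[of "2 * R"] R D_pos by (intro mult_left_mono) auto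
      finally have "1 / \<tau> (4 * R) \<le> D * D / \<tau> R" using t by (simp add: field_simps)
      then have "9 * D * (1 / \<tau> (4 * R)) \<le> 9 * D * (D * D / \<tau> R)" using D_pos by (intro mult_left_mono) auto
      then have "1 + \<bar>h x\<bar> \<le> 9 * D^3 * (1 / \<tau> R)"
        using h_upper[of "4 * R" x] R x by (simp add: power3_eq_cube mult.assoc)
      then have "(1 + \<bar>h x\<bar>)\<^sup>2 \<le> (9 * D^3 * (1 / \<tau> R))\<^sup>2" by (intro power_mono) auto
      then have "1 + (h x)\<^sup>2 \<le> (9 * D^3)\<^sup>2 * (1 / \<tau> R)\<^sup>2"
        using one_plus_square_bounds(2)[of "h x"] by (simp only: power_mult_distrib)
      then have "ln (1 + (h x)\<^sup>2) \<le> ln ((9 * D^3)\<^sup>2 * (1 / \<tau> R)\<^sup>2)"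
        using pos by simp
      then show ?thesis using t D_pos by (subst (asm) ln_mult) auto
    qed
    ultimately show ?thesis by linarith
  qed
  then show ?thesis by blast
qed

text \<open>The increment of h over [x, y] is at most a multiple of M |x - y|^\<alpha>, where M is
  the size of 1 + |h| on an enclosing tame interval of length at least 1, while ln (1 + t^2) varies
  at a rate of order 1 / M on values of that size. The scale M cancels, so the bound is uniform up
  to infinity.\<close>

lemma Holder_ln_h:
  obtains K where "0 < K" "\<And>x y. \<bar>x - y\<bar> \<le> 1 \<Longrightarrow> \<bar>ln (1 + (h x)\<^sup>2) - ln (1 + (h y)\<^sup>2)\<bar> \<le> K * \<bar>x - y\<bar> powr \<alpha>"
proof -
  define K1 where "K1 = 2 * \<Lambda>\<^sup>2 * C * 5 powr \<alpha>"
  have K1: "0 < K1" unfolding K1_def using \<Lambda>_pos C_pos by auto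
  define K where "K = 8 * \<Lambda>\<^sup>2 * K1"
  have K: "0 < K" using K1 \<Lambda>_pos by (simp add: K_def)
  have main: "\<bar>ln (1 + (h x)\<^sup>2) - ln (1 + (h y)\<^sup>2)\<bar> \<le> K * (y - x) powr \<alpha>" if xy: "x < y" "y - x \<le> 1" for x y
  proof -
    obtain c d where cd: "tame c d" "c \<le> x" "y \<le> d" "1 \<le> d - c" using tame_enclosing[OF xy] by blast
    have lt: "c < d" using cd by linarith
    obtain M where M: "0 < M" "\<And>x. x \<in> {c..d} \<Longrightarrow> M \<le> 1 + \<bar>h x\<bar> \<and> 1 + \<bar>h x\<bar> \<le> \<Lambda> * M"
      using tame_h[OF cd(1) less_imp_le[OF lt]] by blast
    have hM: "\<bar>h z\<bar> \<le> \<Lambda> * M" "M\<^sup>2 / 2 \<le> 1 + (h z)\<^sup>2" if "z \<in> {c..d}" for z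
      using M(1) M(2)[OF that] half_square_le[of M "h z"] by auto
    have xm: "x \<in> {c..d}" "y \<in> {c..d}" using cd xy by auto
    have "h y - h x = (LINT z:{x..y}|lebesgue. p z)" using LINT_p xy by simp
    also have "\<dots> \<le> K1 * (measure lebesgue {x..y} / (d - c)) powr \<alpha> * (h d - h c)"
      unfolding K1_def using cd by (intro tame_A_infinity[OF cd(1) lt]) auto
    also have "\<dots> \<le> K1 * (y - x) powr \<alpha> * (2 * \<Lambda> * M)"
    proof (intro mult_mono powr_mono2)
      show "measure lebesgue {x..y} / (d - c) \<le> y - x" using xy cd by (simp add: divide_le_eq mult_le_cancel_left1)
      show "h d - h c \<le> 2 * \<Lambda> * M" using hM(1)[of d] hM(1)[of c] lt by auto
      show "0 \<le> h d - h c" using h_le_iff lt by simp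
    qed (use K1 \<alpha>_pos xy lt in auto)
    finally have diff: "h y - h x \<le> K1 * (y - x) powr \<alpha> * (2 * \<Lambda> * M)" .
    have hxy: "h x < h y" using xy h_less_iff by simp
    \<comment> \<open>Only the endpoint values enter: ln t <= t - 1 is applied to the quotient of 1
      + Y^2 and 1 + X^2 in both orders.\<close>
    have one: "\<bar>ln (1 + X\<^sup>2) - ln (1 + Y\<^sup>2)\<bar> \<le> 4 * \<Lambda> / M * \<bar>Y - X\<bar>"
      if XY: "\<bar>X\<bar> \<le> \<Lambda> * M" "\<bar>Y\<bar> \<le> \<Lambda> * M" "M\<^sup>2 / 2 \<le> 1 + X\<^sup>2" "M\<^sup>2 / 2 \<le> 1 + Y\<^sup>2" for X Y
    proof -
      have half: "ln (1 + Y\<^sup>2) - ln (1 + X\<^sup>2) \<le> 4 * \<Lambda> / M * \<bar>Y - X\<bar>"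
        if XY: "\<bar>X\<bar> \<le> \<Lambda> * M" "\<bar>Y\<bar> \<le> \<Lambda> * M" "M\<^sup>2 / 2 \<le> 1 + X\<^sup>2" for X Y
      proof -
        have pos: "0 < 1 + X\<^sup>2" "0 < 1 + Y\<^sup>2" by (auto simp: add_pos_nonneg)
        have "ln (1 + Y\<^sup>2) - ln (1 + X\<^sup>2) = ln ((1 + Y\<^sup>2) / (1 + X\<^sup>2))" using pos by (simp add: ln_div)
        also have "\<dots> \<le> (1 + Y\<^sup>2) / (1 + X\<^sup>2) - 1" using pos by (intro ln_le_minus_one) auto
        also have "\<dots> = (Y\<^sup>2 - X\<^sup>2) / (1 + X\<^sup>2)" using pos by (simp add: field_simps)
        also have "\<dots> \<le> (\<bar>Y - X\<bar> * (2 * \<Lambda> * M)) / (1 + X\<^sup>2)"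
        proof (rule divide_right_mono)
          have "Y\<^sup>2 - X\<^sup>2 = (Y - X) * (Y + X)" by (simp add: power2_eq_square algebra_simps)
          also have "\<dots> \<le> \<bar>Y - X\<bar> * \<bar>Y + X\<bar>" by (metis abs_ge_self abs_mult)
          also have "\<dots> \<le> \<bar>Y - X\<bar> * (2 * \<Lambda> * M)" using XY by (intro mult_left_mono) auto
          finally show "Y\<^sup>2 - X\<^sup>2 \<le> \<bar>Y - X\<bar> * (2 * \<Lambda> * M)" .
        qed (use pos in auto)
        also have "\<dots> \<le> (\<bar>Y - X\<bar> * (2 * \<Lambda> * M)) / (M\<^sup>2 / 2)"
          using XY M(1) \<Lambda>_pos pos by (intro divide_left_mono) auto
        also have "\<dots> = 4 * \<Lambda> / M * \<bar>Y - X\<bar>" using M(1) by (simp add: power2_eq_square)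
        finally show ?thesis .
      qed
      show ?thesis using half[of X Y] half[of Y X] XY by (auto simp: abs_minus_commute abs_le_iff)
    qed
    have "\<bar>ln (1 + (h x)\<^sup>2) - ln (1 + (h y)\<^sup>2)\<bar> \<le> 4 * \<Lambda> / M * \<bar>h y - h x\<bar>"
      by (rule one) (use hM xm in auto)
    also have "\<dots> \<le> 4 * \<Lambda> / M * (K1 * (y - x) powr \<alpha> * (2 * \<Lambda> * M))"
      using diff hxy M(1) \<Lambda>_pos by (intro mult_left_mono) auto
    also have "\<dots> = K * (y - x) powr \<alpha>" using M(1) by (simp add: K_def power2_eq_square)
    finally show ?thesis .
  qed
  show thesis
  proof (rule that[OF K])
    fix x y :: real assume "\<bar>x - y\<bar> \<le> 1"
    then show "\<bar>ln (1 + (h x)\<^sup>2) - ln (1 + (h y)\<^sup>2)\<bar> \<le> K * \<bar>x - y\<bar> powr \<alpha>"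
      using main[of x y] main[of y x] by (cases x y rule: linorder_cases) (auto simp: abs_minus_commute)
  qed
qed

end

lemma ln_one_plus_square:
  "ln (1 + x\<^sup>2) = ln 2 - ln (line_density x)"
proof -
  have "0 < 1 + x\<^sup>2" by (simp add: add_pos_nonneg)
  then show ?thesis unfolding line_density_def by (subst ln_div) auto
qed

lemma tame_ln_square:
  assumes "tame a b"
  shows "\<exists>c. \<forall>x\<in>{a..b}. \<bar>ln (1 + x\<^sup>2) - c\<bar> \<le> ln 5"
proof -
  obtain m where m: "0 < m" "\<And>x. x \<in> {a..b} \<Longrightarrow> m \<le> line_density x \<and> line_density x \<le> 5 * m"
    using assms by (rule tame_line_density) blast
  have "\<bar>ln (1 + x\<^sup>2) - (ln 2 - ln m)\<bar> \<le> ln 5" if "x \<in> {a..b}" for x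
  proof -
    have "ln m \<le> ln (line_density x)" "ln (line_density x) \<le> ln (5 * m)"
      using m(1) m(2)[OF that] line_density_pos by (auto simp: ln_le_cancel_iff)
    then show ?thesis using m(1) unfolding ln_one_plus_square by (simp add: ln_mult)
  qed
  then show ?thesis by blast
qed

lemma annulus_ln_square:
  fixes R :: real
  assumes R: "1 \<le> R"
  shows "\<exists>c. \<forall>x. R \<le> \<bar>x\<bar> \<and> \<bar>x\<bar> \<le> 4 * R \<longrightarrow> \<bar>ln (1 + x\<^sup>2) - c\<bar> \<le> ln 16"
proof -
  have "\<bar>ln (1 + x\<^sup>2) - ln (1 + R\<^sup>2)\<bar> \<le> ln 16" if x: "R \<le> \<bar>x\<bar>" "\<bar>x\<bar> \<le> 4 * R" for x
  proof -
    have "R\<^sup>2 \<le> x\<^sup>2" "x\<^sup>2 \<le> 16 * R\<^sup>2"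
      using power_mono[OF x(1), of 2] power_mono[OF x(2), of 2] R by (auto simp: power_mult_distrib)
    moreover have "0 < 1 + R\<^sup>2" "0 < 1 + x\<^sup>2" by (auto simp: add_pos_nonneg)
    ultimately have "ln (1 + R\<^sup>2) \<le> ln (1 + x\<^sup>2)" "ln (1 + x\<^sup>2) \<le> ln (16 * (1 + R\<^sup>2))"
      by (subst ln_le_cancel_iff; simp)+
    moreover have "ln (16 * (1 + R\<^sup>2)) = ln 16 + ln (1 + R\<^sup>2)"
      using \<open>0 < 1 + R\<^sup>2\<close> by (subst ln_mult) auto
    ultimately show ?thesis by linarith
  qed
  then show ?thesis by blast
qed

lemma ln_square_lipschitz: "\<bar>ln (1 + x\<^sup>2) - ln (1 + y\<^sup>2)\<bar> \<le> \<bar>x - y\<bar>" for x y :: real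
proof -
  have "norm (ln (1 + x\<^sup>2) - ln (1 + y\<^sup>2)) \<le> 1 * norm (x - y)"
  proof (rule field_differentiable_bound[of UNIV "\<lambda>x. ln (1 + x\<^sup>2)" "\<lambda>x. 2 * x / (1 + x\<^sup>2)"])
    fix z :: real
    have pos: "0 < 1 + z\<^sup>2" by (simp add: add_pos_nonneg)
    then show "((\<lambda>x. ln (1 + x\<^sup>2)) has_field_derivative 2 * z / (1 + z\<^sup>2)) (at z within UNIV)"
      by (auto intro!: derivative_eq_intros)
    have "0 \<le> (1 - \<bar>z\<bar>)\<^sup>2" by simp
    then have "2 * \<bar>z\<bar> \<le> 1 + z\<^sup>2" by (simp add: power2_diff)
    then show "norm (2 * z / (1 + z\<^sup>2)) \<le> 1" using pos by (simp add: abs_mult)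
  qed auto
  then show ?thesis by simp
qed

section \<open>A VMO criterion on the line\<close>

lemma set_integral_oscillation_add:
  fixes v g :: "real \<Rightarrow> real"
  assumes A: "A \<in> lmeasurable" and v: "set_integrable lebesgue A v" and g: "g \<in> borel_measurable lebesgue"
    and bd: "\<And>x. x \<in> A \<Longrightarrow> \<bar>g x - d\<bar> \<le> B" and le: "(LINT x:A|lebesgue. \<bar>v x - c\<bar>) \<le> X"
  shows "set_integrable lebesgue A (\<lambda>x. v x + g x)"
    and "(LINT x:A|lebesgue. \<bar>v x + g x - (c + d)\<bar>) \<le> X + B * measure lebesgue A"
proof -
  have "\<bar>g x\<bar> \<le> (\<bar>d\<bar> + B) * \<bar>1\<bar>" if "x \<in> A" for x
    using bd[OF that] by simp
  then have gi: "set_integrable lebesgue A g"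
    using A g set_integrable_bound_mult[OF set_integral_const_lebesgue(1)[OF A, of 1] fmeasurableD[OF A] g] by blast
  then show *: "set_integrable lebesgue A (\<lambda>x. v x + g x)" using v by (rule set_integral_add(1)[rotated])
  have "(LINT x:A|lebesgue. \<bar>v x + g x - (c + d)\<bar>) \<le> (LINT x:A|lebesgue. \<bar>v x - c\<bar> + B)"
  proof (rule set_integral_mono)
    show "set_integrable lebesgue A (\<lambda>x. \<bar>v x + g x - (c + d)\<bar>)"
      using * A by (rule set_integrable_abs_diff_const)
    show "set_integrable lebesgue A (\<lambda>x. \<bar>v x - c\<bar> + B)"
      using v A by (intro set_integral_add set_integrable_abs_diff_const set_integral_const_lebesgue)
    show "\<bar>v x + g x - (c + d)\<bar> \<le> \<bar>v x - c\<bar> + B" if "x \<in> A" for x using bd[OF that] by linarith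
  qed
  also have "\<dots> = (LINT x:A|lebesgue. \<bar>v x - c\<bar>) + B * measure lebesgue A"
    using v A by (subst set_integral_add(2)) (auto simp: set_integral_const_lebesgue intro!: set_integrable_abs_diff_const)
  finally show "(LINT x:A|lebesgue. \<bar>v x + g x - (c + d)\<bar>) \<le> X + B * measure lebesgue A" using le by linarith
qed

text \<open>Here v is a function on the circle read in the coordinate of the line, so its
  oscillations carry the weight \<open>line_density\<close>; g is a correction of bounded
  oscillation on tame intervals and annuli, uniformly continuous on the line. On a tame interval the
  weight is constant up to a factor 5, and the annulus from R to 4 R is a fixed share of the arc
  given by \<open>tail R\<close>. With v = 0 the criterion also serves the counterexample.\<close>

lemma VMO_line_criterion:
  fixes v g :: "real \<Rightarrow> real"
  assumes v: "v \<in> borel_measurable lebesgue" "integrable lebesgue (\<lambda>x. line_density x * v x)"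
    and v_Icc: "\<And>a b. a < b \<Longrightarrow> \<exists>c. (LINT x:{a..b}|lebesgue. line_density x * \<bar>v x - c\<bar>) \<le> K * (LINT x:{a..b}|lebesgue. line_density x)"
    and v_tail: "\<And>R. 1 \<le> R \<Longrightarrow> \<exists>c. (LINT x:tail R|lebesgue. line_density x * \<bar>v x - c\<bar>) \<le> K * (LINT x:tail R|lebesgue. line_density x)"
    and v_small: "\<And>e. 0 < e \<Longrightarrow> \<exists>d>0. \<forall>a b. a < b \<and> (LINT x:{a..b}|lebesgue. line_density x) < d \<longrightarrow>
        (\<exists>c. (LINT x:{a..b}|lebesgue. line_density x * \<bar>v x - c\<bar>) \<le> e * (LINT x:{a..b}|lebesgue. line_density x))"
    and g: "g \<in> borel_measurable lebesgue"
    and g_tame: "\<And>a b. a < b \<Longrightarrow> tame a b \<Longrightarrow> \<exists>d. \<forall>x\<in>{a..b}. \<bar>g x - d\<bar> \<le> B"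
    and g_annulus: "\<And>R. 1 \<le> R \<Longrightarrow> \<exists>d. \<forall>x. R \<le> \<bar>x\<bar> \<and> \<bar>x\<bar> \<le> 4 * R \<longrightarrow> \<bar>g x - d\<bar> \<le> B"
    and g_small: "\<And>e. 0 < e \<Longrightarrow> \<exists>d>0. \<forall>x y. \<bar>x - y\<bar> < d \<longrightarrow> \<bar>g x - g y\<bar> \<le> e"
    and K: "0 \<le> K" and B: "0 \<le> B"
  shows "(\<lambda>x. v x + g x) \<in> VMO lebesgue intervals"
proof -
  have vr: "set_integrable lebesgue A (\<lambda>x. line_density x * v x)" if "A \<in> sets lebesgue" for A
    using that v(2) unfolding set_integrable_def by (rule integrable_mult_indicator)
  have vrc: "set_integrable lebesgue A (\<lambda>x. line_density x * \<bar>v x - c\<bar>)" if A: "A \<in> sets lebesgue" for A c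
  proof -
    have "set_integrable lebesgue A (\<lambda>x. \<bar>line_density x * v x - c * line_density x\<bar>)"
      using A by (intro set_integrable_abs set_integral_diff(1) vr set_integrable_mult_right set_integrable_line_density) auto
    moreover have "\<bar>line_density x * v x - c * line_density x\<bar> = line_density x * \<bar>v x - c\<bar>" for x
      using abs_mult[of "line_density x" "v x - c"] line_density_pos[of x] by (simp add: algebra_simps)
    ultimately show ?thesis by simp
  qed
  have vi_bounded: "set_integrable lebesgue A v" if A: "A \<in> sets lebesgue" "A \<subseteq> {-r..r}" for A r
  proof (rule set_integrable_bound_mult[OF vr[OF A(1)] A(1) v(1)])
    fix x assume "x \<in> A"
    then have "\<bar>x\<bar> \<le> \<bar>r\<bar>" using A(2) by (auto simp: abs_le_iff)
    then have "2 / (1 + r\<^sup>2) \<le> line_density x" using line_density_bounds(1)[of 0 x "\<bar>r\<bar>"] by simp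
    then have "1 \<le> (1 + r\<^sup>2) / 2 * line_density x" by (simp add: field_simps add_pos_nonneg)
    then have "1 * \<bar>v x\<bar> \<le> (1 + r\<^sup>2) / 2 * line_density x * \<bar>v x\<bar>" by (rule mult_right_mono) simp
    then show "\<bar>v x\<bar> \<le> (1 + r\<^sup>2) / 2 * \<bar>line_density x * v x\<bar>"
      using line_density_pos[of x] by (simp add: abs_mult mult.assoc)
  qed
  have vi: "set_integrable lebesgue {a..b} v" for a b
    by (rule vi_bounded[of _ "max \<bar>a\<bar> \<bar>b\<bar>"]) auto
  have tame_v: "(LINT x:{a..b}|lebesgue. \<bar>v x - c\<bar>) \<le> 5 * e * (b - a)"
    if ab: "a < b" "tame a b" and le: "(LINT x:{a..b}|lebesgue. line_density x * \<bar>v x - c\<bar>) \<le> e * (LINT x:{a..b}|lebesgue. line_density x)"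
      and e: "0 \<le> e" for a b c e
  proof -
    obtain m where m: "0 < m" "\<And>x. x \<in> {a..b} \<Longrightarrow> m \<le> line_density x \<and> line_density x \<le> 5 * m"
      using ab(2) by (rule tame_line_density) blast
    have "(LINT x:{a..b}|lebesgue. \<bar>v x - c\<bar>) \<le> (1/m) * (LINT x:{a..b}|lebesgue. line_density x * \<bar>v x - c\<bar>)"
    proof (rule set_integral_le_cmult)
      show "set_integrable lebesgue {a..b} (\<lambda>x. \<bar>v x - c\<bar>)" by (rule set_integrable_abs_diff_const[OF vi]) simp
      show "set_integrable lebesgue {a..b} (\<lambda>x. line_density x * \<bar>v x - c\<bar>)" by (rule vrc) simp
      fix x assume "x \<in> {a..b}"
      then have "m * \<bar>v x - c\<bar> \<le> line_density x * \<bar>v x - c\<bar>" using m(2) by (intro mult_right_mono) auto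
      then show "\<bar>v x - c\<bar> \<le> 1 / m * (line_density x * \<bar>v x - c\<bar>)" using m(1) by (simp add: field_simps)
    qed
    also have "\<dots> \<le> (1/m) * (e * (5 * m * measure lebesgue {a..b}))"
      using m e by (intro mult_left_mono order_trans[OF le] LINT_line_density_le) auto
    also have "\<dots> = 5 * e * (b - a)" using m(1) ab(1) by simp
    finally show ?thesis .
  qed
  have li: "locally_integrable lebesgue intervals (\<lambda>x. v x + g x)"
    unfolding locally_integrable_def
  proof (intro conjI ballI)
    show "(\<lambda>x. v x + g x) \<in> borel_measurable lebesgue" using v(1) g by (rule borel_measurable_add)
    fix I assume "I \<in> intervals"
    then obtain a b where I: "I = {a..b}" by (auto simp: intervals_def)
    have "continuous_on {a..b} g"
      unfolding continuous_on_iff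
    proof (intro ballI allI impI)
      fix x e :: real assume "0 < e"
      then obtain d where d: "0 < d" "\<And>x y. \<bar>x - y\<bar> < d \<Longrightarrow> \<bar>g x - g y\<bar> \<le> e / 2"
        using g_small[of "e/2"] by auto
      show "\<exists>d>0. \<forall>x'\<in>{a..b}. dist x' x < d \<longrightarrow> dist (g x') (g x) < e"
      proof (intro exI[of _ d] conjI ballI impI d(1))
        fix y assume "dist y x < d"
        then show "dist (g y) (g x) < e" using d(2)[of y x] \<open>0 < e\<close> by (simp add: dist_real_def)
      qed
    qed
    then have "set_integrable lebesgue {a..b} g"
      by (intro absolutely_integrable_continuous_real)
    then show "set_integrable lebesgue I (\<lambda>x. v x + g x)"
      unfolding I using vi by (intro set_integral_add) auto
  qed
  have "(\<lambda>x. v x + g x) \<in> BMO lebesgue intervals"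
  proof (rule BMO_line_criterion[OF li])
    fix a b :: real assume ab: "a < b" "tame a b"
    obtain c where c: "(LINT x:{a..b}|lebesgue. line_density x * \<bar>v x - c\<bar>) \<le> K * (LINT x:{a..b}|lebesgue. line_density x)"
      using v_Icc[OF ab(1)] by blast
    obtain d where d: "\<And>x. x \<in> {a..b} \<Longrightarrow> \<bar>g x - d\<bar> \<le> B" using g_tame[OF ab] by blast
    have "(LINT x:{a..b}|lebesgue. \<bar>v x + g x - (c + d)\<bar>) \<le> 5 * K * (b - a) + B * measure lebesgue {a..b}"
      using d by (intro set_integral_oscillation_add(2) vi g tame_v[OF ab c K]) auto
    also have "\<dots> = (5 * K + B) * (b - a)" using ab by (simp add: algebra_simps)
    also have "\<dots> \<le> (34 * K + 6 * B) * (b - a)" using ab K B by (intro mult_right_mono) auto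
    finally show "\<exists>c. (LINT x:{a..b}|lebesgue. \<bar>v x + g x - c\<bar>) \<le> (34 * K + 6 * B) * (b - a)" by blast
  next
    fix R :: real assume R: "1 \<le> R"
    let ?A = "{x. R \<le> \<bar>x\<bar> \<and> \<bar>x\<bar> \<le> 4 * R}"
    have A: "?A \<in> lmeasurable" using R by (intro annulus_lmeasurable) auto
    have Asub: "?A \<subseteq> {-(4*R)..4*R}" by (auto simp: abs_le_iff)
    have viA: "set_integrable lebesgue ?A v" using fmeasurableD[OF A] Asub by (rule vi_bounded)
    obtain c where c: "(LINT x:tail R|lebesgue. line_density x * \<bar>v x - c\<bar>) \<le> K * (LINT x:tail R|lebesgue. line_density x)"
      using v_tail[OF R] by blast
    obtain d where d: "\<And>x. x \<in> ?A \<Longrightarrow> \<bar>g x - d\<bar> \<le> B" using g_annulus[OF R] by blast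
    \<comment> \<open>17 R^2 / 2 bounds the reciprocal of the density on the annulus, since 1 + (4
      R)^2 <= 17 R^2 for R >= 1.\<close>
    have "(LINT x:?A|lebesgue. \<bar>v x - c\<bar>) \<le> (17 * R\<^sup>2 / 2) * (LINT x:?A|lebesgue. line_density x * \<bar>v x - c\<bar>)"
    proof (rule set_integral_le_cmult)
      show "set_integrable lebesgue ?A (\<lambda>x. \<bar>v x - c\<bar>)" by (rule set_integrable_abs_diff_const[OF viA A])
      show "set_integrable lebesgue ?A (\<lambda>x. line_density x * \<bar>v x - c\<bar>)" by (rule vrc[OF fmeasurableD[OF A]])
      fix x assume "x \<in> ?A"
      then have "2 / (1 + (4 * R)\<^sup>2) \<le> line_density x" using R by (intro line_density_bounds(1)[of 0]) auto
      moreover have "2 / (17 * R\<^sup>2) \<le> 2 / (1 + (4 * R)\<^sup>2)"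
        using R by (intro divide_left_mono) (auto simp: power_mult_distrib add_pos_nonneg)
      ultimately have "17 * R\<^sup>2 / 2 * (2 / (17 * R\<^sup>2)) \<le> 17 * R\<^sup>2 / 2 * line_density x"
        by (intro mult_left_mono) auto
      then have "1 \<le> 17 * R\<^sup>2 / 2 * line_density x" using R by simp
      then have "1 * \<bar>v x - c\<bar> \<le> 17 * R\<^sup>2 / 2 * line_density x * \<bar>v x - c\<bar>" by (rule mult_right_mono) simp
      then show "\<bar>v x - c\<bar> \<le> 17 * R\<^sup>2 / 2 * (line_density x * \<bar>v x - c\<bar>)" by (simp only: mult_1 mult.assoc)
    qed
    also have "\<dots> \<le> (17 * R\<^sup>2 / 2) * (LINT x:tail R|lebesgue. line_density x * \<bar>v x - c\<bar>)"
      using line_density_pos fmeasurableD[OF A]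
      by (intro mult_left_mono set_integral_mono_set_nonneg vrc) (auto simp: tail_def less_imp_le)
    also have "\<dots> \<le> (17 * R\<^sup>2 / 2) * (K * (4 / R))"
      using K R LINT_line_density_tail_bounds(2)[OF R] by (intro mult_left_mono order_trans[OF c]) auto
    also have "\<dots> = 34 * K * R" using R by (simp add: power2_eq_square)
    finally have "(LINT x:?A|lebesgue. \<bar>v x - c\<bar>) \<le> 34 * K * R" .
    then have "(LINT x:?A|lebesgue. \<bar>v x + g x - (c + d)\<bar>) \<le> 34 * K * R + B * measure lebesgue ?A"
      using d by (intro set_integral_oscillation_add(2)[OF A viA g]) auto
    also have "\<dots> = (34 * K + 6 * B) * R" using measure_annulus[of R "4 * R"] R by (simp add: algebra_simps)
    finally show "\<exists>c. (LINT x:?A|lebesgue. \<bar>v x + g x - c\<bar>) \<le> (34 * K + 6 * B) * R" by blast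
  qed
  moreover have "\<exists>\<delta>>0. \<forall>I\<in>intervals. measure lebesgue I < \<delta> \<longrightarrow> mean_oscillation lebesgue I (\<lambda>x. v x + g x) < \<epsilon>"
    if "0 < \<epsilon>" for \<epsilon>
  proof -
    \<comment> \<open>The final bound is 2 (5 e + e) = 12 e, and the inequality has to be
      strict.\<close>
    define e where "e = \<epsilon> / 13"
    have e: "0 < e" using that by (simp add: e_def)
    obtain d1 where d1: "0 < d1" "\<And>a b. a < b \<Longrightarrow> (LINT x:{a..b}|lebesgue. line_density x) < d1 \<Longrightarrow>
        \<exists>c. (LINT x:{a..b}|lebesgue. line_density x * \<bar>v x - c\<bar>) \<le> e * (LINT x:{a..b}|lebesgue. line_density x)"
      using v_small[OF e] by blast
    obtain d2 where d2: "0 < d2" "\<And>x y. \<bar>x - y\<bar> < d2 \<Longrightarrow> \<bar>g x - g y\<bar> \<le> e"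
      using g_small[OF e] by blast
    have "mean_oscillation lebesgue I (\<lambda>x. v x + g x) < \<epsilon>"
      if I: "I \<in> intervals" "measure lebesgue I < min (min (d1 / 2) d2) 1" for I
    proof -
      obtain a b where ab: "I = {a..b}" "a < b" using I by (auto simp: intervals_def)
      have small: "b - a < d1 / 2" "b - a < d2" "b - a < 1" using I(2) ab by auto
      obtain a' b' where "tame a' b'" "a' \<le> a" "b \<le> b'" 
        using tame_enclosing[OF ab(2) less_imp_le[OF small(3)]] by blast
      then have tame: "tame a b" by (rule tame_subset)
      \<comment> \<open>As \<open>line_density\<close> is at most 2, short intervals have short
        images on the circle.\<close>
      have "(LINT x:{a..b}|lebesgue. line_density x) \<le> 2 * measure lebesgue {a..b}"
        by (intro LINT_line_density_le) (auto simp: line_density_def divide_le_eq add_pos_nonneg)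
      then have "(LINT x:{a..b}|lebesgue. line_density x) < d1" using small ab by simp
      then obtain c where c: "(LINT x:{a..b}|lebesgue. line_density x * \<bar>v x - c\<bar>) \<le> e * (LINT x:{a..b}|lebesgue. line_density x)"
        using d1(2) ab by blast
      have "(LINT x:{a..b}|lebesgue. \<bar>v x + g x - (c + g a)\<bar>) \<le> 5 * e * (b - a) + e * measure lebesgue {a..b}"
        using e small d2(2) by (intro set_integral_oscillation_add(2) vi g tame_v[OF ab(2) tame c]) auto
      also have "\<dots> = 6 * e * measure lebesgue {a..b}" using ab by simp
      finally have "mean_oscillation lebesgue {a..b} (\<lambda>x. v x + g x) \<le> 2 * (6 * e)"
        using li I(1) ab by (intro mean_oscillation_le[of lebesgue "{a..b}" _ "c + g a"]) (auto simp: locally_integrable_def)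
      then show ?thesis using that ab e by (simp add: e_def)
    qed
    moreover have "0 < min (min (d1 / 2) d2) 1" using d1 d2 by simp
    ultimately show ?thesis by blast
  qed
  ultimately show ?thesis by (simp add: VMO_def)
qed

section \<open>From the circle to the line\<close>

text \<open>Lets the complex chain rule act along the circle: the circle map is
  \<open>cayley\<close> after h after the inverse Cayley map, and the middle map is differentiated
  only along the real axis.\<close>

lemma has_field_derivative_of_real_Reals:
  assumes "(h has_real_derivative d) (at x)"
  shows "((\<lambda>y::complex. complex_of_real (h (Re y))) has_field_derivative of_real d) (at (of_real x) within \<real>)"
  unfolding has_field_derivative_iff Lim_within
proof (intro allI impI)
  fix e :: real assume "0 < e"
  then obtain s where s: "0 < s" "\<And>y. y \<noteq> x \<Longrightarrow> \<bar>y - x\<bar> < s \<Longrightarrow> \<bar>(h y - h x) / (y - x) - d\<bar> < e"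
    using assms unfolding has_field_derivative_iff LIM_def dist_real_def by metis
  show "\<exists>s>0. \<forall>y\<in>\<real>. 0 < dist y (of_real x) \<and> dist y (of_real x) < s \<longrightarrow>
     dist ((complex_of_real (h (Re y)) - of_real (h (Re (of_real x)))) / (y - of_real x)) (of_real d) < e"
  proof (intro exI[of _ s] conjI ballI impI s(1))
    fix y :: complex assume "y \<in> \<real>" and y: "0 < dist y (of_real x) \<and> dist y (of_real x) < s"
    then obtain r where r: "y = of_real r" by (auto elim: Reals_cases)
    have "r \<noteq> x" "\<bar>r - x\<bar> < s" using y unfolding r dist_of_real dist_real_def by auto
    then have "\<bar>(h r - h x) / (r - x) - d\<bar> < e" by (rule s(2))
    moreover have "(complex_of_real (h (Re y)) - of_real (h (Re (of_real x)))) / (y - of_real x) = of_real ((h r - h x) / (r - x))"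
      unfolding r by simp
    ultimately show "dist ((complex_of_real (h (Re y)) - of_real (h (Re (of_real x)))) / (y - of_real x)) (of_real d) < e"
      by (simp only: dist_of_real dist_real_def)
  qed
qed

text \<open>Chain rule relative to the circle: the derivative of the Cayley map at h x has modulus
  \<open>line_density (h x)\<close>, that of its inverse at z has modulus 1 /
  \<open>line_density x\<close>. Removing the point 1 does not affect the limit at z.\<close>

lemma norm_circle_deriv:
  assumes conj: "\<And>x. \<phi> (cayley_line x) = cayley_line (h x)"
    and h: "(h has_real_derivative d) (at x)"
  shows "norm (circle_deriv \<phi> (cayley_line x)) = \<bar>d\<bar> * line_density (h x) / line_density x"
proof -
  define z where "z = cayley_line x"
  define S where "S = (\<lambda>w::complex. \<i> * (1 + w) / (1 - w))"
  define A where "A = sphere (0::complex) 1 - {1}"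
  have z: "norm z = 1" "z \<noteq> 1" by (auto simp: z_def cayley_line_neq_1)
  have Sz: "S z = of_real x" using of_real_line_of_circle[OF z] by (simp add: S_def z_def)
  have SR: "S w = of_real (line_of_circle w)" if "w \<in> A" for w
    using of_real_line_of_circle[of w] that by (auto simp: S_def A_def)
  have dS: "(S has_field_derivative 2 * \<i> / (1 - z)\<^sup>2) (at z within A)"
    unfolding S_def using z by (auto intro!: derivative_eq_intros simp: power2_eq_square field_simps)
  have "S ` A \<subseteq> \<real>" using SR by auto
  then have dk: "((\<lambda>y::complex. complex_of_real (h (Re y))) has_field_derivative of_real d) (at (S z) within S ` A)"
    unfolding Sz by (rule DERIV_subset[OF has_field_derivative_of_real_Reals[OF h]])
  have nz: "complex_of_real (h x) + \<i> \<noteq> 0" by (rule real_plus_i_nonzero)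
  have dc: "(cayley has_field_derivative 2 * \<i> / (of_real (h x) + \<i>)\<^sup>2) (at (of_real (h x)))"
    unfolding cayley_def[abs_def] using nz
    by (auto intro!: derivative_eq_intros simp: power2_eq_square field_simps)
  define D where "D = 2 * \<i> / (of_real (h x) + \<i>)\<^sup>2 * (of_real d * (2 * \<i> / (1 - z)\<^sup>2))"
  have comp: "(cayley \<circ> ((\<lambda>y::complex. complex_of_real (h (Re y))) \<circ> S) has_field_derivative D) (at z within A)"
    unfolding D_def
  proof (rule DERIV_chain)
    show "(cayley has_field_derivative 2 * \<i> / (of_real (h x) + \<i>)\<^sup>2) (at (((\<lambda>y::complex. complex_of_real (h (Re y))) \<circ> S) z))"
      using dc by (simp add: Sz)
  qed (rule DERIV_image_chain[OF dk dS])
  have eq: "(cayley \<circ> ((\<lambda>y::complex. complex_of_real (h (Re y))) \<circ> S)) w = \<phi> w" if "w \<in> A" for w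
  proof -
    have "\<phi> w = cayley_line (h (line_of_circle w))"
      using conj[of "line_of_circle w"] cayley_line_line_of_circle[of w] that by (auto simp: A_def)
    then show ?thesis using SR[OF that] by simp
  qed
  have zA: "z \<in> A" using z by (simp add: A_def)
  have "(\<phi> has_field_derivative D) (at z within A)"
    by (rule has_field_derivative_transform_within[OF comp zero_less_one zA eq])
  moreover have "at z within A = at z within sphere 0 1"
    using z by (intro at_within_nhd[of z "- {1}"]) (auto simp: A_def)
  ultimately have d: "(\<phi> has_field_derivative D) (at z within sphere 0 1)" by simp
  \<comment> \<open>\<open>circle_deriv\<close> picks some derivative; it is determined because the
    circle has no isolated points.\<close>
  have "z islimpt sphere 0 1"
  proof (rule connected_imp_perfect)
    show "connected (sphere (0::complex) 1)" by (intro connected_sphere) simp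
    have "(1::complex) \<in> sphere 0 1" "(-1::complex) \<in> sphere 0 1" "(1::complex) \<noteq> -1" by auto
    then show "sphere (0::complex) 1 \<noteq> {x}" for x by (metis singletonD)
  qed (use z in auto)
  then have "at z within sphere 0 1 \<noteq> bot" by (simp add: trivial_limit_within)
  then have uniq: "D' = D" if "(\<phi> has_field_derivative D') (at z within sphere 0 1)" for D'
    using that d unfolding has_field_derivative_iff by (blast intro: tendsto_unique)
  have "circle_deriv \<phi> z = D" unfolding circle_deriv_def by (rule some_equality) (rule d, rule uniq)
  moreover have "norm D = \<bar>d\<bar> * line_density (h x) / line_density x"
  proof -
    have sq: "(cmod (of_real y + \<i>))\<^sup>2 = 1 + y\<^sup>2" for y by (simp add: cmod_power2)
    have "1 - z = 2 * \<i> / (of_real x + \<i>)"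
      using real_plus_i_nonzero[of x] by (simp add: z_def cayley_def field_simps)
    then have "(cmod (1 - z))\<^sup>2 = 4 / (1 + x\<^sup>2)" by (simp add: norm_divide power_divide sq)
    moreover have "1 + (h x)\<^sup>2 \<noteq> 0" "1 + x\<^sup>2 \<noteq> 0" by (auto simp: add_nonneg_eq_0_iff)
    ultimately show ?thesis unfolding D_def line_density_def
      by (simp only: norm_mult norm_divide norm_power sq norm_of_real norm_ii norm_numeral) (simp add: divide_simps, simp add: algebra_simps)
  qed
  ultimately show ?thesis unfolding z_def by simp
qed

section \<open>The conjugated homeomorphism of the line\<close>

lemma arctan_Lipschitz: "\<bar>arctan x - arctan y\<bar> \<le> \<bar>x - y\<bar>"
proof -
  have "norm (arctan x - arctan y) \<le> 1 * norm (x - y)"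
  proof (rule field_differentiable_bound[of UNIV arctan "\<lambda>x. inverse (1 + x\<^sup>2)"])
    show "norm (inverse (1 + z\<^sup>2)) \<le> 1" for z :: real by (simp add: inverse_le_1_iff add_pos_nonneg)
  qed (auto intro!: derivative_eq_intros)
  then show ?thesis by simp
qed

text \<open>The chordal distance formula. As h is bounded on bounded intervals, it estimates
  increments of h there by increments of the circle map.\<close>

lemma cayley_line_diff: "dist (cayley_line x) (cayley_line y) * (sqrt (1 + x\<^sup>2) * sqrt (1 + y\<^sup>2)) = 2 * \<bar>x - y\<bar>"
proof -
  have n: "cmod (of_real x + \<i>) = sqrt (1 + x\<^sup>2)" for x by (simp add: cmod_def)
  have "((a - 2 * \<i>) / a - (b - 2 * \<i>) / b) * (a * b) = 2 * \<i> * (a - b)" if "a \<noteq> 0" "b \<noteq> 0" for a b :: complex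
    using that by (simp add: field_simps)
  from this[OF real_plus_i_nonzero[of x] real_plus_i_nonzero[of y]]
  have "(cayley_line x - cayley_line y) * ((of_real x + \<i>) * (of_real y + \<i>)) = 2 * \<i> * of_real (x - y)"
    by (simp add: cayley_def)
  then have "cmod ((cayley_line x - cayley_line y) * ((of_real x + \<i>) * (of_real y + \<i>))) = cmod (2 * \<i> * of_real (x - y))"
    by simp
  then show ?thesis by (simp only: norm_mult n dist_norm norm_of_real) simp
qed

locale circle_homeomorphism =
  fixes \<phi> :: "complex \<Rightarrow> complex"
  assumes homeo: "\<exists>\<psi>. homeomorphism (sphere 0 1) (sphere 0 1) \<phi> \<psi>"
    and winding: "winding_number (\<phi> \<circ> circlepath 0 1) 0 = 1"
    and fixed: "\<phi> 1 = 1"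
begin

abbreviation "h \<equiv> to_line \<phi>"

lemma continuous: "continuous_on (sphere 0 1) \<phi>"
  and image: "\<phi> ` sphere 0 1 = sphere 0 1"
  and inj: "inj_on \<phi> (sphere 0 1)"
proof -
  obtain \<psi> where "homeomorphism (sphere 0 1) (sphere 0 1) \<phi> \<psi>" using homeo by blast
  then show "continuous_on (sphere 0 1) \<phi>" "\<phi> ` sphere 0 1 = sphere 0 1" "inj_on \<phi> (sphere 0 1)"
    unfolding homeomorphism_def by (auto intro: inj_on_inverseI[of _ \<psi> \<phi>])
qed

lemma norm_\<phi>: "norm z = 1 \<Longrightarrow> norm (\<phi> z) = 1"
  using image by (auto simp: set_eq_iff)

lemma \<phi>_neq_1: "norm z = 1 \<Longrightarrow> z \<noteq> 1 \<Longrightarrow> \<phi> z \<noteq> 1"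
  using inj fixed by (metis inj_on_contraD mem_sphere_0 norm_one)

lemma h_eq: "h x = line_of_circle (\<phi> (cayley_line x))"
  unfolding to_line_def by (intro inv_cayley_line norm_\<phi> \<phi>_neq_1) (auto simp: cayley_line_neq_1)

lemma conj: "\<phi> (cayley_line x) = cayley_line (h x)"
  unfolding h_eq by (intro cayley_line_line_of_circle[symmetric] norm_\<phi> \<phi>_neq_1) (auto simp: cayley_line_neq_1)

lemma surj_h: "surj h"
  unfolding surj_def
proof
  fix y
  have "cayley_line y \<in> \<phi> ` sphere 0 1" unfolding image by simp
  then obtain z where z: "norm z = 1" "cayley_line y = \<phi> z" by auto
  have "z \<noteq> 1" using z fixed cayley_line_neq_1[of y] by auto
  then have "cayley_line (line_of_circle z) = z" using z by (intro cayley_line_line_of_circle)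
  then have "cayley_line (h (line_of_circle z)) = cayley_line y" using z conj by metis
  then show "\<exists>x. y = h x" using inj_cayley_line by (metis injD)
qed

text \<open>Sense preservation enters here: the continuous argument of \<open>\<phi> (cis t)\<close> is injective on a
  period, hence monotone, and its total increment is \<open>2 \<pi>\<close> times the winding number.\<close>

lemma strict_mono_h: "strict_mono h"
proof -
  let ?p = "\<phi> \<circ> circlepath 0 1"
  have cp: "circlepath 0 1 t = cis (2 * pi * t)" for t
    by (simp add: circlepath cis_conv_exp mult_ac)
  have "path ?p"
    unfolding path_def
  proof (rule continuous_on_compose)
    show "continuous_on {0..1} (circlepath 0 1)" using path_circlepath unfolding path_def by blast
    show "continuous_on (circlepath 0 1 ` {0..1}) \<phi>"
      by (rule continuous_on_subset[OF continuous]) (auto simp: cp)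
  qed
  moreover have "0 \<notin> path_image ?p"
  proof
    assume "0 \<in> path_image ?p"
    then obtain t where "\<phi> (cis (2 * pi * t)) = 0" by (auto simp: path_image_def cp)
    then show False using norm_\<phi>[of "cis (2 * pi * t)"] by simp
  qed
  ultimately obtain q where q: "path q"
      "pathfinish q - pathstart q = 2 * of_real pi * \<i> * winding_number ?p 0"
      "\<And>t. t \<in> {0..1} \<Longrightarrow> ?p t = 0 + exp (q t)"
    by (rule winding_number_as_continuous_log) blast
  define \<eta> where "\<eta> t = Im (q t)" for t
  have \<eta>: "\<phi> (cis (2 * pi * t)) = cis (\<eta> t)" if t: "t \<in> {0..1}" for t
  proof -
    have eq: "\<phi> (cis (2 * pi * t)) = exp (q t)" using q(3)[OF t] by (simp add: cp)
    then have "exp (Re (q t)) = 1" using norm_\<phi>[of "cis (2 * pi * t)"] by simp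
    then show ?thesis unfolding eq \<eta>_def exp_eq_polar by simp
  qed
  have \<eta>01: "\<eta> 1 - \<eta> 0 = 2 * pi"
    using arg_cong[OF q(2), of Im] winding by (simp add: \<eta>_def pathfinish_def pathstart_def)
  have cont: "continuous_on {0..1} \<eta>"
    using q(1) unfolding path_def \<eta>_def by (intro continuous_intros)
  have inj\<eta>: "inj_on \<eta> {0..1}"
  proof (rule linorder_inj_onI')
    fix s t :: real assume st: "s \<in> {0..1}" "t \<in> {0..1}" "s < t"
    show "\<eta> s \<noteq> \<eta> t"
    proof
      assume eq: "\<eta> s = \<eta> t"
      then have "\<phi> (cis (2 * pi * s)) = \<phi> (cis (2 * pi * t))" using \<eta> st by simp
      then have "cis (2 * pi * t) = cis (2 * pi * s)" using inj by (simp add: inj_on_def)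
      then obtain n :: int where "2 * pi * t = 2 * pi * s + 2 * pi * of_int n" unfolding cis_eq_cis_iff by blast
      then have "2 * pi * (t - s - of_int n) = 0" by (simp add: algebra_simps)
      then have n: "t - s = of_int n" by simp
      then have "0 < n" "n \<le> 1" using st by (auto simp: of_int_le_1_iff[symmetric] of_int_0_less_iff[symmetric, where 'a = real] simp del: of_int_0_less_iff of_int_le_1_iff)
      then have "n = 1" by simp
      then have "s = 0" "t = 1" using n st by auto
      then show False using eq \<eta>01 by simp
    qed
  qed
  have mono\<eta>: "\<eta> s < \<eta> t" if "s \<in> {0..1}" "t \<in> {0..1}" "s < t" for s t
  proof -
    have "strict_mono_on {0..1} \<eta> \<or> strict_antimono_on {0..1} \<eta>"
      using injective_eq_monotone_map[of "{0..1}" \<eta>] cont inj\<eta> by auto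
    moreover have "\<not> strict_antimono_on {0..1} \<eta>"
    proof
      assume "strict_antimono_on {0..1} \<eta>"
      then have "\<eta> 1 < \<eta> 0" by (rule monotone_onD) auto
      then show False using \<eta>01 pi_gt_zero by linarith
    qed
    ultimately have "strict_mono_on {0..1} \<eta>" by blast
    then show ?thesis using that by (rule strict_mono_onD)
  qed
  have "cis (\<eta> 0) = cis 0" using \<eta>[of 0] fixed by simp
  then obtain k :: int where k: "\<eta> 0 = 2 * pi * of_int k" unfolding cis_eq_cis_iff by auto
  define T where "T x = (pi + 2 * arctan x) / (2 * pi)" for x
  have T: "0 < T x" "T x < 1" for x using arctan_bounded[of x] by (auto simp: T_def field_simps)
  \<comment> \<open>Both sides lie in (0, 2 pi) and are arguments of the same point, so they
    coincide.\<close>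
  have arctan_h: "pi + 2 * arctan (h x) = \<eta> (T x) - \<eta> 0" for x
  proof -
    have "cis (pi + 2 * arctan (h x)) = cis (\<eta> (T x))"
      using conj[of x] \<eta>[of "T x"] T[of x] by (simp add: cayley_line_eq_cis T_def)
    then obtain n :: int where n: "pi + 2 * arctan (h x) = \<eta> (T x) + 2 * pi * of_int n"
      unfolding cis_eq_cis_iff by blast
    have "\<eta> 0 < \<eta> (T x)" "\<eta> (T x) < \<eta> 1" using mono\<eta> T[of x] by auto
    then have "0 < \<eta> (T x) - \<eta> 0" "\<eta> (T x) - \<eta> 0 < 2 * pi" using \<eta>01 by auto
    moreover have "0 < pi + 2 * arctan (h x)" "pi + 2 * arctan (h x) < 2 * pi" using arctan_bounded[of "h x"] by auto
    ultimately have "2 * pi * (of_int n + of_int k) < 2 * pi * 1" "2 * pi * (- 1) < 2 * pi * (of_int n + of_int k)"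
      using n k by (simp_all add: algebra_simps)
    then have "real_of_int n + real_of_int k < 1" "- 1 < real_of_int n + real_of_int k"
      by (auto simp only: mult_less_cancel_left_pos[OF mult_pos_pos[OF zero_less_numeral pi_gt_zero]])
    then have "n + k = 0" by linarith
    then have "real_of_int n = - real_of_int k" by linarith
    then show ?thesis using n k by simp
  qed
  show ?thesis
  proof (rule strict_monoI)
    fix x y :: real assume "x < y"
    then have "T x < T y" by (simp add: T_def divide_strict_right_mono arctan_less_iff)
    then have "\<eta> (T x) < \<eta> (T y)" using T[of x] T[of y] by (intro mono\<eta>) auto
    then have "arctan (h x) < arctan (h y)" using arctan_h[of x] arctan_h[of y] by linarith
    then show "h x < h y" by (simp add: arctan_less_iff)
  qed
qed

lemma continuous_h: "continuous_on UNIV h"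
proof -
  have "continuous_on UNIV cayley_line"
    unfolding cayley_line_eq_cis by (intro continuous_intros)
  then have c: "continuous_on UNIV (\<lambda>x. \<phi> (cayley_line x))"
    by (rule continuous_on_compose2[OF continuous]) auto
  have "continuous_on UNIV (\<lambda>x. line_of_circle (\<phi> (cayley_line x)))"
    unfolding line_of_circle_def
    using \<phi>_neq_1 cayley_line_neq_1 by (intro continuous_intros c) auto
  then show ?thesis by (simp add: h_eq[abs_def])
qed

lemma homeomorphism_h: "\<exists>g. homeomorphism UNIV UNIV h g"
proof -
  have "inj h" using strict_mono_h by (rule strict_mono_imp_inj_on)
  then obtain g where "homeomorphism UNIV (h ` UNIV) h g"
    using invariance_of_domain_homeomorphism[OF open_UNIV continuous_h] by blast
  then show ?thesis using surj_h by auto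
qed

text \<open>Increments of h on {a..b} are at most L times those of the circle map, and the angle T x
  = pi + 2 arctan x is increasing and Lipschitz with constant 2. So disjoint families of small total
  length go to such families of angles.\<close>

lemma absolutely_continuous_h:
  assumes ac: "absolutely_continuous_on {0..2 * pi} (\<lambda>t. \<phi> (cis t))"
  shows "absolutely_continuous_on {a..b} h"
  unfolding absolutely_continuous_on_def
proof (intro allI impI)
  fix \<epsilon> :: real assume \<epsilon>: "0 < \<epsilon>"
  define M where "M = max \<bar>h a\<bar> \<bar>h b\<bar>"
  \<comment> \<open>From the chordal distance formula, where both factors sqrt (1 + h^2) are at most
    sqrt (1 + M^2) on {a..b}.\<close>
  define L where "L = (1 + M\<^sup>2) / 2"
  define T where "T x = pi + 2 * arctan x" for x
  have L: "0 < L" by (simp add: L_def add_pos_nonneg)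
  have Lip: "\<bar>h x - h y\<bar> \<le> L * dist (\<phi> (cis (T x))) (\<phi> (cis (T y)))" if "x \<in> {a..b}" "y \<in> {a..b}" for x y
  proof -
    have bd: "sqrt (1 + (h z)\<^sup>2) \<le> sqrt (1 + M\<^sup>2)" if "z \<in> {a..b}" for z
    proof -
      have "h a \<le> h z" "h z \<le> h b" using that strict_mono_h by (auto simp: strict_mono_less_eq)
      then have "\<bar>h z\<bar> \<le> \<bar>M\<bar>" unfolding M_def by auto
      then show ?thesis by (simp add: abs_le_square_iff)
    qed
    have "2 * \<bar>h x - h y\<bar> = dist (cayley_line (h x)) (cayley_line (h y)) * (sqrt (1 + (h x)\<^sup>2) * sqrt (1 + (h y)\<^sup>2))"
      by (rule cayley_line_diff[symmetric])
    also have "\<dots> \<le> dist (cayley_line (h x)) (cayley_line (h y)) * (sqrt (1 + M\<^sup>2) * sqrt (1 + M\<^sup>2))"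
      using that by (intro mult_left_mono mult_mono bd) auto
    also have "\<dots> = 2 * (L * dist (\<phi> (cis (T x))) (\<phi> (cis (T y))))"
      unfolding conj[symmetric] unfolding cayley_line_eq_cis T_def by (simp add: L_def)
    finally show ?thesis by simp
  qed
  obtain \<delta> where \<delta>: "0 < \<delta>" "\<And>(n::nat) u v. (\<forall>i<n. u i \<le> v i \<and> {u i..v i} \<subseteq> {0..2 * pi}) \<Longrightarrow>
        (\<forall>i<n. \<forall>j<n. i \<noteq> j \<longrightarrow> {u i<..<v i} \<inter> {u j<..<v j} = {}) \<Longrightarrow>
        (\<Sum>i<n. v i - u i) < \<delta> \<Longrightarrow> (\<Sum>i<n. dist (\<phi> (cis (u i))) (\<phi> (cis (v i)))) < \<epsilon> / L"
    using ac divide_pos_pos[OF \<epsilon> L] unfolding absolutely_continuous_on_def by meson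
  show "\<exists>\<delta>>0. \<forall>(n::nat) u v. (\<forall>i<n. u i \<le> v i \<and> {u i..v i} \<subseteq> {a..b}) \<and>
        (\<forall>i<n. \<forall>j<n. i \<noteq> j \<longrightarrow> {u i<..<v i} \<inter> {u j<..<v j} = {}) \<and>
        (\<Sum>i<n. v i - u i) < \<delta> \<longrightarrow> (\<Sum>i<n. dist (h (u i)) (h (v i))) < \<epsilon>"
  proof (intro exI[of _ "\<delta> / 2"] conjI allI impI)
    show "0 < \<delta> / 2" using \<delta> by simp
    fix n :: nat and u v :: "nat \<Rightarrow> real"
    assume *: "(\<forall>i<n. u i \<le> v i \<and> {u i..v i} \<subseteq> {a..b}) \<and>
        (\<forall>i<n. \<forall>j<n. i \<noteq> j \<longrightarrow> {u i<..<v i} \<inter> {u j<..<v j} = {}) \<and> (\<Sum>i<n. v i - u i) < \<delta> / 2"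
    have T_range: "0 < T x" "T x < 2 * pi" for x using arctan_bounded[of x] by (auto simp: T_def)
    have T_mono: "T x \<le> T y \<longleftrightarrow> x \<le> y" "T x < T y \<longleftrightarrow> x < y" for x y
      by (auto simp: T_def arctan_le_iff arctan_less_iff)
    have T_Lip: "T y - T x \<le> 2 * (y - x)" if "x \<le> y" for x y
    proof -
      have "arctan y - arctan x \<le> y - x"
        using arctan_Lipschitz[of y x] that by (simp add: arctan_le_iff abs_of_nonneg)
      then show ?thesis by (simp add: T_def)
    qed
    have "(\<Sum>i<n. dist (\<phi> (cis (T (u i)))) (\<phi> (cis (T (v i))))) < \<epsilon> / L"
    proof (rule \<delta>(2))
      show "\<forall>i<n. T (u i) \<le> T (v i) \<and> {T (u i)..T (v i)} \<subseteq> {0..2 * pi}"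
        using * T_range by (auto simp: T_mono intro: less_imp_le order_trans)
      show "\<forall>i<n. \<forall>j<n. i \<noteq> j \<longrightarrow> {T (u i)<..<T (v i)} \<inter> {T (u j)<..<T (v j)} = {}"
      proof (intro allI impI)
        fix i j assume ij: "i < n" "j < n" "i \<noteq> j"
        have "False" if s: "T (u i) < s" "s < T (v i)" "T (u j) < s" "s < T (v j)" for s
        proof -
          have "0 < s" "s < 2 * pi" using s T_range[of "u i"] T_range[of "v i"] by linarith+
          then have "arctan (tan ((s - pi) / 2)) = (s - pi) / 2" by (intro arctan_tan) auto
          then have "T (tan ((s - pi) / 2)) = s" by (simp add: T_def)
          then have "tan ((s - pi) / 2) \<in> {u i<..<v i} \<inter> {u j<..<v j}" using s T_mono by (metis IntI greaterThanLessThan_iff)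
          then show False using * ij by blast
        qed
        then show "{T (u i)<..<T (v i)} \<inter> {T (u j)<..<T (v j)} = {}"
          unfolding disjoint_iff greaterThanLessThan_iff by blast
      qed
      have "(\<Sum>i<n. T (v i) - T (u i)) \<le> (\<Sum>i<n. 2 * (v i - u i))"
        using * by (intro sum_mono T_Lip) auto
      also have "\<dots> = 2 * (\<Sum>i<n. v i - u i)" by (rule sum_distrib_left[symmetric])
      also have "\<dots> < \<delta>" using * by linarith
      finally show "(\<Sum>i<n. T (v i) - T (u i)) < \<delta>" .
    qed
    moreover have "(\<Sum>i<n. dist (h (u i)) (h (v i))) \<le> (\<Sum>i<n. L * dist (\<phi> (cis (T (u i)))) (\<phi> (cis (T (v i)))))"
    proof (intro sum_mono)
      fix i assume "i \<in> {..<n}"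
      then have "u i \<le> v i" "{u i..v i} \<subseteq> {a..b}" using * by auto
      then have "u i \<in> {a..b}" "v i \<in> {a..b}" by auto
      then show "dist (h (u i)) (h (v i)) \<le> L * dist (\<phi> (cis (T (u i)))) (\<phi> (cis (T (v i))))"
        unfolding dist_real_def by (rule Lip)
    qed
    ultimately show "(\<Sum>i<n. dist (h (u i)) (h (v i))) < \<epsilon>"
      using L by (simp add: field_simps flip: sum_distrib_left)
  qed
qed

end

section \<open>Functions that agree almost everywhere\<close>

lemma AE_lebesgue_deriv:
  assumes "AE x in lebesgue. (h has_real_derivative p x) (at x)"
  shows "AE x in lebesgue. p x = deriv h x"
  using assms by eventually_elim (simp add: DERIV_imp_deriv)

lemma set_integral_cong_AE_lebesgue:
  fixes f g :: "real \<Rightarrow> real"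
  assumes "AE x in lebesgue. f x = g x" "f \<in> borel_measurable lebesgue" "A \<in> sets lebesgue"
  shows "(LINT x:A|lebesgue. f x) = (LINT x:A|lebesgue. g x)"
    and "set_integrable lebesgue A f \<longleftrightarrow> set_integrable lebesgue A g"
proof -
  have g: "g \<in> borel_measurable lebesgue" using assms(2,1) by (rule borel_measurable_lebesgue_AE)
  have m: "(\<lambda>x. indicator A x *\<^sub>R f x) \<in> borel_measurable lebesgue" "(\<lambda>x. indicator A x *\<^sub>R g x) \<in> borel_measurable lebesgue"
    using assms g by (auto intro!: borel_measurable_scaleR borel_measurable_indicator)
  have ae: "AE x in lebesgue. indicator A x *\<^sub>R f x = indicator A x *\<^sub>R g x"
    using assms(1) by eventually_elim simp
  show "(LINT x:A|lebesgue. f x) = (LINT x:A|lebesgue. g x)"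
    unfolding set_lebesgue_integral_def using m ae by (rule integral_cong_AE)
  show "set_integrable lebesgue A f \<longleftrightarrow> set_integrable lebesgue A g"
    unfolding set_integrable_def using m ae by (rule integrable_cong_AE)
qed

lemma intervals_sets: "I \<in> intervals \<Longrightarrow> I \<in> sets lebesgue"
  unfolding intervals_def by auto

text \<open>Leads from the density to \<open>deriv h\<close>, which is only known to agree with it
  almost everywhere; completeness of Lebesgue measure supplies the measurability.\<close>

lemma locally_integrable_cong_AE:
  assumes ae: "AE x in lebesgue. f x = g x" and "locally_integrable lebesgue intervals f"
  shows "locally_integrable lebesgue intervals g"
  using assms set_integral_cong_AE_lebesgue(2)[OF ae _ intervals_sets] borel_measurable_lebesgue_AE[OF _ ae]
  unfolding locally_integrable_def by blast

lemma A_infinity_cong_AE: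
  assumes ae: "AE x in lebesgue. f x = g x" and "A_infinity lebesgue intervals f"
  shows "A_infinity lebesgue intervals g"
proof -
  have f: "f \<in> borel_measurable lebesgue" "locally_integrable lebesgue intervals f" "AE x in lebesgue. 0 \<le> f x"
    using assms(2) unfolding A_infinity_def weight_def locally_integrable_def by auto
  have eq: "(LINT x:A|lebesgue. f x) = (LINT x:A|lebesgue. g x)" if "A \<in> sets lebesgue" for A
    using ae f(1) that by (rule set_integral_cong_AE_lebesgue(1))
  have "AE x in lebesgue. 0 \<le> g x" using f(3) ae by eventually_elim simp
  then have "weight lebesgue intervals g"
    unfolding weight_def using locally_integrable_cong_AE[OF ae f(2)] by simp
  then show ?thesis
    using assms(2) unfolding A_infinity_def by (auto simp: eq intervals_sets)
qed

lemma VMO_cong_AE: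
  assumes ae: "AE x in lebesgue. f x = g x" and "f \<in> VMO lebesgue intervals"
  shows "g \<in> VMO lebesgue intervals"
proof -
  have f: "locally_integrable lebesgue intervals f" using assms(2) unfolding VMO_def BMO_def by auto
  then have fm: "f \<in> borel_measurable lebesgue" unfolding locally_integrable_def by simp
  have eq: "mean_oscillation lebesgue I f = mean_oscillation lebesgue I g" if I: "I \<in> intervals" for I
  proof -
    have m: "mean lebesgue I f = mean lebesgue I g"
      unfolding mean_def using set_integral_cong_AE_lebesgue(1)[OF ae fm intervals_sets[OF I]] by simp
    have "AE x in lebesgue. \<bar>f x - mean lebesgue I f\<bar> = \<bar>g x - mean lebesgue I g\<bar>"
      using ae unfolding m by eventually_elim simp
    then show ?thesis unfolding mean_oscillation_def
      using fm by (subst (1 2) mean_def) (simp add: set_integral_cong_AE_lebesgue(1)[OF _ _ intervals_sets[OF I]])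
  qed
  then have "(\<lambda>I. mean_oscillation lebesgue I f) ` intervals = (\<lambda>I. mean_oscillation lebesgue I g) ` intervals"
    by (intro image_cong) auto
  then show ?thesis
    using assms(2) locally_integrable_cong_AE[OF ae f] eq unfolding VMO_def BMO_def by auto
qed

section \<open>Doubling of the circle weight\<close>

lemma arctan_diff_ge:
  assumes "0 \<le> a" "a \<le> b"
  shows "(b - a) / (1 + b\<^sup>2) \<le> arctan b - arctan a"
proof -
  have "(LINT x:{a..b}|lebesgue. 2 / (1 + b\<^sup>2)) \<le> (LINT x:{a..b}|lebesgue. line_density x)"
    using assms
    by (intro set_integral_mono set_integral_const_lebesgue set_integrable_line_density line_density_bounds(1)[of 0]) auto
  then have "2 * ((b - a) / (1 + b\<^sup>2)) \<le> 2 * (arctan b - arctan a)"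
    using assms by (simp add: set_integral_const_lebesgue LINT_line_density)
  then show ?thesis by (rule mult_left_le_imp_le) simp
qed

locale circle_A_infinity = circle_homeomorphism +
  fixes w :: "complex \<Rightarrow> real" and C \<alpha> :: real
  assumes w_def: "w = (\<lambda>z. norm (circle_deriv \<phi> z))"
    and ac: "absolutely_continuous_on {0..2 * pi} (\<lambda>t. \<phi> (cis t))"
    and w_measurable: "w \<in> borel_measurable arc_length"
    and w_integrable: "\<And>A. A \<in> arcs \<Longrightarrow> set_integrable arc_length A w"
    and w_pos: "\<And>A. A \<in> arcs \<Longrightarrow> 0 < (LINT z:A|arc_length. w z)"
    and C: "0 < C" and \<alpha>: "0 < \<alpha>"
    and A_inf: "\<And>A E. A \<in> arcs \<Longrightarrow> E \<in> sets arc_length \<Longrightarrow> E \<subseteq> A \<Longrightarrow>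
      (LINT z:E|arc_length. w z) / (LINT z:A|arc_length. w z) \<le> C * (measure arc_length E / measure arc_length A) powr \<alpha>"
begin

lemma w_nonneg: "0 \<le> w z"
  by (simp add: w_def)

lemma A_inf': 
  assumes "A \<in> arcs" "E \<in> sets arc_length" "E \<subseteq> A"
  shows "(LINT z:E|arc_length. w z) \<le> C * (measure arc_length E / measure arc_length A) powr \<alpha> * (LINT z:A|arc_length. w z)"
  using A_inf[OF assms] w_pos[OF assms(1)] by (simp add: pos_divide_le_eq)

text \<open>If J' fills all but a fraction \<delta> of the arc J, the rest carries at most half of
  the weight, hence J' at least half. Subarcs of any fixed proportion are reached by n such steps,
  each shrinking by \<kappa> = 1 - \<delta>.\<close>

lemma arc_doubling:
  obtains \<kappa> where "0 < \<kappa>" "\<kappa> < 1"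
    "\<And>n a b c d. a \<le> c \<Longrightarrow> c < d \<Longrightarrow> d \<le> b \<Longrightarrow> b \<le> a + 2 * pi \<Longrightarrow> \<kappa> ^ n * (b - a) \<le> d - c \<Longrightarrow>
      (LINT z:cis ` {a..b}|arc_length. w z) \<le> 2 ^ n * (LINT z:cis ` {c..d}|arc_length. w z)"
proof -
  \<comment> \<open>Makes C times \<delta>^\<alpha> at most 1/2.\<close>
  define \<delta> where "\<delta> = min (1/2) ((1 / (2 * C)) powr (1 / \<alpha>))"
  have \<delta>: "0 < \<delta>" "\<delta> < 1" using C by (auto simp: \<delta>_def)
  have C\<delta>: "C * \<delta> powr \<alpha> \<le> 1 / 2"
  proof -
    have "\<delta> powr \<alpha> \<le> ((1 / (2 * C)) powr (1 / \<alpha>)) powr \<alpha>"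
      using \<delta> \<alpha> by (intro powr_mono2) (auto simp: \<delta>_def)
    also have "\<dots> = 1 / (2 * C)" using C \<alpha> by (simp add: powr_powr)
    finally show ?thesis using C by (simp add: field_simps)
  qed
  define \<kappa> where "\<kappa> = 1 - \<delta>"
  have \<kappa>: "0 < \<kappa>" "\<kappa> < 1" using \<delta> by (auto simp: \<kappa>_def)
  have step: "(LINT z:cis ` {a..b}|arc_length. w z) \<le> 2 * (LINT z:cis ` {c..d}|arc_length. w z)"
    if *: "a \<le> c" "c < d" "d \<le> b" "b \<le> a + 2 * pi" "\<kappa> * (b - a) \<le> d - c" for a b c d
  proof -
    let ?J = "cis ` {a..b}" and ?J' = "cis ` {c..d}"
    have J: "?J \<in> arcs" "?J' \<in> arcs" using * by (auto intro!: arcI)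
    have sub: "?J' \<subseteq> ?J" using * by (intro image_mono) auto
    have E: "?J - ?J' \<in> sets arc_length" by (intro sets.Diff arc_in_sets)
    have "?J \<in> fmeasurable arc_length" "?J' \<in> fmeasurable arc_length"
      using * by (auto intro!: fmeasurableI simp: emeasure_arc_length_arc)
    then have "measure arc_length (?J - ?J') = measure arc_length ?J - measure arc_length ?J'"
      using sub by (intro measurable_measure_Diff) (auto dest: fmeasurableD)
    also have "\<dots> = (b - a) - (d - c)" using * by (simp add: measure_arc_length_arc)
    also have "\<dots> \<le> \<delta> * (b - a)" using *(5) by (simp add: \<kappa>_def algebra_simps)
    finally have "measure arc_length (?J - ?J') / measure arc_length ?J \<le> \<delta>"
      using * by (simp add: measure_arc_length_arc divide_le_eq)
    then have "C * (measure arc_length (?J - ?J') / measure arc_length ?J) powr \<alpha> \<le> C * \<delta> powr \<alpha>"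
      using C \<alpha> by (intro mult_left_mono powr_mono2) auto
    then have "C * (measure arc_length (?J - ?J') / measure arc_length ?J) powr \<alpha> * (LINT z:?J|arc_length. w z)
        \<le> 1 / 2 * (LINT z:?J|arc_length. w z)"
      using C\<delta> w_pos[OF J(1)] by (intro mult_right_mono) auto
    then have half: "(LINT z:?J - ?J'|arc_length. w z) \<le> 1 / 2 * (LINT z:?J|arc_length. w z)"
      using A_inf'[OF J(1) E] by auto
    have "(LINT z:(?J - ?J') \<union> ?J'|arc_length. w z) \<le> (LINT z:?J - ?J'|arc_length. w z) + (LINT z:?J'|arc_length. w z)"
      using w_integrable[OF J(1)] w_integrable[OF J(2)] E w_nonneg
      by (intro set_integral_Un_le) (auto intro: set_integrable_subset)
    moreover have "(?J - ?J') \<union> ?J' = ?J" using sub by auto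
    ultimately show ?thesis using half by simp
  qed
  have "(LINT z:cis ` {a..b}|arc_length. w z) \<le> 2 ^ n * (LINT z:cis ` {c..d}|arc_length. w z)"
    if *: "a \<le> c" "c < d" "d \<le> b" "b \<le> a + 2 * pi" "\<kappa> ^ n * (b - a) \<le> d - c" for n a b c d
    using *
  proof (induction n arbitrary: c d)
    case 0
    then have "c = a" "d = b" by auto
    then show ?case by simp
  next
    case (Suc n)
    show ?case
    proof (cases "\<kappa> * (b - a) \<le> d - c")
      case True
      have "(LINT z:cis ` {a..b}|arc_length. w z) \<le> 2 * (LINT z:cis ` {c..d}|arc_length. w z)"
        using step[OF Suc.prems(1-4) True] .
      also have "\<dots> \<le> 2 ^ Suc n * (LINT z:cis ` {c..d}|arc_length. w z)"
        using w_nonneg by (intro mult_right_mono set_integral_nonneg_on) auto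
      finally show ?thesis .
    next
      case False
      text \<open>Enlarge \<open>[c, d]\<close> inside \<open>[a, b]\<close> by the factor \<open>1 / \<kappa>\<close>, extending both ends
        in proportion to the available room.\<close>
      define \<theta> where "\<theta> = ((d - c) / \<kappa> - (d - c)) / ((b - a) - (d - c))"
      have dc: "0 < d - c" "(d - c) / \<kappa> < b - a" using False Suc.prems \<kappa> by (auto simp: field_simps)
      have "d - c < (d - c) / \<kappa>"
        using dc(1) \<kappa> mult_strict_left_mono[of \<kappa> 1 "d - c"] by (simp add: pos_less_divide_eq)
      then have den: "0 < (b - a) - (d - c)" using dc by linarith
      have "(d - c) / \<kappa> - (d - c) \<le> (b - a) - (d - c)" "0 \<le> (d - c) / \<kappa> - (d - c)"
        using dc(2) \<open>d - c < (d - c) / \<kappa>\<close> by linarith+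
      then have \<theta>: "0 \<le> \<theta>" "\<theta> \<le> 1"
        unfolding \<theta>_def using den by (simp_all only: divide_le_eq_1_pos divide_nonneg_pos)
      define c' where "c' = c - \<theta> * (c - a)"
      define d' where "d' = d + \<theta> * (b - d)"
      have len: "d' - c' = (d - c) / \<kappa>"
      proof -
        have "d' - c' = (d - c) + \<theta> * ((b - a) - (d - c))" by (simp add: c'_def d'_def algebra_simps)
        then show ?thesis unfolding \<theta>_def using den by simp
      qed
      have "\<theta> * (c - a) \<le> 1 * (c - a)" "\<theta> * (b - d) \<le> 1 * (b - d)"
        by (rule mult_right_mono; use \<theta> Suc.prems in simp)+
      moreover have "0 \<le> \<theta> * (c - a)" "0 \<le> \<theta> * (b - d)" using \<theta> Suc.prems by auto
      ultimately have sub: "a \<le> c'" "c' \<le> c" "d \<le> d'" "d' \<le> b" by (auto simp: c'_def d'_def)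
      have "(LINT z:cis ` {a..b}|arc_length. w z) \<le> 2 ^ n * (LINT z:cis ` {c'..d'}|arc_length. w z)"
      proof (rule Suc.IH)
        show "c' < d'" using sub Suc.prems by linarith
        show "\<kappa> ^ n * (b - a) \<le> d' - c'" unfolding len using Suc.prems(5) \<kappa> by (simp add: field_simps)
      qed (use sub Suc.prems in auto)
      also have "\<dots> \<le> 2 ^ n * (2 * (LINT z:cis ` {c..d}|arc_length. w z))"
      proof (intro mult_left_mono step)
        show "\<kappa> * (d' - c') \<le> d - c" unfolding len using \<kappa> by simp
      qed (use sub Suc.prems in auto)
      finally show ?thesis by simp
    qed
  qed
  then show thesis using \<kappa> that by blast
qed

lemma measure_image_cayley_line:
  assumes E: "E \<in> sets lebesgue"
  shows "measure arc_length (cayley_line ` E) = (LINT x:E|lebesgue. line_density x)"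
    and "(LINT z:cayley_line ` E|arc_length. w z) = (LINT x:E|lebesgue. line_density x * w (cayley_line x))"
proof -
  have vim: "{x. cayley_line x \<in> cayley_line ` E} = E" using inj_cayley_line by (auto dest: injD)
  have TE: "cayley_line ` E \<in> sets arc_length" using E by (rule cayley_line_image_sets)
  have "(LINT z:cayley_line ` E|arc_length. (1::real)) = measure arc_length (cayley_line ` E)"
    unfolding set_lebesgue_integral_def using sets.sets_into_space[OF TE] by (simp add: Int_absorb2)
  then show "measure arc_length (cayley_line ` E) = (LINT x:E|lebesgue. line_density x)"
    using set_integral_arc_length[OF TE, of "\<lambda>z. 1"] unfolding vim by simp
  show "(LINT z:cayley_line ` E|arc_length. w z) = (LINT x:E|lebesgue. line_density x * w (cayley_line x))"
    using set_integral_arc_length[OF TE w_measurable] unfolding vim .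
qed

lemma measure_arc_line:
  assumes A: "A \<in> sets arc_length"
  shows "measure arc_length A = (LINT x:{x. cayley_line x \<in> A}|lebesgue. line_density x)"
  using set_integral_arc_length[OF A, of "\<lambda>z. 1"] sets.sets_into_space[OF A]
  unfolding set_lebesgue_integral_def by (simp add: Int_absorb2)

lemma A_inf_line:
  assumes A: "A \<in> arcs" and E: "E \<in> sets lebesgue" "E \<subseteq> {x. cayley_line x \<in> A}"
  shows "(LINT x:E|lebesgue. line_density x * w (cayley_line x)) \<le>
    C * ((LINT x:E|lebesgue. line_density x) / (LINT x:{x. cayley_line x \<in> A}|lebesgue. line_density x)) powr \<alpha> *
    (LINT x:{x. cayley_line x \<in> A}|lebesgue. line_density x * w (cayley_line x))"
proof -
  have As: "A \<in> sets arc_length" using A by (auto simp: arcs_def)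
  have "cayley_line ` E \<subseteq> A" using E by auto
  then have "(LINT z:cayley_line ` E|arc_length. w z) \<le>
      C * (measure arc_length (cayley_line ` E) / measure arc_length A) powr \<alpha> * (LINT z:A|arc_length. w z)"
    using A_inf'[OF A cayley_line_image_sets[OF E(1)]] by simp
  then show ?thesis
    unfolding measure_image_cayley_line[OF E(1)] measure_arc_line[OF As] set_integral_arc_length[OF As w_measurable] .
qed

lemma arc_interval: "a < b \<Longrightarrow> cis ` {pi + 2 * arctan a..pi + 2 * arctan b} \<in> arcs"
  using arctan_bounded[of a] arctan_bounded[of b] by (intro arcI) (auto simp: arctan_less_iff)

lemma arc_tail: "0 \<le> R \<Longrightarrow> cis ` {2 * arctan R - pi..pi - 2 * arctan R} \<in> arcs"
  using arctan_bounded[of R] by (intro arcI) auto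

lemma vimage_arc_interval: "{x. cayley_line x \<in> cis ` {pi + 2 * arctan a..pi + 2 * arctan b}} = {a..b}"
  by (simp only: cayley_line_in_arc_interval Collect_mem_eq)

lemma vimage_arc_tail: "0 \<le> R \<Longrightarrow> {x. cayley_line x \<in> cis ` {2 * arctan R - pi..pi - 2 * arctan R}} = tail R"
  by (simp only: cayley_line_in_arc_tail tail_def)

lemma LINT_w_arc:
  "(LINT z:cis ` {a..b}|arc_length. w z) =
    (LINT x:{x. cayley_line x \<in> cis ` {a..b}}|lebesgue. line_density x * w (cayley_line x))"
  by (rule set_integral_arc_length[OF arc_in_sets w_measurable])

text \<open>Each of the three sides of annuli has angular length at least 4 / (17 R), while the arc
  around 1 has length at most 4 / R; n steps of \<open>arc_doubling\<close> with \<kappa>^n < 1/17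
  connect them.\<close>

lemma tail_doubling:
  obtains D where "0 < D"
    "\<And>R. 1 \<le> R \<Longrightarrow> (LINT x:tail R|lebesgue. line_density x * w (cayley_line x)) \<le> D * (LINT x:{R..2*R}|lebesgue. line_density x * w (cayley_line x))"
    "\<And>R. 1 \<le> R \<Longrightarrow> (LINT x:tail R|lebesgue. line_density x * w (cayley_line x)) \<le> D * (LINT x:{2*R..4*R}|lebesgue. line_density x * w (cayley_line x))"
    "\<And>R. 1 \<le> R \<Longrightarrow> (LINT x:tail R|lebesgue. line_density x * w (cayley_line x)) \<le> D * (LINT x:{-(2*R)..-R}|lebesgue. line_density x * w (cayley_line x))"
proof -
  obtain \<kappa> where \<kappa>: "0 < \<kappa>" "\<kappa> < 1"
    "\<And>n a b c d. a \<le> c \<Longrightarrow> c < d \<Longrightarrow> d \<le> b \<Longrightarrow> b \<le> a + 2 * pi \<Longrightarrow> \<kappa> ^ n * (b - a) \<le> d - c \<Longrightarrow>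
      (LINT z:cis ` {a..b}|arc_length. w z) \<le> 2 ^ n * (LINT z:cis ` {c..d}|arc_length. w z)"
    using arc_doubling by blast
  obtain n where n: "\<kappa> ^ n < 1 / 17" using real_arch_pow_inv[of "1/17" \<kappa>] \<kappa> by auto
  have bd: "- pi < 2 * arctan y" "2 * arctan y < pi" for y using arctan_bounded[of y] by auto
  have main: "(LINT x:tail R|lebesgue. line_density x * w (cayley_line x)) \<le> 2 ^ n * (LINT x:{a..b}|lebesgue. line_density x * w (cayley_line x))"
    if R: "1 \<le> R" and ab: "a < b" "R \<le> a \<or> b \<le> - R" and len: "4 / (17 * R) \<le> 2 * (arctan b - arctan a)" for R a b
  proof -
    define s where "s = pi - 2 * arctan R"
    have s: "s \<le> 2 / R" unfolding s_def using two_arctan_le[of R] R by simp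
    have small: "\<kappa> ^ n * (s - (- s)) \<le> 2 * (arctan b - arctan a)"
    proof -
      have "0 < s" using bd[of R] by (simp add: s_def)
      then have "\<kappa> ^ n * (s - (- s)) \<le> 1 / 17 * (2 * s)" using n by (intro mult_mono) auto
      also have "\<dots> \<le> 1 / 17 * (2 * (2 / R))" using s by simp
      also have "\<dots> = 4 / (17 * R)" by simp
      finally show ?thesis using len by linarith
    qed
    have lt: "arctan a < arctan b" using ab by (simp add: arctan_less_iff)
    \<comment> \<open>Points x > 0 have angles in (pi, 2 pi); a shift by -2 pi places those of the
      tail inside {- s..s}.\<close>
    have arc: "cis ` {2 * arctan a - pi..2 * arctan b - pi} = cis ` {pi + 2 * arctan a..pi + 2 * arctan b}"
      using arc_shift[of "2 * arctan a - pi" 1 "2 * arctan b - pi"] by (simp add: add.commute)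
    have "(LINT z:cis ` {- s..s}|arc_length. w z) \<le> 2 ^ n * (LINT z:cis ` {pi + 2 * arctan a..pi + 2 * arctan b}|arc_length. w z)"
      using ab(2)
    proof
      assume "R \<le> a"
      then have "arctan R \<le> arctan a" by (simp add: arctan_le_iff)
      then show ?thesis unfolding arc[symmetric]
        using bd[of b] bd[of R] lt small R by (intro \<kappa>(3)) (auto simp: s_def)
    next
      assume "b \<le> - R"
      then have "arctan b \<le> - arctan R" by (simp add: arctan_le_iff flip: arctan_minus)
      then show ?thesis 
        using bd[of a] bd[of R] lt small R by (intro \<kappa>(3)) (auto simp: s_def)
    qed
    moreover have "{- s..s} = {2 * arctan R - pi..pi - 2 * arctan R}" by (simp add: s_def)
    ultimately show ?thesis
      using vimage_arc_tail[of R] R unfolding LINT_w_arc vimage_arc_interval by simp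
  qed
  \<comment> \<open>For R <= a <= 2 R the worst case of a / (1 + 4 a^2) is a = 2 R, with value 2 R /
    (1 + 16 R^2) >= 2 / (17 R).\<close>
  have len: "4 / (17 * R) \<le> 2 * (arctan (2 * a) - arctan a)" if "1 \<le> R" "R \<le> a" "a \<le> 2 * R" for R a
  proof -
    have "a / (1 + (2 * a)\<^sup>2) \<le> arctan (2 * a) - arctan a" using arctan_diff_ge[of a "2 * a"] that by simp
    moreover have "2 / (17 * R) \<le> a / (1 + (2 * a)\<^sup>2)"
    proof -
      have "0 \<le> (a - R) * (2 * R - a)" using that by (intro mult_nonneg_nonneg) auto
      then have 1: "a * a \<le> 3 * (a * R) - 2 * (R * R)" by (simp add: algebra_simps)
      have 2: "R * R \<le> a * R" "1 \<le> R * R" using that mult_mono[of 1 R 1 R] by (auto intro: mult_right_mono)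
      have 3: "a * R \<le> 2 * (R * R)" using that by (simp add: mult_right_mono)
      have "2 * (1 + (2 * a)\<^sup>2) \<le> a * (17 * R)"
        using 1 2 3 by (simp add: power2_eq_square algebra_simps)
      then show ?thesis using that by (simp add: divide_le_eq pos_le_divide_eq add_pos_nonneg field_simps)
    qed
    ultimately have "2 * (2 / (17 * R)) \<le> 2 * (arctan (2 * a) - arctan a)" by (intro mult_left_mono) auto
    then show ?thesis by simp
  qed
  show thesis
  proof (rule that[of "2 ^ n"])
    fix R :: real assume R: "1 \<le> R"
    show "(LINT x:tail R|lebesgue. line_density x * w (cayley_line x)) \<le> 2 ^ n * (LINT x:{R..2*R}|lebesgue. line_density x * w (cayley_line x))"
      using R len[of R R] by (intro main) auto
    show "(LINT x:tail R|lebesgue. line_density x * w (cayley_line x)) \<le> 2 ^ n * (LINT x:{2*R..4*R}|lebesgue. line_density x * w (cayley_line x))"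
      using R len[of R "2 * R"] by (intro main) auto
    show "(LINT x:tail R|lebesgue. line_density x * w (cayley_line x)) \<le> 2 ^ n * (LINT x:{-(2*R)..-R}|lebesgue. line_density x * w (cayley_line x))"
      using R len[of R R] by (intro main) (auto simp: arctan_minus)
  qed simp
qed

end

section \<open>Membership of the conjugated map in \<open>SS_line\<close>\<close>

lemma absolutely_continuous_on_Lipschitz:
  fixes h k :: "real \<Rightarrow> real"
  assumes ac: "absolutely_continuous_on S h" and L: "0 < L"
    and Lip: "\<And>x y. x \<in> S \<Longrightarrow> y \<in> S \<Longrightarrow> dist (k x) (k y) \<le> L * dist (h x) (h y)"
  shows "absolutely_continuous_on S k"
  unfolding absolutely_continuous_on_def
proof (intro allI impI)
  fix e :: real assume e: "0 < e"
  obtain d where d: "0 < d" "\<And>(n::nat) u v. (\<forall>i<n. u i \<le> v i \<and> {u i..v i} \<subseteq> S) \<Longrightarrow>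
        (\<forall>i<n. \<forall>j<n. i \<noteq> j \<longrightarrow> {u i<..<v i} \<inter> {u j<..<v j} = {}) \<Longrightarrow>
        (\<Sum>i<n. v i - u i) < d \<Longrightarrow> (\<Sum>i<n. dist (h (u i)) (h (v i))) < e / L"
    using ac divide_pos_pos[OF e L] unfolding absolutely_continuous_on_def by meson
  show "\<exists>d>0. \<forall>(n::nat) u v. (\<forall>i<n. u i \<le> v i \<and> {u i..v i} \<subseteq> S) \<and>
        (\<forall>i<n. \<forall>j<n. i \<noteq> j \<longrightarrow> {u i<..<v i} \<inter> {u j<..<v j} = {}) \<and>
        (\<Sum>i<n. v i - u i) < d \<longrightarrow> (\<Sum>i<n. dist (k (u i)) (k (v i))) < e"
  proof (intro exI[of _ d] conjI allI impI d(1))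
    fix n :: nat and u v :: "nat \<Rightarrow> real"
    assume *: "(\<forall>i<n. u i \<le> v i \<and> {u i..v i} \<subseteq> S) \<and>
        (\<forall>i<n. \<forall>j<n. i \<noteq> j \<longrightarrow> {u i<..<v i} \<inter> {u j<..<v j} = {}) \<and> (\<Sum>i<n. v i - u i) < d"
    have "(\<Sum>i<n. dist (k (u i)) (k (v i))) \<le> (\<Sum>i<n. L * dist (h (u i)) (h (v i)))"
    proof (intro sum_mono Lip)
      fix i assume "i \<in> {..<n}"
      then have "u i \<le> v i" "{u i..v i} \<subseteq> S" using * by auto
      then show "u i \<in> S" "v i \<in> S" by auto
    qed
    also have "\<dots> = L * (\<Sum>i<n. dist (h (u i)) (h (v i)))" by (rule sum_distrib_left[symmetric])
    also have "\<dots> < L * (e / L)" using d(2)[of n u v] * L by (intro mult_strict_left_mono) blast+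
    finally show "(\<Sum>i<n. dist (k (u i)) (k (v i))) < e" using L by simp
  qed
qed

lemma cayley_line_in_full_circle: "cayley_line x \<in> cis ` {0..2 * pi}"
  unfolding cayley_line_eq_cis using arctan_bounded[of x] by (intro imageI) auto

context circle_A_infinity begin

text \<open>Both h and 2 arctan h are increasing and absolutely continuous, so each is the integral
  of a density. Differentiation almost everywhere shows that the second density is p times
  \<open>line_density (h x)\<close>, and \<open>norm_circle_deriv\<close> that the circle weight
  yields the same function; this takes the place of a change of variables along h.\<close>

lemma line_weight:
  obtains p D where "circle_weight_on_line h p C \<alpha> D"
    "AE x in lebesgue. p x = deriv h x"
    "AE x in lebesgue. line_density x * w (cayley_line x) = p x * line_density (h x)"
proof -
  have mono: "mono h" using strict_mono_h by (rule strict_mono_mono)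
  have ach: "absolutely_continuous_on {a..b} h" for a b using ac by (rule absolutely_continuous_h)
  obtain p where "indefinite_integral p h" using mono_absolutely_continuous_density[OF mono ach] by blast
  then interpret p: indefinite_integral p h .
  define k2 where "k2 x = 2 * arctan (h x)" for x
  have "mono k2" using mono by (auto simp: mono_def k2_def arctan_le_iff)
  moreover have "absolutely_continuous_on {a..b} k2" for a b
  proof (rule absolutely_continuous_on_Lipschitz[OF ach])
    show "dist (k2 x) (k2 y) \<le> 2 * dist (h x) (h y)" for x y
    proof -
      have "\<bar>2 * arctan (h x) - 2 * arctan (h y)\<bar> = 2 * \<bar>arctan (h x) - arctan (h y)\<bar>"
        by (simp only: right_diff_distrib[symmetric] abs_mult abs_numeral)
      then show ?thesis using arctan_Lipschitz[of "h x" "h y"] unfolding k2_def dist_real_def by simp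
    qed
  qed simp
  ultimately obtain p2 where "indefinite_integral p2 k2" using mono_absolutely_continuous_density by blast
  then interpret p2: indefinite_integral p2 k2 .
  define k where "k x = p x * line_density (h x)" for x
  have ae2: "AE x in lebesgue. p2 x = k x"
    using p.AE_has_derivative p2.AE_has_derivative
  proof eventually_elim
    case (elim x)
    have "(k2 has_real_derivative 2 * (inverse (1 + (h x)\<^sup>2) * p x)) (at x)"
      unfolding k2_def using elim(1) by (auto intro!: derivative_eq_intros)
    then show ?case using elim(2) DERIV_unique by (fastforce simp: k_def line_density_def divide_inverse)
  qed
  have aew: "AE x in lebesgue. line_density x * w (cayley_line x) = k x"
    using p.AE_has_derivative
  proof eventually_elim
    case (elim x)
    show ?case unfolding w_def k_def norm_circle_deriv[OF conj elim]
      using p.nonneg[of x] line_density_pos[of x] by simp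
  qed
  have p2m: "p2 \<in> borel_measurable lebesgue" using p2.borel by (simp add: measurable_completion)
  have km: "k \<in> borel_measurable lebesgue" using p2m ae2 by (rule borel_measurable_lebesgue_AE)
  have wm: "(\<lambda>x. line_density x * w (cayley_line x)) \<in> borel_measurable lebesgue"
    using borel_measurable_cayley_line[OF w_measurable]
    by (intro borel_measurable_times measurable_completion[of line_density]) auto
  have eqk: "(LINT x:E|lebesgue. line_density x * w (cayley_line x)) = (LINT x:E|lebesgue. k x)" if "E \<in> sets lebesgue" for E
    using aew wm that by (rule set_integral_cong_AE_lebesgue)
  obtain D where D: "0 < D"
    "\<And>R. 1 \<le> R \<Longrightarrow> (LINT x:tail R|lebesgue. line_density x * w (cayley_line x)) \<le> D * (LINT x:{R..2*R}|lebesgue. line_density x * w (cayley_line x))"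
    "\<And>R. 1 \<le> R \<Longrightarrow> (LINT x:tail R|lebesgue. line_density x * w (cayley_line x)) \<le> D * (LINT x:{2*R..4*R}|lebesgue. line_density x * w (cayley_line x))"
    "\<And>R. 1 \<le> R \<Longrightarrow> (LINT x:tail R|lebesgue. line_density x * w (cayley_line x)) \<le> D * (LINT x:{-(2*R)..-R}|lebesgue. line_density x * w (cayley_line x))"
    using tail_doubling by blast
  have "circle_weight_on_line h p C \<alpha> D"
  proof
    show "strict_mono h" "surj h" by (rule strict_mono_h surj_h)+
    show "p \<in> borel_measurable lebesgue" using p.borel by (simp add: measurable_completion)
    show "0 \<le> p x" for x by (rule p.nonneg)
    show "set_integrable lebesgue {a..b} p" for a b by (rule p.set_integrable_Icc)
    show "(LINT x:{a..b}|lebesgue. p x) = h b - h a" if "a \<le> b" for a b using that by (rule p.LINT_Icc)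
    show "integrable lebesgue (\<lambda>x. p x * line_density (h x))"
    proof -
      have "set_integrable arc_length (cis ` {0..2 * pi}) w" by (intro w_integrable arcI) auto
      then have "set_integrable lebesgue UNIV (\<lambda>x. line_density x * w (cayley_line x))"
        unfolding set_integrable_arc_length_iff[OF arc_in_sets w_measurable] using cayley_line_in_full_circle by simp
      then have "set_integrable lebesgue UNIV k"
        using set_integral_cong_AE_lebesgue(2)[OF aew wm] by simp
      then show ?thesis by (simp add: set_integrable_def k_def)
    qed
    show "(LINT x:{a..b}|lebesgue. p x * line_density (h x)) = 2 * (arctan (h b) - arctan (h a))" if "a \<le> b" for a b
      using set_integral_cong_AE_lebesgue(1)[OF ae2 p2m, of "{a..b}"] p2.LINT_Icc[OF that]
      by (simp add: k_def k2_def)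
    show "0 < C" "0 < \<alpha>" "0 < D" by (fact C \<alpha> D)+
    show "(LINT x:E|lebesgue. p x * line_density (h x)) \<le>
        C * ((LINT x:E|lebesgue. line_density x) / (LINT x:{a..b}|lebesgue. line_density x)) powr \<alpha> *
        (LINT x:{a..b}|lebesgue. p x * line_density (h x))"
      if "a < b" and E: "E \<in> sets lebesgue" "E \<subseteq> {a..b}" for a b E
    proof -
      have "{a..b} \<in> sets lebesgue" by simp
      from A_inf_line[OF arc_interval[OF that(1)] E(1)] E(2)
      show ?thesis unfolding vimage_arc_interval eqk[OF E(1)] eqk[OF \<open>{a..b} \<in> sets lebesgue\<close>] k_def .
    qed
    show "(LINT x:E|lebesgue. p x * line_density (h x)) \<le>
        C * ((LINT x:E|lebesgue. line_density x) / (LINT x:tail R|lebesgue. line_density x)) powr \<alpha> *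
        (LINT x:tail R|lebesgue. p x * line_density (h x))"
      if "1 \<le> R" and E: "E \<in> sets lebesgue" "E \<subseteq> tail R" for R E
    proof -
      have R: "0 \<le> R" using that by simp
      from A_inf_line[OF arc_tail[OF R] E(1)] E(2)
      show ?thesis unfolding vimage_arc_tail[OF R] eqk[OF E(1)] eqk[OF tail_sets(2)] k_def .
    qed
    have Icc: "{a..b::real} \<in> sets lebesgue" for a b by simp
    show "(LINT x:tail R|lebesgue. p x * line_density (h x)) \<le> D * (LINT x:{R..2*R}|lebesgue. p x * line_density (h x))"
      if "1 \<le> R" for R
      using D(2)[OF that] unfolding eqk[OF Icc] eqk[OF tail_sets(2)] k_def .
    show "(LINT x:tail R|lebesgue. p x * line_density (h x)) \<le> D * (LINT x:{2*R..4*R}|lebesgue. p x * line_density (h x))"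
      if "1 \<le> R" for R
      using D(3)[OF that] unfolding eqk[OF Icc] eqk[OF tail_sets(2)] k_def .
    show "(LINT x:tail R|lebesgue. p x * line_density (h x)) \<le> D * (LINT x:{-(2*R)..-R}|lebesgue. p x * line_density (h x))"
      if "1 \<le> R" for R
      using D(4)[OF that] unfolding eqk[OF Icc] eqk[OF tail_sets(2)] k_def .
  qed
  then show thesis using that AE_lebesgue_deriv[OF p.AE_has_derivative] aew unfolding k_def by blast
qed

lemma to_line_in_SS_line:
  assumes VMO: "(\<lambda>z. ln (w z)) \<in> VMO arc_length arcs"
  shows "h \<in> SS_line"
proof -
  obtain p D where "circle_weight_on_line h p C \<alpha> D"
    and aed: "AE x in lebesgue. p x = deriv h x"
    and aew: "AE x in lebesgue. line_density x * w (cayley_line x) = p x * line_density (h x)"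
    using line_weight by blast
  then interpret line: circle_weight_on_line h p C \<alpha> D by simp
  obtain K where K: "0 < K" "\<And>a b E. a < b \<Longrightarrow> E \<in> sets lebesgue \<Longrightarrow> E \<subseteq> {a..b} \<Longrightarrow>
    (LINT x:E|lebesgue. p x) \<le> K * (measure lebesgue E / (b - a)) powr (\<alpha> / 2) * (h b - h a)"
    using line.A_infinity_p by blast
  have "A_infinity lebesgue intervals p"
    unfolding A_infinity_def weight_def locally_integrable_def
  proof (intro conjI)
    show "\<exists>C>0. \<exists>\<alpha>>0. \<forall>I\<in>intervals. \<forall>E\<in>sets lebesgue. E \<subseteq> I \<longrightarrow>
      (LINT x:E|lebesgue. p x) / (LINT x:I|lebesgue. p x) \<le> C * (measure lebesgue E / measure lebesgue I) powr \<alpha>"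
    proof (intro exI conjI ballI impI)
      show "0 < K" "0 < \<alpha> / 2" using K \<alpha> by auto
      fix I E assume *: "I \<in> intervals" "E \<in> sets lebesgue" "E \<subseteq> I"
      then obtain a b where I: "I = {a..b}" "a < b" by (auto simp: intervals_def)
      have "0 < h b - h a" using I line.h_less_iff by simp
      then show "(LINT x:E|lebesgue. p x) / (LINT x:I|lebesgue. p x) \<le> K * (measure lebesgue E / measure lebesgue I) powr (\<alpha> / 2)"
        using K(2)[of a b E] * I line.LINT_p[of a b] by (simp add: pos_divide_le_eq)
    qed
  qed (use line.p_measurable line.p_nonneg line.p_integrable line.LINT_p line.h_less_iff in \<open>auto simp: intervals_def\<close>)
  then have A: "A_infinity lebesgue intervals (deriv h)" by (rule A_infinity_cong_AE[OF aed])
  define u where "u z = ln (w z)" for z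
  define v where "v x = u (cayley_line x)" for x
  define g where "g x = ln (1 + (h x)\<^sup>2) - ln (1 + x\<^sup>2)" for x
  have um: "u \<in> borel_measurable arc_length"
    using w_measurable unfolding u_def by measurable
  have u: "locally_integrable arc_length arcs u"
      "bdd_above ((\<lambda>I. mean_oscillation arc_length I u) ` arcs)"
      "\<And>e. 0 < e \<Longrightarrow> \<exists>d>0. \<forall>I\<in>arcs. measure arc_length I < d \<longrightarrow> mean_oscillation arc_length I u < e"
    using VMO unfolding VMO_def BMO_def u_def by auto
  obtain K0 where K0: "\<And>A. A \<in> arcs \<Longrightarrow> mean_oscillation arc_length A u \<le> K0"
    using u(2) unfolding bdd_above_def by auto
  define K1 where "K1 = max K0 0"
  have osc: "\<exists>c. (LINT x:{x. cayley_line x \<in> A}|lebesgue. line_density x * \<bar>v x - c\<bar>) \<le>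
      e * (LINT x:{x. cayley_line x \<in> A}|lebesgue. line_density x)"
    if A: "A \<in> arcs" and e: "mean_oscillation arc_length A u \<le> e" for A e
  proof -
    have As: "A \<in> sets arc_length" using A by (auto simp: arcs_def)
    have m: "0 < measure arc_length A" using A by (auto simp: arcs_def measure_arc_length_arc)
    define c where "c = mean arc_length A u"
    have "(LINT z:A|arc_length. \<bar>u z - c\<bar>) = mean_oscillation arc_length A u * measure arc_length A"
      unfolding mean_oscillation_def c_def[symmetric] using m by (subst mean_def) simp
    also have "\<dots> \<le> e * measure arc_length A" using e m by (intro mult_right_mono) auto
    also have "(LINT z:A|arc_length. \<bar>u z - c\<bar>) = (LINT x:{x. cayley_line x \<in> A}|lebesgue. line_density x * \<bar>v x - c\<bar>)"
      unfolding v_def using um by (intro set_integral_arc_length[OF As]) auto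
    finally show ?thesis unfolding measure_arc_line[OF As] by blast
  qed
  obtain H where H: "0 < H" "\<And>x y. \<bar>x - y\<bar> \<le> 1 \<Longrightarrow> \<bar>ln (1 + (h x)\<^sup>2) - ln (1 + (h y)\<^sup>2)\<bar> \<le> H * \<bar>x - y\<bar> powr \<alpha>"
    using line.Holder_ln_h by blast
  \<comment> \<open>The maximum covers ln (1 + h^2) on tame intervals and on annuli; ln 16 covers ln
    (1 + x^2) in both cases, as ln 5 <= ln 16.\<close>
  define B where "B = max (max (ln 2) (ln (line.\<Lambda>\<^sup>2))) (ln ((9 * D^3)\<^sup>2)) + ln 16"
  have "(\<lambda>x. v x + g x) \<in> VMO lebesgue intervals"
  proof (rule VMO_line_criterion[where K = K1 and B = B])
    show "v \<in> borel_measurable lebesgue" unfolding v_def using um by (rule borel_measurable_cayley_line)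
    show "integrable lebesgue (\<lambda>x. line_density x * v x)"
    proof -
      have "set_integrable arc_length (cis ` {0..2 * pi}) u"
        using u(1) arcI[of 0 "2 * pi"] unfolding locally_integrable_def by auto
      then show ?thesis
        unfolding set_integrable_arc_length_iff[OF arc_in_sets um] v_def
        using cayley_line_in_full_circle by (simp add: set_integrable_def)
    qed
    show "\<exists>c. (LINT x:{a..b}|lebesgue. line_density x * \<bar>v x - c\<bar>) \<le> K1 * (LINT x:{a..b}|lebesgue. line_density x)"
      if "a < b" for a b
      using osc[OF arc_interval[OF that], of K1] K0[OF arc_interval[OF that]] unfolding vimage_arc_interval by (auto simp: K1_def)
    show "\<exists>c. (LINT x:tail R|lebesgue. line_density x * \<bar>v x - c\<bar>) \<le> K1 * (LINT x:tail R|lebesgue. line_density x)"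
      if "1 \<le> R" for R
    proof -
      have R: "0 \<le> R" using that by simp
      show ?thesis
        using osc[OF arc_tail[OF R], of K1] K0[OF arc_tail[OF R]] unfolding vimage_arc_tail[OF R] by (auto simp: K1_def)
    qed
    show "\<exists>d>0. \<forall>a b. a < b \<and> (LINT x:{a..b}|lebesgue. line_density x) < d \<longrightarrow>
        (\<exists>c. (LINT x:{a..b}|lebesgue. line_density x * \<bar>v x - c\<bar>) \<le> e * (LINT x:{a..b}|lebesgue. line_density x))"
      if e: "0 < e" for e
    proof -
      obtain d where d: "0 < d" "\<And>I. I \<in> arcs \<Longrightarrow> measure arc_length I < d \<Longrightarrow> mean_oscillation arc_length I u < e"
        using u(3)[OF e] by blast
      have "\<exists>c. (LINT x:{a..b}|lebesgue. line_density x * \<bar>v x - c\<bar>) \<le> e * (LINT x:{a..b}|lebesgue. line_density x)"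
        if ab: "a < b" "(LINT x:{a..b}|lebesgue. line_density x) < d" for a b
      proof -
        have "measure arc_length (cis ` {pi + 2 * arctan a..pi + 2 * arctan b}) < d"
          using ab(2) unfolding measure_arc_line[OF arc_in_sets] vimage_arc_interval .
        from d(2)[OF arc_interval[OF ab(1)] this] show ?thesis
          using osc[OF arc_interval[OF ab(1)], of e] unfolding vimage_arc_interval by simp
      qed
      then show ?thesis using d(1) by blast
    qed
    show "g \<in> borel_measurable lebesgue"
    proof -
      have "h \<in> borel_measurable borel" using continuous_h by (rule borel_measurable_continuous_onI)
      then have "g \<in> borel_measurable lborel" unfolding g_def by measurable
      then show ?thesis by (rule measurable_completion)
    qed
    show "\<exists>d. \<forall>x\<in>{a..b}. \<bar>g x - d\<bar> \<le> B" if ab: "a < b" "tame a b" for a b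
    proof -
      obtain c where c: "\<And>x. x \<in> {a..b} \<Longrightarrow> \<bar>ln (1 + (h x)\<^sup>2) - c\<bar> \<le> max (ln 2) (ln (line.\<Lambda>\<^sup>2))"
        using line.tame_ln_h[OF ab(2,1)] by blast
      obtain d where d: "\<And>x. x \<in> {a..b} \<Longrightarrow> \<bar>ln (1 + x\<^sup>2) - d\<bar> \<le> ln 5"
        using tame_ln_square[OF ab(2)] by blast
      have "ln 5 \<le> ln (16::real)" by simp
      then have "\<bar>g x - (c - d)\<bar> \<le> B" if "x \<in> {a..b}" for x
        using c[OF that] d[OF that] unfolding g_def B_def by linarith
      then show ?thesis by blast
    qed
    show "\<exists>d. \<forall>x. R \<le> \<bar>x\<bar> \<and> \<bar>x\<bar> \<le> 4 * R \<longrightarrow> \<bar>g x - d\<bar> \<le> B" if R: "1 \<le> R" for R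
    proof -
      obtain c where c: "\<And>x. R \<le> \<bar>x\<bar> \<Longrightarrow> \<bar>x\<bar> \<le> 4 * R \<Longrightarrow> \<bar>ln (1 + (h x)\<^sup>2) - c\<bar> \<le> ln ((9 * D^3)\<^sup>2)"
        using line.annulus_ln_h[OF R] by blast
      obtain d where d: "\<And>x. R \<le> \<bar>x\<bar> \<Longrightarrow> \<bar>x\<bar> \<le> 4 * R \<Longrightarrow> \<bar>ln (1 + x\<^sup>2) - d\<bar> \<le> ln 16"
        using annulus_ln_square[OF R] by blast
      have "\<bar>g x - (c - d)\<bar> \<le> B" if "R \<le> \<bar>x\<bar>" "\<bar>x\<bar> \<le> 4 * R" for x
        using c[OF that] d[OF that] unfolding g_def B_def by linarith
      then show ?thesis by blast
    qed
    show "\<exists>d>0. \<forall>x y. \<bar>x - y\<bar> < d \<longrightarrow> \<bar>g x - g y\<bar> \<le> e" if e: "0 < e" for e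
    proof -
      \<comment> \<open>Half of e is left for each logarithm: the first is Hoelder with constant H
        and exponent \<alpha> at distances up to 1, the second is Lipschitz with constant 1.\<close>
      define d where "d = min 1 (min (e / 2) ((e / (2 * H)) powr (1 / \<alpha>)))"
      have d: "0 < d" using e H(1) by (simp add: d_def)
      have "\<bar>g x - g y\<bar> \<le> e" if xy: "\<bar>x - y\<bar> < d" for x y
      proof -
        have "\<bar>x - y\<bar> powr \<alpha> \<le> ((e / (2 * H)) powr (1 / \<alpha>)) powr \<alpha>"
          using xy \<alpha> by (intro powr_mono2) (auto simp: d_def)
        also have "\<dots> = e / (2 * H)" using e H(1) \<alpha> by (simp add: powr_powr)
        finally have "H * \<bar>x - y\<bar> powr \<alpha> \<le> e / 2" using H(1) by (simp add: field_simps)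
        then have "\<bar>ln (1 + (h x)\<^sup>2) - ln (1 + (h y)\<^sup>2)\<bar> \<le> e / 2"
          using H(2)[of x y] xy by (auto simp: d_def)
        moreover have "\<bar>ln (1 + x\<^sup>2) - ln (1 + y\<^sup>2)\<bar> \<le> e / 2"
          using ln_square_lipschitz[of x y] xy by (simp add: d_def)
        ultimately show ?thesis unfolding g_def by linarith
      qed
      then show ?thesis using d by blast
    qed
    show "0 \<le> K1" by (simp add: K1_def)
    show "0 \<le> B" unfolding B_def by (intro add_nonneg_nonneg) (simp_all add: le_max_iff_disj)
  qed
  \<comment> \<open>The product rule for \<open>ln\<close> enters here, and with it the positivity
    of p almost everywhere.\<close>
  moreover have "AE x in lebesgue. v x + g x = ln (deriv h x)"
    using aed aew line.AE_p_pos
  proof eventually_elim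
    case (elim x)
    have pos: "0 < 1 + (h x)\<^sup>2" "0 < 1 + x\<^sup>2" by (auto simp: add_pos_nonneg)
    have "w (cayley_line x) = p x * (1 + x\<^sup>2) / (1 + (h x)\<^sup>2)"
      using elim(2) pos by (simp add: line_density_def field_simps)
    then have "v x = ln (p x) + ln (1 + x\<^sup>2) - ln (1 + (h x)\<^sup>2)"
      using pos elim(3) by (simp add: v_def u_def ln_div ln_mult)
    then show ?case using elim(1) by (simp add: g_def)
  qed
  ultimately have "(\<lambda>x. ln (deriv h x)) \<in> VMO lebesgue intervals" by (rule VMO_cong_AE[rotated])
  then show ?thesis unfolding SS_line_def
    using strict_mono_h homeomorphism_h absolutely_continuous_h[OF ac] A by blast
qed

end

lemma to_line_SS_circle:
  assumes "\<phi> \<in> SS_circle" "\<phi> 1 = 1"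
  shows "to_line \<phi> \<in> SS_line"
proof -
  let ?w = "\<lambda>z. norm (circle_deriv \<phi> z)"
  have S: "\<exists>\<psi>. homeomorphism (sphere 0 1) (sphere 0 1) \<phi> \<psi>" "winding_number (\<phi> \<circ> circlepath 0 1) 0 = 1"
     "absolutely_continuous_on {0..2*pi} (\<lambda>t. \<phi> (cis t))" "A_infinity arc_length arcs ?w"
     "(\<lambda>z. ln (?w z)) \<in> VMO arc_length arcs"
    using assms(1) unfolding SS_circle_def by auto
  then obtain C \<alpha> where "0 < C" "0 < \<alpha>" "\<And>A E. A \<in> arcs \<Longrightarrow> E \<in> sets arc_length \<Longrightarrow> E \<subseteq> A \<Longrightarrow>
      (LINT z:E|arc_length. ?w z) / (LINT z:A|arc_length. ?w z) \<le> C * (measure arc_length E / measure arc_length A) powr \<alpha>"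
    unfolding A_infinity_def by blast
  then have "circle_A_infinity \<phi> ?w C \<alpha>"
    using S assms(2) unfolding A_infinity_def weight_def locally_integrable_def
    by unfold_locales auto
  then show ?thesis using S(5) by (rule circle_A_infinity.to_line_in_SS_line)
qed

section \<open>A strongly symmetric homeomorphism of the line that does not transfer\<close>

text \<open>The cubic term makes the derivative of the conjugated map vanish at 1. The linear term
  keeps h' >= 1: for x^3 alone, ln h' would have a logarithmic singularity at 0 and fail to be in
  VMO.\<close>

definition cubic :: "real \<Rightarrow> real" where "cubic x = x + x ^ 3"

lemma cubic_deriv: "(cubic has_real_derivative 1 + 3 * x\<^sup>2) (at x)"
  unfolding cubic_def by (auto intro!: derivative_eq_intros)

lemma deriv_cubic: "deriv cubic = (\<lambda>x. 1 + 3 * x\<^sup>2)"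
  using cubic_deriv DERIV_imp_deriv by blast

lemma cubic_diff: "cubic y - cubic x = (y - x) * (1 + x\<^sup>2 + x * y + y\<^sup>2)"
  by (simp add: cubic_def power2_eq_square power3_eq_cube algebra_simps)

lemma strict_mono_cubic: "strict_mono cubic"
proof (rule strict_monoI)
  fix x y :: real assume "x < y"
  have "0 \<le> (x + y)\<^sup>2" by simp
  then have "0 \<le> x\<^sup>2 + 2 * (x * y) + y\<^sup>2" by (simp add: power2_sum)
  moreover have "0 \<le> x\<^sup>2" "0 \<le> y\<^sup>2" by auto
  ultimately have "0 < 1 + x\<^sup>2 + x * y + y\<^sup>2" by linarith
  then have "0 < cubic y - cubic x" unfolding cubic_diff using \<open>x < y\<close> by simp
  then show "cubic x < cubic y" by simp
qed

lemma continuous_on_cubic: "continuous_on A cubic"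
  unfolding cubic_def by (intro continuous_intros)

lemma surj_cubic: "surj cubic"
  unfolding surj_def
proof
  fix y :: real
  have "0 \<le> \<bar>y\<bar> ^ 3" "cubic (- \<bar>y\<bar>) = - \<bar>y\<bar> - \<bar>y\<bar> ^ 3" by (auto simp: cubic_def)
  then have "cubic (- \<bar>y\<bar>) \<le> y" "y \<le> cubic \<bar>y\<bar>" unfolding cubic_def by linarith+
  then have "\<exists>x\<ge>- \<bar>y\<bar>. x \<le> \<bar>y\<bar> \<and> cubic x = y"
    by (intro IVT' continuous_on_cubic) auto
  then show "\<exists>x. y = cubic x" by metis
qed

lemma homeomorphism_cubic: "\<exists>g. homeomorphism UNIV UNIV cubic g"
proof -
  have "inj cubic" using strict_mono_cubic by (rule strict_mono_imp_inj_on)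
  then obtain g where "homeomorphism UNIV (cubic ` UNIV) cubic g"
    using invariance_of_domain_homeomorphism[OF open_UNIV continuous_on_cubic] by blast
  then show ?thesis using surj_cubic by auto
qed

lemma absolutely_continuous_on_id: "absolutely_continuous_on S (\<lambda>x. x)"
  unfolding absolutely_continuous_on_def
proof (intro allI impI)
  fix e :: real assume "0 < e"
  show "\<exists>d>0. \<forall>(n::nat) u v. (\<forall>i<n. u i \<le> v i \<and> {u i..v i} \<subseteq> S) \<and>
        (\<forall>i<n. \<forall>j<n. i \<noteq> j \<longrightarrow> {u i<..<v i} \<inter> {u j<..<v j} = {}) \<and>
        (\<Sum>i<n. v i - u i) < d \<longrightarrow> (\<Sum>i<n. dist (u i) (v i)) < e"
  proof (intro exI[of _ e] conjI allI impI \<open>0 < e\<close>)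
    fix n :: nat and u v :: "nat \<Rightarrow> real"
    assume *: "(\<forall>i<n. u i \<le> v i \<and> {u i..v i} \<subseteq> S) \<and>
        (\<forall>i<n. \<forall>j<n. i \<noteq> j \<longrightarrow> {u i<..<v i} \<inter> {u j<..<v j} = {}) \<and> (\<Sum>i<n. v i - u i) < e"
    have "(\<Sum>i<n. dist (u i) (v i)) = (\<Sum>i<n. v i - u i)"
      using * by (intro sum.cong) (auto simp: dist_real_def)
    then show "(\<Sum>i<n. dist (u i) (v i)) < e" using * by simp
  qed
qed

lemma absolutely_continuous_cubic: "absolutely_continuous_on {a..b} cubic"
proof (rule absolutely_continuous_on_Lipschitz[OF absolutely_continuous_on_id])
  define M where "M = max \<bar>a\<bar> \<bar>b\<bar>"
  show "0 < 1 + 3 * M\<^sup>2" by (simp add: add_pos_nonneg)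
  fix x y :: real assume "x \<in> {a..b}" "y \<in> {a..b}"
  then have xy: "\<bar>x\<bar> \<le> M" "\<bar>y\<bar> \<le> M" unfolding M_def by auto
  have "\<bar>1 + y\<^sup>2 + y * x + x\<^sup>2\<bar> \<le> 1 + \<bar>y\<bar> * \<bar>y\<bar> + \<bar>y\<bar> * \<bar>x\<bar> + \<bar>x\<bar> * \<bar>x\<bar>"
    using abs_ge_self[of "y * x"] abs_ge_minus_self[of "y * x"]
    by (simp add: power2_eq_square abs_mult abs_le_iff)
       (smt (verit) mult_nonneg_nonneg zero_le_square)
  also have "\<dots> \<le> 1 + M * M + M * M + M * M"
    using xy by (intro add_mono mult_mono) auto
  finally have "\<bar>x - y\<bar> * \<bar>1 + y\<^sup>2 + y * x + x\<^sup>2\<bar> \<le> \<bar>x - y\<bar> * (1 + 3 * M\<^sup>2)"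
    by (intro mult_left_mono) (auto simp: power2_eq_square)
  then show "dist (cubic x) (cubic y) \<le> (1 + 3 * M\<^sup>2) * dist x y"
    unfolding dist_real_def cubic_diff abs_mult by (simp add: mult.commute)
qed

text \<open>The mean of h' over [a, b] is 1 + a^2 + a b + b^2, at least a quarter of the maximum 1 +
  3 M^2 there; so C = 4 and exponent 1 suffice.\<close>

lemma A_infinity_cubic: "A_infinity lebesgue intervals (deriv cubic)"
proof -
  obtain p where "indefinite_integral p cubic"
    using mono_absolutely_continuous_density[OF strict_mono_mono[OF strict_mono_cubic] absolutely_continuous_cubic] by blast
  then interpret p: indefinite_integral p cubic .
  have ae: "AE x in lebesgue. p x = deriv cubic x" using p.AE_has_derivative by (rule AE_lebesgue_deriv)
  have pm: "p \<in> borel_measurable lebesgue" using p.borel by (simp add: measurable_completion)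
  have m: "deriv cubic \<in> borel_measurable lebesgue" using pm ae by (rule borel_measurable_lebesgue_AE)
  have int: "set_integrable lebesgue {a..b} (deriv cubic)" for a b
    using set_integral_cong_AE_lebesgue(2)[OF ae pm, of "{a..b}"] p.set_integrable_Icc by simp
  have LINT: "(LINT x:{a..b}|lebesgue. deriv cubic x) = cubic b - cubic a" if "a \<le> b" for a b
    using set_integral_cong_AE_lebesgue(1)[OF ae pm, of "{a..b}"] p.LINT_Icc[OF that] by simp
  have pos: "0 < cubic b - cubic a" if "a < b" for a b using strict_mono_cubic that by (simp add: strict_mono_less)
  show ?thesis
    unfolding A_infinity_def weight_def locally_integrable_def
  proof (intro conjI)
    show "\<exists>C>0. \<exists>\<alpha>>0. \<forall>I\<in>intervals. \<forall>E\<in>sets lebesgue. E \<subseteq> I \<longrightarrow>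
      (LINT x:E|lebesgue. deriv cubic x) / (LINT x:I|lebesgue. deriv cubic x) \<le> C * (measure lebesgue E / measure lebesgue I) powr \<alpha>"
    proof (intro exI conjI ballI impI)
      show "(0::real) < 4" "(0::real) < 1" by auto
      fix I E assume *: "I \<in> intervals" "E \<in> sets lebesgue" "E \<subseteq> I"
      then obtain a b where I: "I = {a..b}" "a < b" by (auto simp: intervals_def)
      define M where "M = max \<bar>a\<bar> \<bar>b\<bar>"
      have Em: "E \<in> lmeasurable" using measure_Icc_subset[of E a b] * I by auto
      have "(LINT x:E|lebesgue. deriv cubic x) \<le> (LINT x:E|lebesgue. 1 + 3 * M\<^sup>2)"
      proof (rule set_integral_mono)
        show "set_integrable lebesgue E (deriv cubic)"
          using set_integrable_subset[OF int *(2)] *(3) I by blast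
        show "set_integrable lebesgue E (\<lambda>x. 1 + 3 * M\<^sup>2)" using Em by (rule set_integral_const_lebesgue)
        fix x assume "x \<in> E"
        then have "x \<in> {a..b}" using *(3) I(1) by blast
        then have "\<bar>x\<bar> \<le> \<bar>M\<bar>" unfolding M_def by auto
        then have "x\<^sup>2 \<le> M\<^sup>2" by (simp only: abs_le_square_iff)
        then show "deriv cubic x \<le> 1 + 3 * M\<^sup>2" by (simp add: deriv_cubic)
      qed
      also have "\<dots> = (1 + 3 * M\<^sup>2) * measure lebesgue E" using Em by (rule set_integral_const_lebesgue)
      also have "\<dots> \<le> (4 * (1 + a\<^sup>2 + a * b + b\<^sup>2)) * measure lebesgue E"
      proof (rule mult_right_mono)
        \<comment> \<open>If M^2 = a^2, the difference of the two sides of the claim is 3 + (a + 2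
          b)^2; symmetrically for b.\<close>
        have "M\<^sup>2 = a\<^sup>2 \<or> M\<^sup>2 = b\<^sup>2" unfolding M_def max_def by auto
        moreover have "0 \<le> (2 * a + b)\<^sup>2" "0 \<le> (a + 2 * b)\<^sup>2" by auto
        ultimately show "1 + 3 * M\<^sup>2 \<le> 4 * (1 + a\<^sup>2 + a * b + b\<^sup>2)"
          by (auto simp: power2_eq_square algebra_simps)
      qed simp
      finally have "(b - a) * (LINT x:E|lebesgue. deriv cubic x) \<le> (b - a) * ((4 * (1 + a\<^sup>2 + a * b + b\<^sup>2)) * measure lebesgue E)"
        using I by (intro mult_left_mono) auto
      also have "\<dots> = 4 * measure lebesgue E * (cubic b - cubic a)" by (simp add: cubic_diff)
      finally have "(LINT x:E|lebesgue. deriv cubic x) \<le> 4 * (measure lebesgue E / (b - a)) * (cubic b - cubic a)"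
        using I by (simp add: field_simps)
      then have "(LINT x:E|lebesgue. deriv cubic x) / (cubic b - cubic a) \<le> 4 * (measure lebesgue E / (b - a))"
        using pos[OF I(2)] by (simp add: pos_divide_le_eq)
      then show "(LINT x:E|lebesgue. deriv cubic x) / (LINT x:I|lebesgue. deriv cubic x) \<le> 4 * (measure lebesgue E / measure lebesgue I) powr 1"
        using I LINT[of a b] by simp
    qed
  qed (use m int LINT pos in \<open>auto simp: intervals_def deriv_cubic add_nonneg_nonneg\<close>)
qed

text \<open>The criterion is applied with v = 0. Staying within ln 3 of ln (1 + x^2), the function
  ln (1 + 3 x^2) shares its bounded oscillation; scaling the variable by sqrt 3 gives the Lipschitz
  bound.\<close>

lemma VMO_ln_deriv_cubic: "(\<lambda>x. ln (deriv cubic x)) \<in> VMO lebesgue intervals"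
proof -
  define g where "g x = ln (1 + 3 * x\<^sup>2)" for x :: real
  have near: "\<bar>g x - ln (1 + x\<^sup>2)\<bar> \<le> ln 3" for x
  proof -
    have pos: "0 < 1 + x\<^sup>2" "0 < 1 + 3 * x\<^sup>2" by (auto simp: add_pos_nonneg)
    have "ln (1 + x\<^sup>2) \<le> g x" "g x \<le> ln (3 * (1 + x\<^sup>2))"
      unfolding g_def using pos by (subst ln_le_cancel_iff; simp)+
    moreover have "ln (3 * (1 + x\<^sup>2)) = ln 3 + ln (1 + x\<^sup>2)" using pos by (subst ln_mult) auto
    ultimately show ?thesis by linarith
  qed
  have "(\<lambda>x. 0 + g x) \<in> VMO lebesgue intervals"
  proof (rule VMO_line_criterion[where K = 0 and B = "ln 3 + ln 16"])
    show "g \<in> borel_measurable lebesgue"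
      unfolding g_def by (rule measurable_completion) measurable
    show "\<exists>d. \<forall>x\<in>{a..b}. \<bar>g x - d\<bar> \<le> ln 3 + ln 16" if ab: "a < b" "tame a b" for a b
    proof -
      obtain d where d: "\<And>x. x \<in> {a..b} \<Longrightarrow> \<bar>ln (1 + x\<^sup>2) - d\<bar> \<le> ln 5" using tame_ln_square[OF ab(2)] by blast
      have "ln 5 \<le> ln (16::real)" by simp
      then have "\<bar>g x - d\<bar> \<le> ln 3 + ln 16" if "x \<in> {a..b}" for x using d[OF that] near[of x] by linarith
      then show ?thesis by blast
    qed
    show "\<exists>d. \<forall>x. R \<le> \<bar>x\<bar> \<and> \<bar>x\<bar> \<le> 4 * R \<longrightarrow> \<bar>g x - d\<bar> \<le> ln 3 + ln 16" if R: "1 \<le> R" for R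
    proof -
      obtain d where d: "\<And>x. R \<le> \<bar>x\<bar> \<Longrightarrow> \<bar>x\<bar> \<le> 4 * R \<Longrightarrow> \<bar>ln (1 + x\<^sup>2) - d\<bar> \<le> ln 16"
        using annulus_ln_square[OF R] by blast
      have "\<bar>g x - d\<bar> \<le> ln 3 + ln 16" if "R \<le> \<bar>x\<bar>" "\<bar>x\<bar> \<le> 4 * R" for x using d[OF that] near[of x] by linarith
      then show ?thesis by blast
    qed
    show "\<exists>d>0. \<forall>x y. \<bar>x - y\<bar> < d \<longrightarrow> \<bar>g x - g y\<bar> \<le> e" if e: "0 < e" for e
    proof (intro exI[of _ "e / 2"] conjI allI impI)
      fix x y :: real assume xy: "\<bar>x - y\<bar> < e / 2"
      have "\<bar>g x - g y\<bar> \<le> \<bar>sqrt 3 * x - sqrt 3 * y\<bar>"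
        using ln_square_lipschitz[of "sqrt 3 * x" "sqrt 3 * y"] by (simp add: g_def power_mult_distrib)
      also have "\<dots> = sqrt 3 * \<bar>x - y\<bar>" by (simp only: right_diff_distrib[symmetric] abs_mult) simp
      also have "\<dots> \<le> 2 * \<bar>x - y\<bar>" by (intro mult_right_mono real_le_lsqrt) auto
      also have "\<dots> \<le> e" using xy by simp
      finally show "\<bar>g x - g y\<bar> \<le> e" .
    qed (use e in simp)
    show "(0::real) \<le> ln 3 + ln 16" by (intro add_nonneg_nonneg) auto
    show "\<exists>d>0. \<forall>a b. a < b \<and> (LINT x:{a..b}|lebesgue. line_density x) < d \<longrightarrow>
        (\<exists>c. (LINT x:{a..b}|lebesgue. line_density x * \<bar>0 - c\<bar>) \<le> e * (LINT x:{a..b}|lebesgue. line_density x))"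
      if e: "0 < e" for e
      using e by (intro exI[of _ 1] conjI allI impI exI[of _ 0])
        (auto intro!: mult_nonneg_nonneg set_integral_nonneg_on less_imp_le[OF line_density_pos])
  qed (auto intro!: exI[of _ 0])
  then show ?thesis by (simp add: deriv_cubic g_def)
qed

lemma cubic_SS_line: "cubic \<in> SS_line"
  unfolding SS_line_def
  using strict_mono_cubic homeomorphism_cubic absolutely_continuous_cubic A_infinity_cubic VMO_ln_deriv_cubic by blast

section \<open>The conjugated cubic map near 1\<close>

lemma to_circle_cayley_line: "to_circle h (cayley_line x) = cayley_line (h x)"
  unfolding to_circle_def using cayley_line_neq_1 by (simp add: inv_f_f[OF inj_cayley_line])

text \<open>With y = x^2 the norm is (1 + 3 y) (1 + y) / (1 + y (1 + y)^2), asymptotic to 3 / y, and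
  2 and 4 enclose the limit 3. As |z - 1| is about 2 / |x|, this is quadratic vanishing at
  1.\<close>

lemma norm_circle_deriv_cubic_bounds:
  assumes "2 \<le> \<bar>x\<bar>"
  shows "2 / x\<^sup>2 \<le> norm (circle_deriv (to_circle cubic) (cayley_line x))"
    and "norm (circle_deriv (to_circle cubic) (cayley_line x)) \<le> 4 / x\<^sup>2"
proof -
  define y where "y = x\<^sup>2"
  have "2\<^sup>2 \<le> \<bar>x\<bar>\<^sup>2" using assms by (intro power_mono) auto
  then have y: "4 \<le> y" by (simp add: y_def)
  have c2: "(cubic x)\<^sup>2 = y + 2 * y\<^sup>2 + y ^ 3"
    by (simp add: cubic_def y_def power2_eq_square power3_eq_cube algebra_simps)
  have pos: "0 < 1 + y + 2 * y\<^sup>2 + y ^ 3" using y by (simp add: add_pos_nonneg)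
  have "norm (circle_deriv (to_circle cubic) (cayley_line x)) = \<bar>1 + 3 * x\<^sup>2\<bar> * line_density (cubic x) / line_density x"
    by (rule norm_circle_deriv[OF to_circle_cayley_line cubic_deriv])
  also have "\<dots> = \<bar>1 + 3 * y\<bar> * (2 / (1 + y + 2 * y\<^sup>2 + y ^ 3)) / (2 / (1 + y))"
    unfolding line_density_def c2 y_def[symmetric] by (simp add: add.assoc)
  also have "\<dots> = (1 + 3 * y) * (1 + y) / (1 + y + 2 * y\<^sup>2 + y ^ 3)"
  proof -
    have "a * (2 / P) / (2 / Q) = a * Q / P" for a P Q :: real by simp
    moreover have "\<bar>1 + 3 * y\<bar> = 1 + 3 * y" using y by simp
    ultimately show ?thesis by (simp only:)
  qed
  finally have eq: "norm (circle_deriv (to_circle cubic) (cayley_line x)) = (1 + 3 * y) * (1 + y) / (1 + y + 2 * y\<^sup>2 + y ^ 3)" .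
  have "2 * (1 + y + 2 * y\<^sup>2 + y ^ 3) \<le> (1 + 3 * y) * (1 + y) * y"
  proof -
    have "4 * 4 * y \<le> y * y * y" using y by (intro mult_right_mono mult_mono) auto
    then have "y + 2 \<le> y * (y * y)" using y by linarith
    then show ?thesis using y by (simp add: power2_eq_square power3_eq_cube algebra_simps)
  qed
  then show "2 / x\<^sup>2 \<le> norm (circle_deriv (to_circle cubic) (cayley_line x))"
    unfolding eq y_def[symmetric] using pos y by (simp add: pos_divide_le_eq pos_le_divide_eq mult.commute)
  have "(1 + 3 * y) * (1 + y) * y \<le> 4 * (1 + y + 2 * y\<^sup>2 + y ^ 3)"
    using y by (simp add: power2_eq_square power3_eq_cube algebra_simps)
  then show "norm (circle_deriv (to_circle cubic) (cayley_line x)) \<le> 4 / x\<^sup>2"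
    unfolding eq y_def[symmetric] using pos y by (simp add: pos_divide_le_eq pos_le_divide_eq mult.commute)
qed

lemma in_arc_interval:
  assumes "z \<in> cis ` {pi + 2 * arctan a..pi + 2 * arctan b}"
  obtains x where "z = cayley_line x" "a \<le> x" "x \<le> b"
proof -
  obtain t where t: "z = cis t" "pi + 2 * arctan a \<le> t" "t \<le> pi + 2 * arctan b" using assms by auto
  define x where "x = tan ((t - pi) / 2)"
  have "arctan x = (t - pi) / 2"
    unfolding x_def using t arctan_bounded[of a] arctan_bounded[of b] by (intro arctan_tan) auto
  then have "pi + 2 * arctan x = t" by simp
  then have "z = cayley_line x" "arctan a \<le> arctan x" "arctan x \<le> arctan b"
    using t by (auto simp: cayley_line_eq_cis)
  then show thesis using that by (simp add: arctan_le_iff)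
qed

lemma set_integral_arc_ge:
  assumes f: "set_integrable arc_length A f" "\<And>z. z \<in> A \<Longrightarrow> 0 \<le> f z"
    and B: "B = cis ` {a..b}" "B \<subseteq> A" "a \<le> b" "b \<le> a + 2 * pi" and c: "\<And>z. z \<in> B \<Longrightarrow> c \<le> f z"
  shows "c * (b - a) \<le> (LINT z:A|arc_length. f z)"
proof -
  have Bs: "B \<in> sets arc_length" using B by simp
  have fin: "emeasure arc_length B < \<infinity>" using B by (simp add: emeasure_arc_length_arc)
  have "c * (b - a) = (LINT z:B|arc_length. c)"
    unfolding set_lebesgue_integral_def
    using sets.sets_into_space[OF Bs] B by (simp add: Int_absorb2 measure_arc_length_arc)
  also have "\<dots> \<le> (LINT z:B|arc_length. f z)"
    using set_integrable_subset[OF f(1) Bs B(2)] c Bs fin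
    by (intro set_integral_mono) (auto simp: set_integrable_def intro!: integrable_mult_left)
  also have "\<dots> \<le> (LINT z:A|arc_length. f z)"
    using f Bs B(2) by (intro set_integral_mono_set_nonneg) auto
  finally show ?thesis .
qed

text \<open>The arc A, the image of (-\<infinity>, -X] with 1 adjoined, shrinks to 1 as X grows. Its
  pieces over [-8 X, -4 X] and [-2 X, -X] fill a fixed share of it, and u differs by at least ln 2
  between them; so whatever the mean m, on one of the pieces u keeps distance ln 2 / 2 from
  it.\<close>

lemma to_circle_cubic_not_VMO:
  "(\<lambda>z. ln (norm (circle_deriv (to_circle cubic) z))) \<notin> VMO arc_length arcs"
proof
  define u where "u z = ln (norm (circle_deriv (to_circle cubic) z))" for z
  assume "(\<lambda>z. ln (norm (circle_deriv (to_circle cubic) z))) \<in> VMO arc_length arcs"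
  then have u: "locally_integrable arc_length arcs u"
     "\<And>e. 0 < e \<Longrightarrow> \<exists>d>0. \<forall>I\<in>arcs. measure arc_length I < d \<longrightarrow> mean_oscillation arc_length I u < e"
    unfolding VMO_def BMO_def u_def by auto
  \<comment> \<open>Either piece has arc length at least 1 / (10 X) and A has length s <= 2 / X; ln
    2 / 2 times 1 / (10 X) equals ln 2 / 40 times 2 / X.\<close>
  have "0 < ln (2::real) / 40" by simp
  then obtain d where d: "0 < d" "\<And>I. I \<in> arcs \<Longrightarrow> measure arc_length I < d \<Longrightarrow> mean_oscillation arc_length I u < ln 2 / 40"
    using u(2) by blast
  \<comment> \<open>X >= 2 brings the derivative bounds into force, X >= 3 / d makes 2 / X <
    d.\<close>
  define X where "X = max 2 (3 / d)"
  have X: "2 \<le> X" "2 / X < d"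
  proof -
    show "2 \<le> X" by (simp add: X_def)
    have "3 / d \<le> X" by (simp add: X_def)
    then show "2 / X < d" using d(1) \<open>2 \<le> X\<close> by (simp add: field_simps)
  qed
  define s where "s = pi + 2 * arctan (- X)"
  define A where "A = cis ` {0..s}"
  have s: "0 < s" "s < 2 * pi" "s \<le> 2 / X"
    using arctan_bounded[of X] two_arctan_le[of X] X by (auto simp: s_def arctan_minus)
  have A: "A \<in> arcs" "measure arc_length A = s" unfolding A_def using s by (auto intro: arcI simp: measure_arc_length_arc)
  have ui: "set_integrable arc_length A u" using u(1) A(1) unfolding locally_integrable_def by blast
  define m where "m = mean arc_length A u"
  have fi: "set_integrable arc_length A (\<lambda>z. \<bar>u z - m\<bar>)"
  proof (intro set_integrable_abs set_integral_diff(1) ui)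
    show "set_integrable arc_length A (\<lambda>z. m)"
      unfolding A_def set_integrable_def using s by (auto intro!: integrable_mult_left simp: emeasure_arc_length_arc)
  qed
  have "mean_oscillation arc_length A u < ln 2 / 40" using d(2) A s X by auto
  then have upper: "(LINT z:A|arc_length. \<bar>u z - m\<bar>) < ln 2 / 40 * s"
    unfolding mean_oscillation_def m_def[symmetric] using s A by (subst (asm) mean_def) (simp add: pos_divide_less_eq)
  have lower: "c * (2 * (arctan (- a) - arctan (- b))) \<le> (LINT z:A|arc_length. \<bar>u z - m\<bar>)"
    if ab: "X \<le> a" "a < b" and c: "\<And>x. - b \<le> x \<Longrightarrow> x \<le> - a \<Longrightarrow> c \<le> \<bar>u (cayley_line x) - m\<bar>" for a b c
  proof -
    let ?B = "cis ` {pi + 2 * arctan (- b)..pi + 2 * arctan (- a)}"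
    have lt: "arctan (- b) < arctan (- a)" "arctan (- a) \<le> arctan (- X)" using ab by (auto simp: arctan_less_iff arctan_le_iff)
    have "c * ((pi + 2 * arctan (- a)) - (pi + 2 * arctan (- b))) \<le> (LINT z:A|arc_length. \<bar>u z - m\<bar>)"
    proof (rule set_integral_arc_ge[OF fi _ refl])
      show "?B \<subseteq> A" unfolding A_def s_def using arctan_bounded[of "- b"] lt by (intro image_mono) auto
      show "pi + 2 * arctan (- a) \<le> pi + 2 * arctan (- b) + 2 * pi"
        using arctan_bounded[of "- a"] arctan_bounded[of "- b"] by auto
      fix z assume "z \<in> ?B"
      then obtain x where "z = cayley_line x" "- b \<le> x" "x \<le> - a" by (rule in_arc_interval)
      then show "c \<le> \<bar>u z - m\<bar>" using c by simp
    qed (use lt in auto)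
    then show ?thesis by (simp add: algebra_simps)
  qed
  \<comment> \<open>The upper bound for u where |x| >= 4 X, from 4 / (4 X)^2. For |x| <= 2 X the
    lower bound 2 / (2 X)^2 for the derivative is twice that number.\<close>
  define U where "U = ln (1 / (4 * X\<^sup>2))"
  have far: "u (cayley_line x) \<le> U" if x: "- (8 * X) \<le> x" "x \<le> - (4 * X)" for x
  proof -
    have "(4 * X)\<^sup>2 \<le> (- x)\<^sup>2" using x X by (intro power_mono) auto
    then have x2: "16 * X\<^sup>2 \<le> x\<^sup>2" by (simp add: power_mult_distrib)
    have "4 / x\<^sup>2 \<le> 4 / (16 * X\<^sup>2)" using x2 X by (intro divide_left_mono) (auto intro!: mult_pos_pos)
    then have "norm (circle_deriv (to_circle cubic) (cayley_line x)) \<le> 1 / (4 * X\<^sup>2)"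
      using norm_circle_deriv_cubic_bounds(2)[of x] x X by simp
    moreover have "0 < 2 / x\<^sup>2" using x X by auto
    then have "0 < norm (circle_deriv (to_circle cubic) (cayley_line x))"
      using norm_circle_deriv_cubic_bounds(1)[of x] x X by linarith
    ultimately show ?thesis unfolding u_def U_def by (intro ln_mono)
  qed
  have near: "U + ln 2 \<le> u (cayley_line x)" if x: "- (2 * X) \<le> x" "x \<le> - X" for x
  proof -
    have "(- x)\<^sup>2 \<le> (2 * X)\<^sup>2" using x X by (intro power_mono) auto
    then have x2: "x\<^sup>2 \<le> 4 * X\<^sup>2" by (simp add: power_mult_distrib)
    have "0 < x\<^sup>2" using x X by auto
    then have "2 / (4 * X\<^sup>2) \<le> 2 / x\<^sup>2" using x2 X by (intro divide_left_mono) (auto intro!: mult_pos_pos)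
    then have le: "2 / (4 * X\<^sup>2) \<le> norm (circle_deriv (to_circle cubic) (cayley_line x))"
      using norm_circle_deriv_cubic_bounds(1)[of x] x X by linarith
    have pos: "0 < 2 / (4 * X\<^sup>2)" using X by simp
    then have "ln (2 / (4 * X\<^sup>2)) \<le> u (cayley_line x)"
      unfolding u_def using le by (intro ln_mono) auto
    moreover have "ln (2 / (4 * X\<^sup>2)) = U + ln 2"
    proof -
      have "2 / (4 * X\<^sup>2) = (1 / (4 * X\<^sup>2)) * 2" by simp
      then show ?thesis unfolding U_def using X by (simp only:) (subst ln_mult, auto)
    qed
    ultimately show ?thesis by (simp only:)
  qed
  have "ln 2 / 40 * s \<le> (LINT z:A|arc_length. \<bar>u z - m\<bar>)"
  proof (cases "U + ln 2 / 2 \<le> m")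
    case True
    have "ln 2 / 2 * (2 * (arctan (- (4 * X)) - arctan (- (8 * X)))) \<le> (LINT z:A|arc_length. \<bar>u z - m\<bar>)"
    proof (rule lower)
      fix x assume "- (8 * X) \<le> x" "x \<le> - (4 * X)"
      then show "ln 2 / 2 \<le> \<bar>u (cayley_line x) - m\<bar>" using far[of x] True by linarith
    qed (use X in auto)
    moreover have "1 / (20 * X) \<le> arctan (- (4 * X)) - arctan (- (8 * X))"
    proof -
      have "(8 * X - 4 * X) / (1 + (8 * X)\<^sup>2) \<le> arctan (8 * X) - arctan (4 * X)" using X by (intro arctan_diff_ge) auto
      moreover have "1 / (20 * X) \<le> (8 * X - 4 * X) / (1 + (8 * X)\<^sup>2)"
      proof -
        have "2 * 2 \<le> X * X" using X by (intro mult_mono) auto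
        then have "1 + (8 * X)\<^sup>2 \<le> 4 * X * (20 * X)" by (simp add: power2_eq_square)
        then show ?thesis using X by (simp add: pos_divide_le_eq pos_le_divide_eq add_pos_nonneg)
      qed
      ultimately show ?thesis by (simp add: arctan_minus)
    qed
    then have "ln 2 / 2 * (2 * (1 / (20 * X))) \<le> ln 2 / 2 * (2 * (arctan (- (4 * X)) - arctan (- (8 * X))))"
      by (intro mult_left_mono) auto
    moreover have "ln 2 / 40 * s \<le> ln 2 / 40 * (2 / X)" using s by (intro mult_left_mono) auto
    moreover have "ln 2 / 40 * (2 / X) = ln 2 / 2 * (2 * (1 / (20 * X)))" by simp
    ultimately show ?thesis by linarith
  next
    case False
    have "ln 2 / 2 * (2 * (arctan (- X) - arctan (- (2 * X)))) \<le> (LINT z:A|arc_length. \<bar>u z - m\<bar>)"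
    proof (rule lower)
      fix x assume "- (2 * X) \<le> x" "x \<le> - X"
      then show "ln 2 / 2 \<le> \<bar>u (cayley_line x) - m\<bar>" using near[of x] False by linarith
    qed (use X in auto)
    moreover have "1 / (20 * X) \<le> arctan (- X) - arctan (- (2 * X))"
    proof -
      have "(2 * X - X) / (1 + (2 * X)\<^sup>2) \<le> arctan (2 * X) - arctan X" using X by (intro arctan_diff_ge) auto
      moreover have "1 / (20 * X) \<le> (2 * X - X) / (1 + (2 * X)\<^sup>2)"
      proof -
        have "2 * 2 \<le> X * X" using X by (intro mult_mono) auto
        then have "1 + (2 * X)\<^sup>2 \<le> X * (20 * X)" by (simp add: power2_eq_square)
        then show ?thesis using X by (simp add: pos_divide_le_eq pos_le_divide_eq add_pos_nonneg)
      qed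
      ultimately show ?thesis by (simp add: arctan_minus)
    qed
    then have "ln 2 / 2 * (2 * (1 / (20 * X))) \<le> ln 2 / 2 * (2 * (arctan (- X) - arctan (- (2 * X))))"
      by (intro mult_left_mono) auto
    moreover have "ln 2 / 40 * s \<le> ln 2 / 40 * (2 / X)" using s by (intro mult_left_mono) auto
    moreover have "ln 2 / 40 * (2 / X) = ln 2 / 2 * (2 * (1 / (20 * X)))" by simp
    ultimately show ?thesis by linarith
  qed
  then show False using upper by linarith
qed

theorem theorem19:
  shows "(\<forall>\<phi>\<in>SS_circle. \<phi> 1 = 1 \<longrightarrow> to_line \<phi> \<in> SS_line) \<and>
         (\<exists>h\<in>SS_line. to_circle h \<notin> SS_circle)"
proof
  show "\<forall>\<phi>\<in>SS_circle. \<phi> 1 = 1 \<longrightarrow> to_line \<phi> \<in> SS_line"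
    using to_line_SS_circle by blast
  have "to_circle cubic \<notin> SS_circle"
    using to_circle_cubic_not_VMO unfolding SS_circle_def by blast
  then show "\<exists>h\<in>SS_line. to_circle h \<notin> SS_circle"
    using cubic_SS_line by blast
qed

end
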